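(* Let $X_1,\dots,X_n$ be independent real-valued random variables and let $\varepsilon \in (0,1/75)$. If $$ N_\infty\left((1-\varepsilon)\sum_{i=1}^n X_i\right) \leq \frac12 \sum_{i=1}^n N_\infty(X_i), $$ then there exist indices $i_0$ and $i_1$ such that $$ (1-37.5\,\varepsilon)^2\left(\frac12\sum_{i=1}^n N_\infty(X_i)\right) \leq N_\infty(X_{i_0}),\ N_\infty(X_{i_1}) \leq (1+2\varepsilon)^2\left(\frac12\sum_{i=1}^n N_\infty(X_i)\right), $$ while $$ \sum_{i\neq i_0,i_1} N_\infty(X_i) \leq 50\,\varepsilon \sum_{i=1}^n N_\infty(X_i). $$
   Context: For a real-valued random variable $X$, let $$ M(X) = \inf\{c : \mathbb{P}(X \in A) \leq c\,|A| \text{ for all Borel } A \subseteq \mathbb{R}\}, $$ where $|A|$ is the Lebesgue measure of $A$. The min-entropy power of $X$ is $N_\infty(X) = M(X)^{-2}$ if $M(X)<\infty$, and $N_\infty(X)=0$ otherwise. When $X$ is absolutely continuous with density $f$, $M(X)=\|f\|_\infty$ is the essential supremum of $f$ with respect to Lebesgue measure. The two-term middle expression in the displayed chain of inequalities means that both $N_\infty(X_{i_0})$ and $N_\infty(X_{i_1})$ satisfy both bounds. *)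

theory Defs
  imports "HOL-Probability.Probability"
begin

text \<open>Taking c in the extended nonnegative reals loses nothing: a negative c never satisfies the
  condition, and \<open>c = \<infinity>\<close> does not change the infimum, which is \<open>\<infinity>\<close> when no finite c works.\<close>

definition max_density :: "'a measure \<Rightarrow> ('a \<Rightarrow> real) \<Rightarrow> ennreal" where
  "max_density P X =
     Inf {c. \<forall>A \<in> sets (borel :: real measure).
               emeasure P {\<omega> \<in> space P. X \<omega> \<in> A} \<le> c * emeasure lborel A}"

definition min_entropy_power :: "'a measure \<Rightarrow> ('a \<Rightarrow> real) \<Rightarrow> real" where
  "min_entropy_power P X =
     (if max_density P X < \<infinity> then 1 / (enn2real (max_density P X))\<^sup>2 else 0)"

end

theory Submission
  imports Defs "HOL-Real_Asymp.Real_Asymp"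
begin

text \<open>If \<open>X\<^sub>i\<close> has density at most \<open>1 / w\<^sub>i\<close>, then the concentration function of the sum is at most
  that of a sum of independent variables uniform on intervals of length \<open>w\<^sub>i\<close>. This is proved by
  adding one summand at a time, for test functions with values in \<open>[0, 1]\<close>: quantiles of the new summand
  and of the test function cut the plane into thin hooks, and the previous estimate applies to each hook.

  The problem becomes a stability version of Ball's cube slicing theorem: with
  \<open>\<Sum>w\<^sub>i\<^sup>2 = 1\<close>, the peak \<open>2 / \<pi> \<integral>\<^sub>0\<^sup>\<infinity> \<Prod> sinc (w\<^sub>i t) dt\<close> of the density of the uniform sum is
  close to \<open>\<surd>2\<close> only if two weights are close to \<open>1 / \<surd>2\<close>. If all \<open>w\<^sub>i\<^sup>2\<close> are at most
  \<open>2 / 5\<close>, weighted AM-GM reduces the integral to those of single powers \<open>\<bar>sinc\<bar>\<^sup>p\<close> with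
  \<open>p \<ge> 5 / 2\<close>. If one weight is large but the two largest do not dominate, a Gaussian bound controls the
  main part, and the product is negative just after its first zero. If the two largest weights dominate, they
  convolve to a trapezoid, and Ball's bound is applied to the remaining weights.\<close>

section \<open>Convolutions of uniform distributions on intervals\<close>

text \<open>The hypothesis yields a normalised peak of at least
  \<open>sqrt 2 * (1 - \<epsilon>)\<close>. The value \<open>sqrt 2\<close> is attained by two equal
  weights, where weighted AM-GM is sharp: both exponents are 2 and the integral of
  \<open>csinc\<close> squared gives exactly \<open>sqrt 2\<close>. Absolute integral estimates thus
  have no room near this configuration, and an argument on the real side takes over. It produces the
  deficit \<open>1 - d / 27\<close>, with \<open>d\<close> the squared weight outside the two
  largest, and hence \<open>d \<le> 27 * \<epsilon>\<close>. Elsewhere the integrals only have to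
  beat the fixed factor \<open>74 / 75\<close>; this is what the range of \<epsilon> buys. The
  border \<open>d = 21 / 100\<close> keeps \<open>sqrt d\<close> below \<open>46 / 100\<close>,
  small enough for the deficit inequality, while a larger \<open>d\<close> supplies enough Gaussian
  decay. The largest weight may be taken with \<open>w1\<^sup>2 \<le> 5137 / 10000\<close>, since
  beyond that the trivial peak bound \<open>1 / w1\<close> is already below
  \<open>sqrt 2 * (74 / 75)\<close>. The real-side argument needs Ball's inequality for the
  remaining weights, a shorter list, so Ball's inequality and its stability version rest on one case
  analysis.\<close>

definition odd_concave :: "(real \<Rightarrow> real) \<Rightarrow> bool" where
  "odd_concave g \<longleftrightarrow> continuous_on UNIV g \<and> (\<forall>v. g (- v) = - g v) \<and> mono g \<and> (\<forall>v. g v \<le> 1) \<and>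
     (\<forall>z\<ge>0. \<forall>s\<ge>0. g (z + s) + g (z - s) \<le> 2 * g z)"

definition window_avg :: "real \<Rightarrow> (real \<Rightarrow> real) \<Rightarrow> real \<Rightarrow> real" where
  "window_avg w g v = integral {v - w..v + w} g / (2 * w)"

section \<open>Window integrals of odd functions\<close>

lemma integral_window_shift:
  fixes g :: "real \<Rightarrow> real"
  assumes "continuous_on UNIV g"
  shows "integral {v - w..v + w} g = integral {- w..w} (\<lambda>r. g (v + r))"
proof -
  have "integral {- w..w} (g \<circ> (\<lambda>x. x + v)) = integral {- w + v..w + v} g"
    by (rule integral_shift) (use assms continuous_on_subset in blast)
  then show ?thesis by (simp add: o_def algebra_simps)
qed

lemma integral_odd:
  fixes h :: "real \<Rightarrow> real"
  assumes "\<And>x. h (- x) = - h x"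
  shows "integral {- c..c} h = 0"
proof -
  have "integral {- c..c} h = integral {- c..c} (\<lambda>x. h (- x))"
    using Henstock_Kurzweil_Integration.integral_reflect_real[of c "-c" h] by simp
  also have "\<dots> = - integral {- c..c} h" by (simp add: assms)
  finally show ?thesis by simp
qed

text \<open>The two windows differ by the interval between \<open>v - w\<close> and
  \<open>w - v\<close>, which is symmetric about 0 and contributes nothing. Centre and radius of a
  window can therefore be exchanged.\<close>

lemma integral_odd_window_swap:
  fixes g :: "real \<Rightarrow> real"
  assumes c: "continuous_on UNIV g" and o: "\<And>x. g (- x) = - g x" and "0 \<le> v" "0 \<le> w"
  shows "integral {v - w..v + w} g = integral {w - v..w + v} g"
proof -
  have i: "g integrable_on {a..b}" for a b
    by (rule integrable_continuous_real) (use c continuous_on_subset in blast)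
  have *: "integral {v - w..v + w} g = integral {w - v..w + v} g" if "0 \<le> v" "v \<le> w" for v w
  proof -
    have "integral {v - w..w - v} g + integral {w - v..v + w} g = integral {v - w..v + w} g"
      by (rule Henstock_Kurzweil_Integration.integral_combine) (use that i in auto)
    moreover have "integral {v - w..w - v} g = 0"
      using integral_odd[of g "w - v", OF o] by simp
    ultimately show ?thesis by (simp add: add.commute)
  qed
  show ?thesis using *[of v w] *[of w v] assms by (cases "v \<le> w") (auto simp: add.commute)
qed

text \<open>A window centred at \<open>z \<ge> 0\<close> that crosses 0 is replaced by the one with
  centre and radius exchanged, which lies in the half-line where \<open>h \<le> 0\<close>.\<close>

lemma integral_odd_window_nonpos:
  fixes h :: "real \<Rightarrow> real"
  assumes c: "continuous_on UNIV h" and o: "\<And>x. h (- x) = - h x" and n: "\<And>x. 0 \<le> x \<Longrightarrow> h x \<le> 0"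
    and "0 \<le> z" "0 \<le> w"
  shows "integral {z - w..z + w} h \<le> 0"
proof -
  have i: "h integrable_on {a..b}" for a b
    by (rule integrable_continuous_real) (use c continuous_on_subset in blast)
  have *: "integral {a..b} h \<le> 0" if "0 \<le> a" for a b
    using integral_le[OF i[of a b], of "\<lambda>_. 0"] n that by auto
  show ?thesis
    using *[of "z - w" "z + w"] *[of "w - z" "w + z"] integral_odd_window_swap[OF c o, of z w] assms
    by (cases "w \<le> z") auto
qed

text \<open>Once centre and radius are exchanged, the window is centred at \<open>w\<close> and its
  points pair up as \<open>w + r\<close> and \<open>w - r\<close>; the midpoint inequality at
  \<open>w\<close> bounds each pair by \<open>2 * g w\<close>. The constant \<open>g w / w\<close>
  is the slope of \<open>window_avg w g\<close> at 0, so the right side is a tangent line.\<close>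

lemma window_avg_le_slope:
  assumes g: "odd_concave g" and "0 < w" "0 \<le> v"
  shows "window_avg w g v \<le> v * g w / w"
proof -
  have c: "continuous_on UNIV g" and o: "\<And>x. g (- x) = - g x"
    and cc: "\<And>z s. 0 \<le> z \<Longrightarrow> 0 \<le> s \<Longrightarrow> g (z + s) + g (z - s) \<le> 2 * g z"
    using g by (auto simp: odd_concave_def)
  have ci: "(\<lambda>r. g (a + b * r)) integrable_on {p..q}" for a b p q
    by (intro integrable_continuous_real continuous_on_compose2[OF c] continuous_intros) auto
  have i1: "(\<lambda>r. g (w + r)) integrable_on {- v..v}" using ci[of w 1] by simp
  have i2: "(\<lambda>r. g (w - r)) integrable_on {- v..v}" using ci[of w "-1"] by simp
  have cc': "g (w + r) + g (w - r) \<le> 2 * g w" for r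
    using cc[of w r] cc[of w "-r"] assms(2) by (cases "0 \<le> r") auto
  have "integral {v - w..v + w} g = integral {w - v..w + v} g"
    by (rule integral_odd_window_swap[OF c o]) (use assms in auto)
  also have e: "\<dots> = integral {- v..v} (\<lambda>r. g (w + r))"
    by (rule integral_window_shift[OF c])
  finally have e1: "integral {v - w..v + w} g = integral {- v..v} (\<lambda>r. g (w + r))" .
  have e2: "integral {- v..v} (\<lambda>r. g (w + r)) = integral {- v..v} (\<lambda>r. g (w - r))"
    using Henstock_Kurzweil_Integration.integral_reflect_real[of v "-v" "\<lambda>r. g (w + r)"] by simp
  have "2 * integral {v - w..v + w} g = integral {- v..v} (\<lambda>r. g (w + r) + g (w - r))"
    using Henstock_Kurzweil_Integration.integral_add[OF i1 i2] e1 e2 by simp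
  also have "\<dots> \<le> integral {- v..v} (\<lambda>r. 2 * g w)"
    by (rule integral_le) (use i1 i2 cc' in \<open>auto intro!: integrable_add\<close>)
  also have "\<dots> = 4 * v * g w" using assms by simp
  finally have "integral {v - w..v + w} g \<le> 2 * v * g w" by simp
  then show ?thesis using assms by (simp add: window_avg_def field_simps)
qed

text \<open>This closure property is why the midpoint inequality in \<open>odd_concave\<close> also
  admits \<open>s > z\<close>: for fixed \<open>s\<close> the second difference of \<open>g\<close>
  is an odd function that is nonpositive on the whole half-line, so its average over a window
  centred at \<open>z \<ge> 0\<close> keeps the sign. For a continuous odd function the inequality
  amounts to concavity on the half-line.\<close>

lemma odd_concave_window_avg:
  assumes g: "odd_concave g" and w: "0 < w"
  shows "odd_concave (window_avg w g)"
proof -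
  have c: "continuous_on UNIV g" and o: "\<And>x. g (- x) = - g x" and m: "mono g" and le: "\<And>v. g v \<le> 1"
    and cc: "\<And>z s. 0 \<le> z \<Longrightarrow> 0 \<le> s \<Longrightarrow> g (z + s) + g (z - s) \<le> 2 * g z"
    using g by (auto simp: odd_concave_def)
  have e: "window_avg w g v = integral {- w..w} (\<lambda>r. g (v + r)) / (2 * w)" for v
    by (simp add: window_avg_def integral_window_shift[OF c])
  have ci: "(\<lambda>r. g (a + r)) integrable_on {p..q}" for a p q
    by (intro integrable_continuous_real continuous_on_compose2[OF c] continuous_intros) auto
  have 1: "continuous_on UNIV (window_avg w g)"
  proof -
    have "continuous_on (UNIV \<times> cbox (- w) w) (\<lambda>(v, r). g (v + r))"
      unfolding case_prod_unfold
      by (intro continuous_on_compose2[OF c] continuous_intros) auto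
    from integral_continuous_on_param[OF this]
    have "continuous_on UNIV (\<lambda>v. integral {- w..w} (\<lambda>r. g (v + r)))" by simp
    then show ?thesis unfolding e[abs_def] by (intro continuous_intros) (use w in auto)
  qed
  have 2: "window_avg w g (- v) = - window_avg w g v" for v
  proof -
    have "integral {- w..w} (\<lambda>r. g (- v + r)) = integral {- w..w} (\<lambda>r. g (- v - r))"
      using Henstock_Kurzweil_Integration.integral_reflect_real[of w "-w" "\<lambda>r. g (- v + r)"] by simp
    also have "\<dots> = integral {- w..w} (\<lambda>r. - g (v + r))"
      using o[of "v + _"] by (simp add: o[symmetric])
    also have "\<dots> = - integral {- w..w} (\<lambda>r. g (v + r))" by simp
    finally show ?thesis by (simp add: e)
  qed
  have 3: "mono (window_avg w g)"
  proof (rule monoI)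
    fix x y :: real assume "x \<le> y"
    have "integral {- w..w} (\<lambda>r. g (x + r)) \<le> integral {- w..w} (\<lambda>r. g (y + r))"
      by (rule integral_le) (use ci \<open>x \<le> y\<close> m in \<open>auto intro: monoD\<close>)
    then show "window_avg w g x \<le> window_avg w g y" using w by (simp add: e field_simps)
  qed
  have 4: "window_avg w g v \<le> 1" for v
  proof -
    have "integral {- w..w} (\<lambda>r. g (v + r)) \<le> integral {- w..w} (\<lambda>r. 1)"
      by (rule integral_le) (use ci le in auto)
    then show ?thesis using w by (simp add: e field_simps)
  qed
  have 5: "window_avg w g (z + s) + window_avg w g (z - s) \<le> 2 * window_avg w g z"
    if zs: "0 \<le> z" "0 \<le> s" for z s
  proof -
    define h where "h y = g (y + s) + g (y - s) - 2 * g y" for y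
    have hc: "continuous_on UNIV h" unfolding h_def
      by (intro continuous_intros continuous_on_compose2[OF c]) auto
    have ho: "h (- x) = - h x" for x
    proof -
      have "- x + s = - (x - s)" "- x - s = - (x + s)" by auto
      then show ?thesis by (simp only: h_def o)
    qed
    have hn: "h x \<le> 0" if "0 \<le> x" for x
      using cc[of x s] that zs by (simp add: h_def)
    have "integral {z - w..z + w} h \<le> 0"
      by (rule integral_odd_window_nonpos[OF hc ho hn]) (use zs w in auto)
    also have "integral {z - w..z + w} h = integral {- w..w} (\<lambda>r. h (z + r))"
      by (rule integral_window_shift[OF hc])
    also have "\<dots> = integral {- w..w} (\<lambda>r. g (z + s + r)) + integral {- w..w} (\<lambda>r. g (z - s + r))
        - 2 * integral {- w..w} (\<lambda>r. g (z + r))"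
    proof -
      have "(\<lambda>r. h (z + r)) = (\<lambda>r. g (z + s + r) + g (z - s + r) - 2 * g (z + r))"
        by (simp add: h_def fun_eq_iff algebra_simps)
      then show ?thesis
        using ci[of "z + s" "-w" w] ci[of "z - s" "-w" w] ci[of z "-w" w]
        by (simp add: Henstock_Kurzweil_Integration.integral_diff Henstock_Kurzweil_Integration.integral_add
            integrable_add integrable_on_cmult_left)
    qed
    finally have "(integral {- w..w} (\<lambda>r. g (z + s + r)) + integral {- w..w} (\<lambda>r. g (z - s + r))) / (2 * w)
        \<le> 2 * integral {- w..w} (\<lambda>r. g (z + r)) / (2 * w)"
      using w by (intro divide_right_mono) auto
    then show ?thesis by (simp add: e add_divide_distrib)
  qed
  show ?thesis unfolding odd_concave_def using 1 2 3 4 5 by blast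
qed

lemma odd_concave_clamp:
  assumes w: "0 < w"
  shows "odd_concave (\<lambda>v. max (- 1) (min 1 (v / w)))"
  unfolding odd_concave_def
proof (intro conjI allI impI)
  show "continuous_on UNIV (\<lambda>v. max (- 1) (min 1 (v / w)))"
    by (intro continuous_intros) (use w in auto)
  show "mono (\<lambda>v. max (- 1) (min 1 (v / w)))"
    by (rule monoI) (use w in \<open>auto simp: max_def min_def field_simps\<close>)
  fix z s :: real assume "0 \<le> z" "0 \<le> s"
  define z' s' where "z' = z / w" and "s' = s / w"
  have zs: "0 \<le> z'" "0 \<le> s'" "(z + s) / w = z' + s'" "(z - s) / w = z' - s'" "z / w = z'"
    using w \<open>0 \<le> z\<close> \<open>0 \<le> s\<close> by (auto simp: z'_def s'_def add_divide_distrib diff_divide_distrib)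
  then show "max (- 1) (min 1 ((z + s) / w)) + max (- 1) (min 1 ((z - s) / w)) \<le> 2 * max (- 1) (min 1 (z / w))"
    by (simp add: max_def min_def)
qed (auto simp: max_def min_def)

text \<open>\<open>box_conc ws v\<close> is the probability that a sum of independent variables, uniform on the intervals
  \<open>[- w, w]\<close>, lies in \<open>[- v, v]\<close>; equivalently, with uniforms on intervals of length \<open>w\<close>, that the
  sum lies in the centred interval of length \<open>v\<close>. In the latter scale \<open>box_peak ws\<close> is the maximal density.\<close>

fun box_conc :: "real list \<Rightarrow> real \<Rightarrow> real" where
  "box_conc [] = sgn"
| "box_conc [w] = (\<lambda>v. max (- 1) (min 1 (v / w)))"
| "box_conc (w # w' # ws) = window_avg w (box_conc (w' # ws))"

fun box_peak :: "real list \<Rightarrow> real" where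
  "box_peak [] = 0"
| "box_peak [w] = 1 / w"
| "box_peak (w # w' # ws) = box_conc (w' # ws) w / w"

lemma odd_concave_box_conc:
  "ws \<noteq> [] \<Longrightarrow> (\<And>w. w \<in> set ws \<Longrightarrow> 0 < w) \<Longrightarrow> odd_concave (box_conc ws)"
  by (induction ws rule: box_conc.induct) (auto intro: odd_concave_clamp odd_concave_window_avg)

lemma odd_concave_nonneg: "odd_concave g \<Longrightarrow> 0 \<le> v \<Longrightarrow> 0 \<le> g v"
  unfolding odd_concave_def by (metis add.inverse_neutral dual_order.refl equal_neg_zero monoD)

text \<open>By concavity on the half-line the graph stays below its tangent at 0, whose slope is the
  peak.\<close>

lemma box_conc_le_peak:
  assumes "ws \<noteq> []" "\<And>w. w \<in> set ws \<Longrightarrow> 0 < w" "0 \<le> v"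
  shows "box_conc ws v \<le> v * box_peak ws"
  using assms
proof (induction ws rule: box_conc.induct)
  case (2 w)
  then show ?case by (auto simp: max_def min_def field_simps)
next
  case (3 w w' ws)
  have "window_avg w (box_conc (w' # ws)) v \<le> v * box_conc (w' # ws) w / w"
    by (rule window_avg_le_slope[OF odd_concave_box_conc]) (use 3 in auto)
  then show ?case by simp
qed auto

lemma window_avg_scale:
  assumes "0 < c" "continuous_on UNIV g"
  shows "window_avg (c * w) (\<lambda>v. g (v / c)) v = window_avg w g (v / c)"
proof -
  have "g integrable_on {v / c - w..v / c + w}"
    by (rule integrable_continuous_real) (use assms(2) continuous_on_subset in blast)
  then have "(g has_integral integral {v / c - w..v / c + w} g) (cbox (v / c - w) (v / c + w))"
    by (simp add: has_integral_integral)
  from has_integral_affinity'[OF this, of "1 / c" 0] assms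
  have "((\<lambda>x. g (x / c)) has_integral (c * integral {v / c - w..v / c + w} g))
      {(v / c - w) * c..(v / c + w) * c}"
    by (simp add: divide_inverse mult.commute)
  then have "integral {v - c * w..v + c * w} (\<lambda>x. g (x / c)) = c * integral {v / c - w..v / c + w} g"
    using assms by (intro integral_unique) (simp add: algebra_simps)
  then show ?thesis using assms by (simp add: window_avg_def)
qed

lemma box_conc_scale:
  assumes "0 < c" "\<And>w. w \<in> set ws \<Longrightarrow> 0 < w"
  shows "box_conc (map ((*) c) ws) v = box_conc ws (v / c)"
  using assms(2)
proof (induction ws arbitrary: v rule: box_conc.induct)
  case 1
  then show ?case using assms(1) by (simp add: sgn_if zero_less_divide_iff)
next
  case (2 w)
  then show ?case by (simp add: mult.commute)
next
  case (3 w w' ws)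
  have "box_conc (map ((*) c) (w' # ws)) = (\<lambda>v. box_conc (w' # ws) (v / c))"
    using 3 by auto
  moreover have "continuous_on UNIV (box_conc (w' # ws))"
    using odd_concave_box_conc[of "w' # ws"] 3 by (simp add: odd_concave_def)
  ultimately show ?case using window_avg_scale[OF assms(1)] by simp
qed

text \<open>Makes the peak times the root of the square sum invariant under scaling, so that weights
  can be normalised to square sum 1.\<close>

lemma box_peak_scale:
  assumes "0 < c" "\<And>w. w \<in> set ws \<Longrightarrow> 0 < w"
  shows "box_peak (map ((*) c) ws) = box_peak ws / c"
proof (cases ws rule: box_peak.cases)
  case (3 w w' ws')
  have "box_conc (map ((*) c) (w' # ws')) (c * w) = box_conc (w' # ws') w"
    using box_conc_scale[OF assms(1), of "w' # ws'" "c * w"] assms 3 by simp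
  then show ?thesis using 3 by (simp add: mult.commute)
qed (auto simp: mult.commute)

section \<open>Comparison of concentration functions\<close>

text \<open>Right endpoints put the sum of a decreasing function below its integral. The range
  starts at \<open>j = 1\<close>, which is what remains of the slicing after the first row and
  column have gone into the error term.\<close>

lemma integral_antimono_sum_le:
  fixes \<phi> :: "real \<Rightarrow> real"
  assumes c: "continuous_on UNIV \<phi>" and m: "antimono \<phi>" and "0 \<le> \<Delta>"
  shows "(\<Sum>j=1..n. \<Delta> * \<phi> (real j * \<Delta>)) \<le> integral {0..real n * \<Delta>} \<phi>"
proof (induction n)
  case (Suc n)
  have i: "\<phi> integrable_on {a..b}" for a b
    by (rule integrable_continuous_real) (use c continuous_on_subset in blast)
  have 1: "integral {0..real n * \<Delta>} \<phi> + integral {real n * \<Delta>..real (Suc n) * \<Delta>} \<phi> = integral {0..real (Suc n) * \<Delta>} \<phi>"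
    by (rule Henstock_Kurzweil_Integration.integral_combine) (use assms i in \<open>auto intro!: mult_right_mono\<close>)
  have 2: "integral {real n * \<Delta>..real (Suc n) * \<Delta>} (\<lambda>_. \<phi> (real (Suc n) * \<Delta>))
      \<le> integral {real n * \<Delta>..real (Suc n) * \<Delta>} \<phi>"
    by (rule integral_le) (use i m in \<open>auto intro: antimonoD\<close>)
  have 3: "integral {real n * \<Delta>..real (Suc n) * \<Delta>} (\<lambda>_. \<phi> (real (Suc n) * \<Delta>)) = \<Delta> * \<phi> (real (Suc n) * \<Delta>)"
    using assms(3) by (simp add: algebra_simps)
  have "(\<Sum>j=1..Suc n. \<Delta> * \<phi> (real j * \<Delta>)) = (\<Sum>j=1..n. \<Delta> * \<phi> (real j * \<Delta>)) + \<Delta> * \<phi> (real (Suc n) * \<Delta>)"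
    by simp
  then show ?case using Suc.IH 1 2 3 by linarith
qed simp

lemma (in finite_borel_measure) atomless_quantile:
  assumes "\<And>x. measure M {x} = 0" "0 < s" "s < measure M (space M)"
  shows "\<exists>p. measure M {..p} = s"
proof -
  have c: "isCont (cdf M) x" for x using assms(1) isCont_cdf by blast
  have "\<forall>\<^sub>F x in at_bot. cdf M x < s" using order_tendstoD(2)[OF cdf_lim_at_bot assms(2)] .
  then obtain a where a: "cdf M a < s" by (metis eventually_at_bot_linorder order_refl)
  have "\<forall>\<^sub>F x in at_top. s < cdf M x" using order_tendstoD(1)[OF cdf_lim_at_top assms(3)] .
  then obtain b where b: "s < cdf M b" by (metis eventually_at_top_linorder order_refl)
  have "a \<le> b" using a b cdf_nondecreasing[of b a] by (cases "a \<le> b") auto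
  then have "\<exists>x\<ge>a. x \<le> b \<and> cdf M x = s"
    by (intro IVT) (use a b c in auto)
  then show ?thesis by (auto simp: cdf_def)
qed

text \<open>Test functions with values in \<open>[0, 1]\<close> take the place of sets: integrating
  out one summand turns the indicator of a set into such a function, so only this class is stable
  under the induction. The bound \<open>g c\<close> is the largest amount that a test function of
  Lebesgue mass \<open>c\<close> can collect.\<close>

definition spread_bounded :: "real measure \<Rightarrow> (real \<Rightarrow> real) \<Rightarrow> bool" where
  "spread_bounded \<nu> g \<longleftrightarrow>
     (\<forall>f\<in>borel_measurable borel. \<forall>c\<ge>0. (\<forall>x. f x \<le> 1) \<longrightarrow> (\<integral>\<^sup>+x. f x \<partial>lborel) = ennreal c \<longrightarrow>
        (\<integral>\<^sup>+x. f x \<partial>\<nu>) \<le> ennreal (g c))"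

lemma spread_boundedD:
  assumes "spread_bounded \<nu> g" "f \<in> borel_measurable borel" "\<And>x. f x \<le> 1"
    "(\<integral>\<^sup>+x. f x \<partial>lborel) = ennreal c" "0 \<le> c"
  shows "(\<integral>\<^sup>+x. f x \<partial>\<nu>) \<le> ennreal (g c)"
  using assms unfolding spread_bounded_def by blast

lemma nn_integral_le_density_bound:
  assumes [measurable_cong]: "sets \<mu> = sets borel" and w: "0 < w"
    and d: "\<And>A. A \<in> sets borel \<Longrightarrow> ennreal w * emeasure \<mu> A \<le> emeasure lborel A"
    and [measurable]: "f \<in> borel_measurable borel"
  shows "ennreal w * (\<integral>\<^sup>+x. f x \<partial>\<mu>) \<le> (\<integral>\<^sup>+x. f x \<partial>lborel)"
proof -
  have s: "space \<mu> = UNIV" using sets_eq_imp_space_eq[OF assms(1)] by simp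
  have "scale_measure (ennreal w) \<mu> \<le> lborel"
    by (subst le_measure) (use d assms(1) in auto)
  then have "(\<integral>\<^sup>+x. f x \<partial>scale_measure (ennreal w) \<mu>) \<le> (\<integral>\<^sup>+x. f x \<partial>lborel)"
    by (intro nn_integral_mono_measure) (use assms(1) in auto)
  then show ?thesis by (subst (asm) nn_integral_scale_measure) (auto simp: assms(1))
qed

text \<open>Two trivial bounds combined: \<open>f \<le> 1\<close> gives 1, and the density bound
  gives \<open>c / w\<close>. The lower clamp at -1 only serves the odd extension.\<close>

lemma spread_bounded_clamp:
  assumes "prob_space \<mu>" "sets \<mu> = sets borel" and w: "0 < w"
    and d: "\<And>A. A \<in> sets borel \<Longrightarrow> ennreal w * emeasure \<mu> A \<le> emeasure lborel A"
  shows "spread_bounded \<mu> (\<lambda>v. max (- 1) (min 1 (v / w)))"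
  unfolding spread_bounded_def
proof (intro ballI allI impI)
  interpret prob_space \<mu> by fact
  fix f :: "real \<Rightarrow> ennreal" and c :: real
  assume [measurable]: "f \<in> borel_measurable borel" and c: "0 \<le> c" and f: "\<forall>x. f x \<le> 1"
    and i: "(\<integral>\<^sup>+x. f x \<partial>lborel) = ennreal c"
  have "(\<integral>\<^sup>+x. f x \<partial>\<mu>) \<le> (\<integral>\<^sup>+x. 1 \<partial>\<mu>)" by (intro nn_integral_mono) (use f in auto)
  then have 1: "(\<integral>\<^sup>+x. f x \<partial>\<mu>) \<le> 1" by (simp add: emeasure_space_1)
  have "ennreal w * (\<integral>\<^sup>+x. f x \<partial>\<mu>) \<le> ennreal c"
    using nn_integral_le_density_bound[OF assms(2) w d, of f] i by simp
  moreover obtain r where r: "(\<integral>\<^sup>+x. f x \<partial>\<mu>) = ennreal r" "0 \<le> r"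
    using 1 by (cases "\<integral>\<^sup>+x. f x \<partial>\<mu>") (auto simp: top_unique)
  ultimately have "w * r \<le> c" using w c by (simp add: ennreal_mult[symmetric])
  then have "r \<le> min 1 (c / w)" using 1 r w by (simp add: field_simps)
  then show "(\<integral>\<^sup>+x. f x \<partial>\<mu>) \<le> ennreal (max (- 1) (min 1 (c / w)))"
    unfolding r using c w r by (intro ennreal_leI) auto
qed

text \<open>For a set \<open>A\<close> of measure \<open>v\<close>, the function \<open>k\<close>,
  which is \<open>w / v\<close> times the \<mu>-measure of \<open>A\<close> shifted by
  \<open>- y\<close>, is at most 1 by the density bound and has Lebesgue mass exactly
  \<open>w\<close>. It is thus a test function for \<nu> whose mass does not depend on
  \<open>v\<close>, and the resulting bound is linear in \<open>v\<close>.\<close>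

lemma spread_bounded_convolution_peak:
  assumes p: "prob_space \<mu>" "prob_space \<nu>" and s[measurable_cong]: "sets \<mu> = sets borel" "sets \<nu> = sets borel"
    and w: "0 < w"
    and d: "\<And>A. A \<in> sets borel \<Longrightarrow> ennreal w * emeasure \<mu> A \<le> emeasure lborel A"
    and b: "spread_bounded \<nu> g" and g0: "0 \<le> g w"
    and [measurable]: "A \<in> sets borel" and fin: "emeasure lborel A < \<infinity>"
  shows "emeasure (\<mu> \<star> \<nu>) A \<le> ennreal (g w / w) * emeasure lborel A"
proof (cases "emeasure lborel A = 0")
  case False
  then obtain v where v: "emeasure lborel A = ennreal v" "0 < v"
    using fin by (cases "emeasure lborel A") (auto simp: less_le)
  interpret M: prob_space \<mu> by fact
  interpret N: prob_space \<nu> by fact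
  interpret pair_sigma_finite \<mu> \<nu> ..
  define k where "k y = ennreal (w / v) * (\<integral>\<^sup>+x. indicator A (x + y) \<partial>\<mu>)" for y
  have [measurable]: "k \<in> borel_measurable borel" unfolding k_def by measurable
  have k1: "k y \<le> 1" for y
  proof -
    have "ennreal w * (\<integral>\<^sup>+x. indicator A (x + y) \<partial>\<mu>) \<le> (\<integral>\<^sup>+x. indicator A (x + y) \<partial>lborel)"
      by (rule nn_integral_le_density_bound[OF s(1) w d]) auto
    also have "\<dots> = ennreal v"
      using nn_integral_real_affine[of "indicator A" 1 y] v by (simp add: add.commute)
    finally have "ennreal (1 / v) * (ennreal w * (\<integral>\<^sup>+x. indicator A (x + y) \<partial>\<mu>)) \<le> ennreal (1 / v) * ennreal v"
      by (rule mult_left_mono) simp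
    then show ?thesis
      using v w by (simp add: k_def mult.assoc[symmetric] ennreal_mult[symmetric])
  qed
  have ki: "(\<integral>\<^sup>+y. k y \<partial>lborel) = ennreal w"
  proof -
    interpret P: pair_sigma_finite \<mu> lborel ..
    have "(\<integral>\<^sup>+y. k y \<partial>lborel) = ennreal (w / v) * (\<integral>\<^sup>+y. (\<integral>\<^sup>+x. indicator A (x + y) \<partial>\<mu>) \<partial>lborel)"
      unfolding k_def by (rule nn_integral_cmult) measurable
    also have "(\<integral>\<^sup>+y. (\<integral>\<^sup>+x. indicator A (x + y) \<partial>\<mu>) \<partial>lborel) = (\<integral>\<^sup>+x. (\<integral>\<^sup>+y. indicator A (x + y) \<partial>lborel) \<partial>\<mu>)"
      by (rule P.Fubini') measurable
    also have "\<dots> = (\<integral>\<^sup>+x. ennreal v \<partial>\<mu>)"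
    proof (rule nn_integral_cong)
      fix x show "(\<integral>\<^sup>+y. indicator A (x + y) \<partial>lborel) = ennreal v"
        using nn_integral_real_affine[of "indicator A" 1 x] v by simp
    qed
    also have "\<dots> = ennreal v" by (simp add: M.emeasure_space_1)
    finally show ?thesis using v w by (simp add: ennreal_mult[symmetric])
  qed
  have "(\<integral>\<^sup>+y. k y \<partial>\<nu>) \<le> ennreal (g w)"
    by (rule spread_boundedD[OF b _ k1 ki]) (use w in auto)
  moreover have "(\<integral>\<^sup>+y. k y \<partial>\<nu>) = ennreal (w / v) * emeasure (\<mu> \<star> \<nu>) A"
  proof -
    have "(\<integral>\<^sup>+y. k y \<partial>\<nu>) = ennreal (w / v) * (\<integral>\<^sup>+y. (\<integral>\<^sup>+x. indicator A (x + y) \<partial>\<mu>) \<partial>\<nu>)"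
      unfolding k_def by (rule nn_integral_cmult) measurable
    also have "(\<integral>\<^sup>+y. (\<integral>\<^sup>+x. indicator A (x + y) \<partial>\<mu>) \<partial>\<nu>) = (\<integral>\<^sup>+x. (\<integral>\<^sup>+y. indicator A (x + y) \<partial>\<nu>) \<partial>\<mu>)"
      by (rule Fubini') measurable
    also have "\<dots> = emeasure (\<mu> \<star> \<nu>) A"
      by (subst convolution_emeasure') (use s M.finite_measure_axioms N.finite_measure_axioms in auto)
    finally show ?thesis .
  qed
  ultimately have "ennreal (v / w) * (ennreal (w / v) * emeasure (\<mu> \<star> \<nu>) A) \<le> ennreal (v / w) * ennreal (g w)"
    by (intro mult_left_mono) auto
  then show ?thesis using v w g0
    by (simp add: mult.assoc[symmetric] ennreal_mult[symmetric] mult.commute)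
next
  case True
  interpret M: prob_space \<mu> by fact
  interpret N: prob_space \<nu> by fact
  interpret pair_sigma_finite \<mu> \<nu> ..
  \<comment> \<open>The factor \<open>w / v\<close> is meaningless for a null set; there the
    absolute continuity of \<mu> makes every section null.\<close>
  have "emeasure (\<mu> \<star> \<nu>) A \<le> 0" if z: "emeasure lborel A = 0"
  proof -
    have "emeasure (\<mu> \<star> \<nu>) A = (\<integral>\<^sup>+x. (\<integral>\<^sup>+y. indicator A (x + y) \<partial>\<nu>) \<partial>\<mu>)"
      by (subst convolution_emeasure') (use s M.finite_measure_axioms N.finite_measure_axioms in auto)
    also have "\<dots> = (\<integral>\<^sup>+y. (\<integral>\<^sup>+x. indicator A (x + y) \<partial>\<mu>) \<partial>\<nu>)"
      by (rule Fubini'[symmetric]) measurable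
    also have "\<dots> = (\<integral>\<^sup>+y. 0 \<partial>\<nu>)"
    proof (rule nn_integral_cong)
      fix y
      have "ennreal w * (\<integral>\<^sup>+x. indicator A (x + y) \<partial>\<mu>) \<le> (\<integral>\<^sup>+x. indicator A (x + y) \<partial>lborel)"
        by (rule nn_integral_le_density_bound[OF s(1) w d]) auto
      also have "\<dots> = 0"
        using nn_integral_real_affine[of "indicator A" 1 y] z by (simp add: add.commute)
      finally show "(\<integral>\<^sup>+x. indicator A (x + y) \<partial>\<mu>) = 0" using w by simp
    qed
    finally show ?thesis by simp
  qed
  then show ?thesis using True by simp
qed

lemma integral_affine_rev:
  fixes g :: "real \<Rightarrow> real"
  assumes "continuous_on UNIV g" "0 \<le> m"
  shows "integral {0..m} (\<lambda>s. g (b - 2 * s)) = integral {b - 2 * m..b} g / 2"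
proof -
  have "g integrable_on {b - 2 * m..b}"
    by (rule integrable_continuous_real) (use assms(1) continuous_on_subset in blast)
  then have "(g has_integral integral {b - 2 * m..b} g) (cbox (b - 2 * m) b)"
    by (simp add: has_integral_integral)
  from has_integral_affinity[OF this, of "- 2" b]
  have "((\<lambda>s. g (b - 2 * s)) has_integral integral {b - 2 * m..b} g / 2)
     ((\<lambda>x. b / 2 - x / 2) ` {b - 2 * m..b})"
    by (simp add: algebra_simps)
  also have "(\<lambda>x. b / 2 - x / 2) ` {b - 2 * m..b} = {0..m}"
  proof (intro equalityI subsetI)
    fix y assume "y \<in> {0..m}"
    then show "y \<in> (\<lambda>x. b / 2 - x / 2) ` {b - 2 * m..b}"
      by (intro image_eqI[of _ _ "b - 2 * y"]) (auto simp: field_simps)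
  qed auto
  finally show ?thesis by (rule integral_unique)
qed

text \<open>As \<open>s\<close> runs through \<open>[0, min w v]\<close>, the argument
  \<open>w + v - 2 * s\<close> decreases from \<open>w + v\<close> to
  \<open>\<bar>w - v\<bar>\<close>. The left side is the limit of the hook sums; since
  \<open>g\<close> is odd, stopping at \<open>min w v\<close> still gives the integral over the full
  window.\<close>

lemma window_avg_eq_integral_min:
  assumes c: "continuous_on UNIV g" and o: "\<And>x. g (- x) = - g x" and w: "0 < w" "0 \<le> v"
  shows "integral {0..min w v} (\<lambda>s. g (w + v - 2 * s)) / w = window_avg w g v"
proof -
  have "integral {0..min w v} (\<lambda>s. g (w + v - 2 * s)) = integral {w + v - 2 * min w v..w + v} g / 2"
    by (rule integral_affine_rev) (use assms in auto)
  also have "integral {w + v - 2 * min w v..w + v} g = integral {v - w..v + w} g"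
    using integral_odd_window_swap[OF c o, of v w] w by (cases "w \<le> v") (auto simp: add.commute)
  finally show ?thesis using w by (simp add: window_avg_def field_simps)
qed


text \<open>Take coordinates \<open>(x, x + y)\<close>, the first weighted by \<mu> times
  \<open>w\<close>, the second by \<open>f\<close>, and cut both axes at equal masses
  \<open>S j\<close>. The hook between two successive quadrants carries total mass at most about
  \<open>\<Delta> * (w + v - 2 * S j)\<close>, but at most \<Delta> on each line of fixed
  \<open>y\<close>. Divided by \<Delta> it is a test function of mass about
  \<open>w + v - 2 * S j\<close>, and the bounds for all hooks add up to a Riemann sum of the window
  average.\<close>

theorem spread_bounded_convolution:
  assumes p: "prob_space \<mu>" "prob_space \<nu>" and s[measurable_cong]: "sets \<mu> = sets borel" "sets \<nu> = sets borel"
    and w: "0 < w"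
    and d: "\<And>A. A \<in> sets borel \<Longrightarrow> ennreal w * emeasure \<mu> A \<le> emeasure lborel A"
    and b: "spread_bounded \<nu> g" and g: "odd_concave g"
  shows "spread_bounded (\<mu> \<star> \<nu>) (window_avg w g)"
  unfolding spread_bounded_def
proof (intro ballI allI impI)
  fix f :: "real \<Rightarrow> ennreal" and v :: real
  assume f[measurable]: "f \<in> borel_measurable borel" and v0: "0 \<le> v" and f1: "\<forall>x. f x \<le> 1"
    and fi: "(\<integral>\<^sup>+x. f x \<partial>lborel) = ennreal v"
  interpret M: prob_space \<mu> by fact
  interpret N: prob_space \<nu> by fact
  interpret pair_sigma_finite \<mu> \<nu> ..
  have gc: "continuous_on UNIV g" and go: "\<And>x. g (- x) = - g x" and gm: "mono g"
    using g by (auto simp: odd_concave_def)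
  have g0: "0 \<le> g x" if "0 \<le> x" for x using odd_concave_nonneg[OF g that] .
  define k where "k y = ennreal w * (\<integral>\<^sup>+x. f (x + y) \<partial>\<mu>)" for y
  have [measurable]: "k \<in> borel_measurable borel" unfolding k_def by measurable
  have "(\<integral>\<^sup>+x. f x \<partial>(\<mu> \<star> \<nu>)) = (\<integral>\<^sup>+x. \<integral>\<^sup>+y. f (x + y) \<partial>\<nu> \<partial>\<mu>)"
    by (rule nn_integral_convolution) (use s M.finite_measure_axioms N.finite_measure_axioms in auto)
  also have "\<dots> = (\<integral>\<^sup>+y. \<integral>\<^sup>+x. f (x + y) \<partial>\<mu> \<partial>\<nu>)"
    by (rule Fubini'[symmetric]) measurable
  finally have E: "(\<integral>\<^sup>+x. f x \<partial>(\<mu> \<star> \<nu>)) = (\<integral>\<^sup>+y. \<integral>\<^sup>+x. f (x + y) \<partial>\<mu> \<partial>\<nu>)" .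
  have kE: "(\<integral>\<^sup>+y. k y \<partial>\<nu>) = ennreal w * (\<integral>\<^sup>+x. f x \<partial>(\<mu> \<star> \<nu>))"
    unfolding k_def E by (rule nn_integral_cmult) measurable
  have shift: "(\<integral>\<^sup>+x. h (x + y) \<partial>lborel) = (\<integral>\<^sup>+x. h x \<partial>lborel)"
    if "h \<in> borel_measurable borel" for h :: "real \<Rightarrow> ennreal" and y
    using nn_integral_real_affine[of h 1 y] that by (simp add: add.commute)
  have le_leb: "ennreal w * (\<integral>\<^sup>+x. h (x + y) \<partial>\<mu>) \<le> (\<integral>\<^sup>+x. h x \<partial>lborel)"
    if [measurable]: "h \<in> borel_measurable borel" for h :: "real \<Rightarrow> ennreal" and y
  proof -
    have "ennreal w * (\<integral>\<^sup>+x. h (x + y) \<partial>\<mu>) \<le> (\<integral>\<^sup>+x. h (x + y) \<partial>lborel)"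
      by (rule nn_integral_le_density_bound[OF s(1) w d]) auto
    also have "\<dots> = (\<integral>\<^sup>+x. h x \<partial>lborel)" by (rule shift) measurable
    finally show ?thesis .
  qed
  define \<phi> where "\<phi> s = g (w + v - 2 * s)" for s
  define m where "m = min w v"
  define I where "I = integral {0..m} \<phi>"
  have \<phi>c: "continuous_on UNIV \<phi>" unfolding \<phi>_def[abs_def]
    by (rule continuous_on_compose2[OF gc]) (auto intro!: continuous_intros)
  have \<phi>m: "antimono \<phi>" unfolding \<phi>_def[abs_def] by (rule antimonoI) (rule monoD[OF gm], simp)
  have \<phi>0: "0 \<le> \<phi> s" if "s \<le> m" for s unfolding \<phi>_def by (rule g0) (use that in \<open>auto simp: m_def\<close>)
  have I: "I / w = window_avg w g v"
    unfolding I_def \<phi>_def m_def by (rule window_avg_eq_integral_min[OF gc go w v0])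
  \<comment> \<open>There are \<open>n\<close> hooks. The three pieces that they leave out, the
    strips up to \<open>p 1\<close> and up to \<open>a 1\<close> and the last quadrant, cost at most
    \<open>m / (n + 2)\<close> each, whence the factor 3.\<close>
  have main: "(\<integral>\<^sup>+y. k y \<partial>\<nu>) \<le> ennreal (3 * (m / real (n + 2)) + I)" for n :: nat
  proof (cases "v = 0")
    case True
    have "k y = 0" for y using le_leb[OF f, of y] fi True by (simp add: k_def)
    then show ?thesis by simp
  next
    case False
    then have v: "0 < v" using v0 by simp
    then have m: "0 < m" "m \<le> w" "m \<le> v" using w by (auto simp: m_def)
    \<comment> \<open>With \<open>n + 2\<close> slices the levels \<open>S 1\<close> to
      \<open>S (n + 1)\<close> lie strictly between 0 and \<open>m\<close>, as the existence of
      quantiles requires, and exactly one slice is left beyond the last level.\<close>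
    define \<Delta> where "\<Delta> = m / real (n + 2)"
    define S where "S j = real j * \<Delta>" for j
    have D: "0 < \<Delta>" using m by (simp add: \<Delta>_def)
    have S: "0 < S j" "S j < m" if "j \<in> {1..n+1}" for j
    proof -
      show "0 < S j" using that D by (simp add: S_def)
      have "S j < real (n + 2) * \<Delta>" unfolding S_def using that D by (intro mult_strict_right_mono) auto
      then show "S j < m" by (simp add: \<Delta>_def)
    qed
    have SS: "S (Suc j) = S j + \<Delta>" for j by (simp add: S_def algebra_simps)
    have Sn: "S (n + 1) = m - \<Delta>" by (simp add: S_def \<Delta>_def field_simps)
    define F where "F = density lborel f"
    have [measurable_cong]: "sets F = sets borel" by (simp add: F_def)
    have F_eq: "emeasure F B = (\<integral>\<^sup>+x. f x * indicator B x \<partial>lborel)" if "B \<in> sets borel" for B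
      unfolding F_def by (rule emeasure_density) (use that in auto)
    have Fs: "emeasure F UNIV = ennreal v" by (simp add: F_eq fi)
    have F_space: "space F = UNIV" and mu_space: "space \<mu> = UNIV"
      using sets_eq_imp_space_eq[OF s(1)] by (simp_all add: F_def)
    have F_fin: "finite_measure F" by (rule finite_measureI) (simp add: F_space Fs)
    interpret F: finite_borel_measure F
      using F_fin by (rule finite_borel_measure.intro) (simp add: finite_borel_measure_axioms_def F_def)
    interpret M': finite_borel_measure \<mu>
      using M.finite_measure_axioms
      by (rule finite_borel_measure.intro) (simp add: finite_borel_measure_axioms_def s)
    have F0: "measure F {x} = 0" for x
    proof -
      have "emeasure F {x} = (\<integral>\<^sup>+y. f y * indicator {x} y \<partial>lborel)" by (rule F_eq) simp
      also have "\<dots> \<le> (\<integral>\<^sup>+y. indicator {x} y \<partial>lborel)"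
        by (intro nn_integral_mono) (use f1 in \<open>auto split: split_indicator\<close>)
      finally show ?thesis by (simp add: measure_def)
    qed
    have M0: "measure \<mu> {x} = 0" for x
    proof -
      have "ennreal w * emeasure \<mu> {x} \<le> 0" using d[of "{x}"] by simp
      then show ?thesis using w by (simp add: measure_def)
    qed
    have F_UNIV: "measure F (space F) = v"
      using v by (simp add: F_space measure_def Fs)
    have "\<exists>p. \<forall>j\<in>{1..n+1}. measure \<mu> {..p j} = S j / w"
    proof (rule bchoice, rule ballI)
      fix j assume j: "j \<in> {1..n+1}"
      show "\<exists>p. measure \<mu> {..p} = S j / w"
        by (rule M'.atomless_quantile[OF M0]) (use S[OF j] m w in \<open>auto simp: M.prob_space\<close>)
    qed
    then obtain p where p: "\<And>j. j \<in> {1..n+1} \<Longrightarrow> measure \<mu> {..p j} = S j / w" by blast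
    have "\<exists>a. \<forall>j\<in>{1..n+1}. measure F {..a j} = S j"
    proof (rule bchoice, rule ballI)
      fix j assume j: "j \<in> {1..n+1}"
      show "\<exists>a. measure F {..a} = S j"
        by (rule F.atomless_quantile[OF F0]) (use S[OF j] m w in \<open>auto simp: F_UNIV\<close>)
    qed
    then obtain a where a: "\<And>j. j \<in> {1..n+1} \<Longrightarrow> measure F {..a j} = S j" by blast
    have mu_le: "ennreal w * emeasure \<mu> {..p j} = ennreal (S j)" if "j \<in> {1..n+1}" for j
      using p[OF that] w S[OF that] by (simp add: M.emeasure_eq_measure ennreal_mult[symmetric])
    have mu_gt: "ennreal w * emeasure \<mu> {p j<..} = ennreal (w - S j)" if j: "j \<in> {1..n+1}" for j
    proof -
      have "measure \<mu> {p j<..} = 1 - S j / w"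
        using M.prob_compl[of "{..p j}"] p[OF j] sets_eq_imp_space_eq[OF s(1)] s(1)
        by (simp add: Compl_eq_Diff_UNIV[symmetric] Compl_atMost)
      then show ?thesis using w S[OF j] m by (simp add: M.emeasure_eq_measure ennreal_mult[symmetric] field_simps)
    qed
    have F_le: "emeasure F {..a j} = ennreal (S j)" if "j \<in> {1..n+1}" for j
      using a[OF that] by (simp add: F.emeasure_eq_measure)
    have F_gt: "emeasure F {a j<..} = ennreal (v - S j)" if j: "j \<in> {1..n+1}" for j
    proof -
      have "measure F {a j<..} = v - S j"
        using F.finite_measure_compl[of "{..a j}"] a[OF j] F_UNIV
        by (simp add: F_def Compl_eq_Diff_UNIV[symmetric] Compl_atMost)
      then show ?thesis by (simp add: F.emeasure_eq_measure)
    qed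
    have pm: "p j < p (Suc j)" and am: "a j < a (Suc j)" if j: "j \<in> {1..n}" for j
    proof -
      have "measure \<mu> {..p j} < measure \<mu> {..p (Suc j)}" using p[of j] p[of "Suc j"] j D w SS by (simp add: divide_strict_right_mono)
      then show "p j < p (Suc j)" using M'.cdf_nondecreasing[of "p (Suc j)" "p j"] by (force simp: cdf_def)
      have "measure F {..a j} < measure F {..a (Suc j)}" using a[of j] a[of "Suc j"] j D SS by simp
      then show "a j < a (Suc j)" using F.cdf_nondecreasing[of "a (Suc j)" "a j"] by (force simp: cdf_def)
    qed
    have mu_ivl: "ennreal w * emeasure \<mu> {p j<..p (Suc j)} = ennreal \<Delta>" if j: "j \<in> {1..n}" for j
    proof -
      have "measure \<mu> {p j<..p (Suc j)} = \<Delta> / w"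
        using M'.cdf_diff_eq[of "p j" "p (Suc j)"] pm[OF j] p[of j] p[of "Suc j"] j
        by (simp add: cdf_def SS add_divide_distrib)
      then show ?thesis using w D by (simp add: M.emeasure_eq_measure ennreal_mult[symmetric])
    qed
    have F_ivl: "emeasure F {a j<..a (Suc j)} = ennreal \<Delta>" if j: "j \<in> {1..n}" for j
      using F.cdf_diff_eq[of "a j" "a (Suc j)"] am[OF j] a[of j] a[of "Suc j"] j
      by (simp add: cdf_def SS F.emeasure_eq_measure)
    \<comment> \<open>The line \<open>x \<mapsto> (x, x + y)\<close> stays in the quadrant \<open>T j\<close> once it has entered, and lies in the hook
      \<open>H j\<close> only while \<open>x \<in> {p j<..p (Suc j)}\<close> or only while \<open>x + y \<in> {a j<..a (Suc j)}\<close>. Both strips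
      have weight \<open>\<Delta>\<close>, so \<open>K j / \<Delta>\<close> is a test function for \<open>\<nu>\<close>.\<close>
    define T where "T j = {p j<..} \<times> {a j<..}" for j
    define H where "H j = T j - T (Suc j)" for j
    define K where "K j y = ennreal w * (\<integral>\<^sup>+x. f (x + y) * indicator (H j) (x, x + y) \<partial>\<mu>)" for j y
    have [measurable]: "T j \<in> sets (borel \<Otimes>\<^sub>M borel)" for j unfolding T_def by measurable
    have [measurable]: "H j \<in> sets (borel \<Otimes>\<^sub>M borel)" for j unfolding H_def by measurable
    have [measurable]: "K j \<in> borel_measurable borel" for j unfolding K_def by measurable
    have T_ind: "indicator (T 1) z \<le> (\<Sum>j=1..n'. indicator (H j) z) + (indicator (T (Suc n')) z :: ennreal)" for n' z
    proof (induction n')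
      case (Suc n')
      have "indicator (T (Suc n')) z \<le> indicator (H (Suc n')) z + (indicator (T (Suc (Suc n'))) z :: ennreal)"
        by (auto simp: H_def split: split_indicator)
      from add_left_mono[OF this, of "\<Sum>j=1..n'. indicator (H j) z"]
      show ?case using Suc by (simp add: add.assoc order.trans)
    qed simp
    have k_le: "k y \<le> ennreal (3 * \<Delta>) + (\<Sum>j=1..n. K j y)" for y
    proof -
      have pt: "f (x + y) \<le> indicator {..p 1} x + f (x + y) * indicator {..a 1} (x + y)
          + (\<Sum>j=1..n. f (x + y) * indicator (H j) (x, x + y)) + f (x + y) * indicator (T (Suc n)) (x, x + y)"
        (is "_ \<le> ?A + ?B + ?C + ?D") for x
      proof (cases "x \<le> p 1 \<or> x + y \<le> a 1")
        case True
        then have "f (x + y) \<le> ?A + ?B" using f1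
            by (cases "x \<le> p 1"; cases "x + y \<le> a 1") (auto intro: add_increasing2)
        then have "f (x + y) \<le> (?A + ?B) + (?C + ?D)" by (rule add_increasing2[OF zero_le])
        then show ?thesis by (simp only: add.assoc)
      next
        case False
        then have "indicator (T 1) (x, x + y) = (1::ennreal)" by (auto simp: T_def)
        then have "1 \<le> (\<Sum>j=1..n. indicator (H j) (x, x + y)) + (indicator (T (Suc n)) (x, x + y) :: ennreal)"
          using T_ind[of "(x, x + y)" n] by simp
        from mult_left_mono[OF this, of "f (x + y)"] have "f (x + y) \<le> ?C + ?D"
          by (simp add: distrib_left sum_distrib_left)
        then have "f (x + y) \<le> (?A + ?B) + (?C + ?D)" by (rule add_increasing[OF zero_le])
        then show ?thesis by (simp only: add.assoc)
      qed
      have "k y \<le> ennreal w * (\<integral>\<^sup>+x. indicator {..p 1} x + f (x + y) * indicator {..a 1} (x + y)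
          + (\<Sum>j=1..n. f (x + y) * indicator (H j) (x, x + y)) + f (x + y) * indicator (T (Suc n)) (x, x + y) \<partial>\<mu>)"
        unfolding k_def by (intro mult_left_mono nn_integral_mono pt) simp
      also have "\<dots> = ennreal w * (\<integral>\<^sup>+x. indicator {..p 1} x \<partial>\<mu>) + ennreal w * (\<integral>\<^sup>+x. f (x + y) * indicator {..a 1} (x + y) \<partial>\<mu>)
          + (\<Sum>j=1..n. K j y) + ennreal w * (\<integral>\<^sup>+x. f (x + y) * indicator (T (Suc n)) (x, x + y) \<partial>\<mu>)"
      proof -
        define fB where "fB x = f (x + y) * indicator {..a 1} (x + y)" for x
        define fC where "fC j x = f (x + y) * indicator (H j) (x, x + y)" for j x
        define fD where "fD x = f (x + y) * indicator (T (Suc n)) (x, x + y)" for x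
        have [measurable]: "fB \<in> borel_measurable borel" "fC j \<in> borel_measurable borel" "fD \<in> borel_measurable borel" for j
          unfolding fB_def fC_def fD_def by measurable
        have "(\<integral>\<^sup>+x. indicator {..p 1} x + fB x + (\<Sum>j=1..n. fC j x) + fD x \<partial>\<mu>)
            = (\<integral>\<^sup>+x. indicator {..p 1} x \<partial>\<mu>) + (\<integral>\<^sup>+x. fB x \<partial>\<mu>) + (\<Sum>j=1..n. \<integral>\<^sup>+x. fC j x \<partial>\<mu>) + (\<integral>\<^sup>+x. fD x \<partial>\<mu>)"
          by (simp add: nn_integral_add nn_integral_sum del: nn_integral_indicator)
        then show ?thesis unfolding K_def fB_def[symmetric] fC_def[symmetric] fD_def[symmetric]
          by (simp only: distrib_left sum_distrib_left)
      qed
      also have "\<dots> \<le> ennreal \<Delta> + ennreal \<Delta> + (\<Sum>j=1..n. K j y) + ennreal \<Delta>"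
      proof (intro add_mono order_refl)
        show "ennreal w * (\<integral>\<^sup>+x. indicator {..p 1} x \<partial>\<mu>) \<le> ennreal \<Delta>"
          using mu_le[of 1] by (simp add: s S_def)
        have "ennreal w * (\<integral>\<^sup>+x. f (x + y) * indicator {..a 1} (x + y) \<partial>\<mu>) \<le> (\<integral>\<^sup>+x. f x * indicator {..a 1} x \<partial>lborel)"
          by (rule le_leb) measurable
        also have "\<dots> = ennreal \<Delta>" using F_le[of 1] by (simp add: F_eq S_def)
        finally show "ennreal w * (\<integral>\<^sup>+x. f (x + y) * indicator {..a 1} (x + y) \<partial>\<mu>) \<le> ennreal \<Delta>" .
        show "ennreal w * (\<integral>\<^sup>+x. f (x + y) * indicator (T (Suc n)) (x, x + y) \<partial>\<mu>) \<le> ennreal \<Delta>"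
        \<comment> \<open>The last quadrant is bounded through the variable whose total mass is
          \<open>m\<close>: that is the one with exactly \<Delta> left beyond its last
          quantile.\<close>
        proof (cases "w \<le> v")
          case True
          have "ennreal w * (\<integral>\<^sup>+x. f (x + y) * indicator (T (Suc n)) (x, x + y) \<partial>\<mu>)
              \<le> ennreal w * (\<integral>\<^sup>+x. indicator {p (Suc n)<..} x \<partial>\<mu>)"
            by (intro mult_left_mono nn_integral_mono) (use f1 in \<open>auto simp: T_def split: split_indicator\<close>)
          also have "\<dots> = ennreal (w - S (n + 1))" using mu_gt[of "n + 1"] by (simp add: s)
          also have "w - S (n + 1) = \<Delta>" using True unfolding Sn by (simp add: m_def)
          finally show ?thesis .
        next
          case False
          have "ennreal w * (\<integral>\<^sup>+x. f (x + y) * indicator (T (Suc n)) (x, x + y) \<partial>\<mu>)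
              \<le> ennreal w * (\<integral>\<^sup>+x. f (x + y) * indicator {a (Suc n)<..} (x + y) \<partial>\<mu>)"
            by (intro mult_left_mono nn_integral_mono) (auto simp: T_def split: split_indicator)
          also have "\<dots> \<le> (\<integral>\<^sup>+x. f x * indicator {a (Suc n)<..} x \<partial>lborel)"
            by (rule le_leb) measurable
          also have "\<dots> = ennreal (v - S (n + 1))" using F_gt[of "n + 1"] by (simp add: F_eq)
          also have "v - S (n + 1) = \<Delta>" using False unfolding Sn by (simp add: m_def)
          finally show ?thesis .
        qed
      qed
      also have "\<dots> = ennreal (3 * \<Delta>) + (\<Sum>j=1..n. K j y)"
      proof -
        have "ennreal (3 * \<Delta>) = ennreal \<Delta> + ennreal \<Delta> + ennreal \<Delta>"
          using D by (simp add: ennreal_plus[symmetric] del: ennreal_plus)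
        then show ?thesis by (simp add: ac_simps)
      qed
      finally show ?thesis .
    qed
    have K_le: "K j y \<le> ennreal \<Delta>" if j: "j \<in> {1..n}" for j y
    proof (cases "a (Suc j) - y \<le> p (Suc j)")
      case True
      have "K j y \<le> ennreal w * (\<integral>\<^sup>+x. indicator {p j<..p (Suc j)} x \<partial>\<mu>)" unfolding K_def
      proof (rule mult_left_mono[OF nn_integral_mono])
        fix x
        show "f (x + y) * indicator (H j) (x, x + y) \<le> indicator {p j<..p (Suc j)} x"
          using True f1 by (auto simp: H_def T_def split: split_indicator)
      qed simp
      then show ?thesis using mu_ivl[OF j] by (simp add: s)
    next
      case False
      have "K j y \<le> ennreal w * (\<integral>\<^sup>+x. f (x + y) * indicator {a j<..a (Suc j)} (x + y) \<partial>\<mu>)" unfolding K_def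
      proof (rule mult_left_mono[OF nn_integral_mono])
        fix x
        show "f (x + y) * indicator (H j) (x, x + y) \<le> f (x + y) * indicator {a j<..a (Suc j)} (x + y)"
          using False by (auto simp: H_def T_def split: split_indicator)
      qed simp
      also have "\<dots> \<le> (\<integral>\<^sup>+x. f x * indicator {a j<..a (Suc j)} x \<partial>lborel)" by (rule le_leb) measurable
      also have "\<dots> = ennreal \<Delta>" using F_ivl[OF j] by (simp add: F_eq)
      finally show ?thesis .
    qed
    have K_int: "(\<integral>\<^sup>+y. K j y \<partial>lborel) \<le> ennreal (\<Delta> * (v - S j + (w - S (Suc j))))" if j: "j \<in> {1..n}" for j
    proof -
      interpret P: pair_sigma_finite \<mu> lborel ..
      have "(\<integral>\<^sup>+y. K j y \<partial>lborel) = ennreal w * (\<integral>\<^sup>+y. (\<integral>\<^sup>+x. f (x + y) * indicator (H j) (x, x + y) \<partial>\<mu>) \<partial>lborel)"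
        unfolding K_def by (rule nn_integral_cmult) measurable
      also have "(\<integral>\<^sup>+y. (\<integral>\<^sup>+x. f (x + y) * indicator (H j) (x, x + y) \<partial>\<mu>) \<partial>lborel)
          = (\<integral>\<^sup>+x. (\<integral>\<^sup>+y. f (x + y) * indicator (H j) (x, x + y) \<partial>lborel) \<partial>\<mu>)"
        by (rule P.Fubini') measurable
      also have "\<dots> = (\<integral>\<^sup>+x. (\<integral>\<^sup>+y. f y * indicator (H j) (x, y) \<partial>lborel) \<partial>\<mu>)"
      proof (rule nn_integral_cong)
        fix x
        show "(\<integral>\<^sup>+y. f (x + y) * indicator (H j) (x, x + y) \<partial>lborel) = (\<integral>\<^sup>+y. f y * indicator (H j) (x, y) \<partial>lborel)"
          using shift[of "\<lambda>y. f y * indicator (H j) (x, y)" x] by (simp add: add.commute)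
      qed
      \<comment> \<open>The hook splits into two arms: the strip in \<open>x\<close> with everything
        above \<open>a j\<close>, and the strip in \<open>x + y\<close> with everything to the right
        of \<open>p (Suc j)\<close>. The index \<open>Suc j\<close> in the second arm prevents the
        common corner from being counted twice.\<close>
      also have "\<dots> \<le> (\<integral>\<^sup>+x. (\<integral>\<^sup>+y. indicator {p j<..p (Suc j)} x * (f y * indicator {a j<..} y)
          + indicator {p (Suc j)<..} x * (f y * indicator {a j<..a (Suc j)} y) \<partial>lborel) \<partial>\<mu>)"
        by (intro nn_integral_mono) (auto simp: H_def T_def split: split_indicator)
      also have "\<dots> = (\<integral>\<^sup>+x. indicator {p j<..p (Suc j)} x * emeasure F {a j<..}
          + indicator {p (Suc j)<..} x * emeasure F {a j<..a (Suc j)} \<partial>\<mu>)"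
        by (intro nn_integral_cong) (simp add: nn_integral_add nn_integral_cmult F_eq)
      also have "\<dots> = emeasure \<mu> {p j<..p (Suc j)} * emeasure F {a j<..} + emeasure \<mu> {p (Suc j)<..} * emeasure F {a j<..a (Suc j)}"
        by (simp add: nn_integral_add nn_integral_multc s)
      also have "ennreal w * \<dots> = (ennreal w * emeasure \<mu> {p j<..p (Suc j)}) * emeasure F {a j<..}
          + (ennreal w * emeasure \<mu> {p (Suc j)<..}) * emeasure F {a j<..a (Suc j)}"
        by (simp add: distrib_left mult.assoc)
      also have "\<dots> = ennreal \<Delta> * ennreal (v - S j) + ennreal (w - S (Suc j)) * ennreal \<Delta>"
        using mu_ivl[OF j] F_gt[of j] mu_gt[of "Suc j"] F_ivl[OF j] j by simp
      also have "\<dots> = ennreal (\<Delta> * (v - S j + (w - S (Suc j))))"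
        using D S[of j] S[of "Suc j"] j m
        by (simp add: ennreal_mult[symmetric] ennreal_plus[symmetric] algebra_simps del: ennreal_plus)
      finally show ?thesis by (simp add: mult_left_mono)
    qed
    have K_nu: "(\<integral>\<^sup>+y. K j y \<partial>\<nu>) \<le> ennreal (\<Delta> * \<phi> (S j))" if j: "j \<in> {1..n}" for j
    proof -
      define q where "q y = ennreal (1 / \<Delta>) * K j y" for y
      have [measurable]: "q \<in> borel_measurable borel" unfolding q_def by measurable
      have q1: "q y \<le> 1" for y
        using mult_left_mono[OF K_le[OF j, of y], of "ennreal (1 / \<Delta>)"] D
        by (simp add: q_def ennreal_mult[symmetric])
      have qi: "(\<integral>\<^sup>+y. q y \<partial>lborel) \<le> ennreal (v - S j + (w - S (Suc j)))"
      proof -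
        have "(\<integral>\<^sup>+y. q y \<partial>lborel) = ennreal (1 / \<Delta>) * (\<integral>\<^sup>+y. K j y \<partial>lborel)"
          unfolding q_def by (rule nn_integral_cmult) measurable
        also have "\<dots> \<le> ennreal (1 / \<Delta>) * ennreal (\<Delta> * (v - S j + (w - S (Suc j))))"
          by (intro mult_left_mono K_int[OF j]) simp
        also have "\<dots> = ennreal (v - S j + (w - S (Suc j)))"
          using D S[of j] S[of "Suc j"] j m by (simp add: ennreal_mult[symmetric])
        finally show ?thesis .
      qed
      then obtain c where c: "(\<integral>\<^sup>+y. q y \<partial>lborel) = ennreal c" "0 \<le> c"
        by (cases "\<integral>\<^sup>+y. q y \<partial>lborel") (auto simp: top_unique)
      have "c \<le> v - S j + (w - S (Suc j))"
        using qi S[of j] S[of "Suc j"] j m unfolding c(1) by (subst (asm) ennreal_le_iff) auto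
      \<comment> \<open>The mass is at most \<open>w + v - 2 * S j - \<Delta>\<close>; monotonicity
        of \<open>g\<close> absorbs the missing \<Delta>.\<close>
      then have gle: "g c \<le> \<phi> (S j)" unfolding \<phi>_def using D by (intro monoD[OF gm]) (simp add: SS)
      have "(\<integral>\<^sup>+y. q y \<partial>\<nu>) \<le> ennreal (g c)" by (rule spread_boundedD[OF b _ q1 c]) measurable
      also have "\<dots> \<le> ennreal (\<phi> (S j))" by (rule ennreal_leI[OF gle])
      finally have "(\<integral>\<^sup>+y. q y \<partial>\<nu>) \<le> ennreal (\<phi> (S j))" .
      moreover have "(\<integral>\<^sup>+y. q y \<partial>\<nu>) = ennreal (1 / \<Delta>) * (\<integral>\<^sup>+y. K j y \<partial>\<nu>)"
        unfolding q_def by (rule nn_integral_cmult) measurable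
      ultimately have "ennreal \<Delta> * (ennreal (1 / \<Delta>) * (\<integral>\<^sup>+y. K j y \<partial>\<nu>)) \<le> ennreal \<Delta> * ennreal (\<phi> (S j))"
        by (intro mult_left_mono) auto
      then show ?thesis using D \<phi>0[of "S j"] S[of j] j
        by (simp add: mult.assoc[symmetric] ennreal_mult[symmetric])
    qed
    have "(\<integral>\<^sup>+y. k y \<partial>\<nu>) \<le> (\<integral>\<^sup>+y. ennreal (3 * \<Delta>) + (\<Sum>j=1..n. K j y) \<partial>\<nu>)"
      by (intro nn_integral_mono k_le)
    also have "\<dots> = ennreal (3 * \<Delta>) + (\<Sum>j=1..n. (\<integral>\<^sup>+y. K j y \<partial>\<nu>))"
      by (simp add: nn_integral_add nn_integral_sum N.emeasure_space_1)
    also have "\<dots> \<le> ennreal (3 * \<Delta>) + (\<Sum>j=1..n. ennreal (\<Delta> * \<phi> (S j)))"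
      by (intro add_left_mono sum_mono K_nu)
    also have "\<dots> = ennreal (3 * \<Delta> + (\<Sum>j=1..n. \<Delta> * \<phi> (S j)))"
    proof -
      have nn: "0 \<le> \<Delta> * \<phi> (S j)" if "j \<in> {1..n}" for j
        using D \<phi>0[of "S j"] S[of j] that by auto
      show ?thesis using D sum_nonneg[of "{1..n}", OF nn] by (subst sum_ennreal) (use nn in \<open>auto\<close>)
    qed
    also have "\<dots> \<le> ennreal (3 * (m / real (n + 2)) + I)"
    proof (rule ennreal_leI)
      have "(\<Sum>j=1..n. \<Delta> * \<phi> (S j)) \<le> integral {0..real n * \<Delta>} \<phi>"
        unfolding S_def by (rule integral_antimono_sum_le[OF \<phi>c \<phi>m]) (use D in simp)
      also have "\<dots> \<le> I" unfolding I_def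
      proof (rule integral_subset_le)
        have "real n * \<Delta> \<le> real (n + 2) * \<Delta>" using D by (intro mult_right_mono) auto
        then show "{0..real n * \<Delta>} \<subseteq> {0..m}" by (auto simp: \<Delta>_def)
      qed (use \<phi>0 \<phi>c in \<open>auto intro!: integrable_continuous_real intro: continuous_on_subset\<close>)
      finally show "3 * \<Delta> + (\<Sum>j=1..n. \<Delta> * \<phi> (S j)) \<le> 3 * (m / real (n + 2)) + I"
        by (simp add: \<Delta>_def)
    qed
    finally show ?thesis .
  qed
  show "(\<integral>\<^sup>+x. f x \<partial>(\<mu> \<star> \<nu>)) \<le> ennreal (window_avg w g v)"
  proof -
    have top: "(\<integral>\<^sup>+y. k y \<partial>\<nu>) \<noteq> \<infinity>" using main[of 0] by (auto simp: top_unique)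
    then obtain r where r: "(\<integral>\<^sup>+x. f x \<partial>(\<mu> \<star> \<nu>)) = ennreal r" "0 \<le> r"
      unfolding kE using w by (cases "\<integral>\<^sup>+x. f x \<partial>(\<mu> \<star> \<nu>)") (auto simp: ennreal_mult_top)
    have I0: "0 \<le> I" unfolding I_def by (rule integral_nonneg)
        (use \<phi>0 \<phi>c in \<open>auto intro!: integrable_continuous_real intro: continuous_on_subset\<close>)
    have m0: "0 \<le> m" using w v0 by (simp add: m_def)
    have le: "w * r \<le> 3 * (m / real (n + 2)) + I" for n
    proof -
      have "ennreal (w * r) \<le> ennreal (3 * (m / real (n + 2)) + I)"
        using main[of n] w r(2) unfolding kE r(1) by (simp only: ennreal_mult less_imp_le)
      then show ?thesis by (subst (asm) ennreal_le_iff) (use I0 m0 in auto)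
    qed
    have lim: "(\<lambda>n. 3 * (m / real (n + 2)) + I) \<longlonglongrightarrow> 3 * 0 + I"
    proof (intro tendsto_intros)
      have "(\<lambda>n. m / real n) \<longlonglongrightarrow> 0" by (rule lim_const_over_n)
      then show "(\<lambda>n. m / real (n + 2)) \<longlonglongrightarrow> 0" by (rule LIMSEQ_ignore_initial_segment)
    qed
    have "w * r \<le> 3 * 0 + I" using le by (intro LIMSEQ_le_const[OF lim]) auto
    then have "r \<le> I / w" using w by (simp add: field_simps)
    then show ?thesis unfolding r I by (rule ennreal_leI)
  qed
qed

section \<open>Estimates for the cardinal sine\<close>

definition csinc :: "real \<Rightarrow> real" where
  "csinc y = (if y = 0 then 1 else sin y / y)"

lemma csinc_measurable[measurable]: "csinc \<in> borel_measurable borel"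
  using borel_measurable_sinc unfolding csinc_def[abs_def] .

lemma csinc_abs_le_1: "\<bar>csinc y\<bar> \<le> 1"
  using abs_sin_x_le_abs_x[of y] by (auto simp: csinc_def abs_divide field_simps)

lemma csinc_abs_le: "y \<noteq> 0 \<Longrightarrow> \<bar>csinc y\<bar> \<le> 1 / \<bar>y\<bar>"
  using abs_sin_le_one[of y] by (auto simp: csinc_def abs_divide field_simps)

lemma csinc_nonneg: "0 \<le> y \<Longrightarrow> y \<le> pi \<Longrightarrow> 0 \<le> csinc y"
  using sin_ge_zero[of y] by (auto simp: csinc_def)

lemma csinc_nonpos: "pi \<le> y \<Longrightarrow> y \<le> 2 * pi \<Longrightarrow> csinc y \<le> 0"
  using sin_le_zero[of y] pi_gt_zero by (cases "y = 2 * pi") (auto simp: csinc_def divide_nonpos_pos)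

lemma sin_minus_x_cos_nonneg:
  fixes y :: real
  assumes "0 \<le> y" "y \<le> pi"
  shows "0 \<le> sin y - y * cos y"
proof -
  have "sin 0 - 0 * cos 0 \<le> sin y - y * cos y"
  proof (rule DERIV_nonneg_imp_nondecreasing[OF assms(1)])
    fix x assume "0 \<le> x" "x \<le> y"
    then show "\<exists>d. DERIV (\<lambda>y. sin y - y * cos y) x :> d \<and> d \<ge> 0"
      using assms by (intro exI[of _ "x * sin x"] conjI) (auto intro!: derivative_eq_intros mult_nonneg_nonneg sin_ge_zero)
  qed
  then show ?thesis by simp
qed

text \<open>The exponent consists of the first two terms of the power series of
  \<open>- ln (csinc y)\<close>, all of whose coefficients are positive. The proof shows that the
  quotient of the two sides decreases; two further differentiations reduce the sign of its
  derivative to that of \<open>sin x - x * cos x\<close> and \<open>sin x\<close> on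
  \<open>[0, pi]\<close>.\<close>

lemma csinc_le_exp:
  assumes "0 \<le> y" "y \<le> pi"
  shows "csinc y \<le> exp (- (y\<^sup>2 / 6 + y ^ 4 / 180))"
proof (cases "y = 0")
  case False
  with assms have y: "0 < y" by simp
  have 2: "0 \<le> sin y * (1 / 3 - 4 * y\<^sup>2 / 45) - cos y * (y / 3 + y ^ 3 / 45)" (is "0 \<le> ?l y")
    if "0 \<le> y" "y \<le> pi" for y :: real
  proof -
    have "?l 0 \<le> ?l y"
    proof (rule DERIV_nonneg_imp_nondecreasing[OF that(1)])
      fix x assume x: "0 \<le> x" "x \<le> y"
      have "DERIV ?l x :> 7 * x / 45 * (sin x - x * cos x) + x ^ 3 * sin x / 45"
        by (auto intro!: derivative_eq_intros simp: field_simps power2_eq_square power3_eq_cube)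
      moreover have "0 \<le> 7 * x / 45 * (sin x - x * cos x) + x ^ 3 * sin x / 45"
        using x that sin_minus_x_cos_nonneg[of x] sin_ge_zero[of x] by auto
      ultimately show "\<exists>d. DERIV ?l x :> d \<and> d \<ge> 0" by blast
    qed
    then show ?thesis by simp
  qed
  have 3: "0 \<le> sin y * (1 - y\<^sup>2 / 3 - y ^ 4 / 45) - y * cos y" (is "0 \<le> ?k y")
    if "0 \<le> y" "y \<le> pi" for y :: real
  proof -
    have "?k 0 \<le> ?k y"
    proof (rule DERIV_nonneg_imp_nondecreasing[OF that(1)])
      fix x assume x: "0 \<le> x" "x \<le> y"
      have "DERIV ?k x :> x * (sin x * (1 / 3 - 4 * x\<^sup>2 / 45) - cos x * (x / 3 + x ^ 3 / 45))"
        by (auto intro!: derivative_eq_intros simp: field_simps power2_eq_square power3_eq_cube power4_eq_xxxx)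
      moreover have "0 \<le> x * (sin x * (1 / 3 - 4 * x\<^sup>2 / 45) - cos x * (x / 3 + x ^ 3 / 45))"
        using x that 2[of x] by auto
      ultimately show "\<exists>d. DERIV ?k x :> d \<and> d \<ge> 0" by blast
    qed
    then show ?thesis by simp
  qed
  define W where "W y = y\<^sup>2 / 6 + y ^ 4 / 180" for y :: real
  define r where "r y = sin y / y * exp (W y)" for y :: real
  have dec: "r y \<le> r e" if e: "0 < e" "e \<le> y" for e
  proof (rule DERIV_nonpos_imp_nonincreasing[OF e(2)])
    fix x assume x: "e \<le> x" "x \<le> y"
    have "DERIV r x :> - exp (W x) / x\<^sup>2 * (sin x * (1 - x\<^sup>2 / 3 - x ^ 4 / 45) - x * cos x)"
      unfolding r_def W_def using x e
      by (auto intro!: derivative_eq_intros simp: field_simps power2_eq_square power3_eq_cube power4_eq_xxxx)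
    moreover have "- exp (W x) / x\<^sup>2 * (sin x * (1 - x\<^sup>2 / 3 - x ^ 4 / 45) - x * cos x) \<le> 0"
      using 3[of x] x e assms by (intro mult_nonpos_nonneg) auto
    ultimately show "\<exists>d. DERIV r x :> d \<and> d \<le> 0" by blast
  qed
  \<comment> \<open>At 0 itself \<open>r\<close> has the default value of a division by zero, so the
    comparison value 1 is obtained as a right limit.\<close>
  have "(r \<longlongrightarrow> 1 * exp 0) (at_right 0)" unfolding r_def
  proof (intro tendsto_mult tendsto_exp)
    show "((\<lambda>x::real. sin x / x) \<longlongrightarrow> 1) (at_right 0)"
      by (rule tendsto_within_subset[OF sinc_at_0]) simp
    have "isCont W 0" unfolding W_def by (intro continuous_intros) auto
    then have "(W \<longlongrightarrow> W 0) (at 0)" unfolding isCont_def .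
    then have "(W \<longlongrightarrow> W 0) (at_right 0)" by (rule tendsto_within_subset) simp
    then show "(W \<longlongrightarrow> 0) (at_right 0)" by (simp add: W_def)
  qed
  moreover have "\<forall>\<^sub>F e in at_right 0. r y \<le> r e"
    using eventually_at_right_real[OF y] by eventually_elim (use dec in auto)
  ultimately have "r y \<le> 1 * exp 0" by (intro tendsto_lowerbound) auto
  then have "csinc y * exp (W y) \<le> 1" using y by (simp add: r_def csinc_def)
  then show ?thesis by (simp add: exp_minus W_def[symmetric] field_simps)
qed (simp add: csinc_def)

text \<open>The product of \<open>1 + u + u\<^sup>2 / 2\<close> and
  \<open>1 - u + u\<^sup>2 / 2\<close> is \<open>1 + u ^ 4 / 4\<close>, hence at least 1, and the
  first factor is at most \<open>exp u\<close>.\<close>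

lemma exp_minus_le_quadratic:
  fixes u :: real
  assumes "0 \<le> u"
  shows "exp (- u) \<le> 1 - u + u\<^sup>2 / 2"
proof -
  have "1 + u + u\<^sup>2 / 2 \<le> exp u" by (rule exp_lower_Taylor_quadratic[OF assms])
  moreover have "0 < 1 - u + u\<^sup>2 / 2"
  proof -
    have "1 - u + u\<^sup>2 / 2 = ((u - 1)\<^sup>2 + 1) / 2" by (simp add: power2_eq_square field_simps)
    moreover have "0 < ((u - 1)\<^sup>2 + 1) / 2" by (simp add: add_nonneg_pos)
    ultimately show ?thesis by simp
  qed
  ultimately have "(1 + u + u\<^sup>2 / 2) * (1 - u + u\<^sup>2 / 2) \<le> exp u * (1 - u + u\<^sup>2 / 2)"
    by (intro mult_right_mono) auto
  moreover have "(1 + u + u\<^sup>2 / 2) * (1 - u + u\<^sup>2 / 2) = 1 + u ^ 4 / 4"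
    by (simp add: algebra_simps power2_eq_square power4_eq_xxxx)
  moreover have "0 \<le> u ^ 4 / 4" by simp
  ultimately have "1 \<le> exp u * (1 - u + u\<^sup>2 / 2)" by linarith
  then show ?thesis by (simp add: exp_minus field_simps)
qed

section \<open>Tail integrals of squared sines and Gaussian integrals\<close>

lemma nn_integral_scale:
  fixes h :: "real \<Rightarrow> ennreal"
  assumes [measurable]: "h \<in> borel_measurable borel" and a: "0 < a"
  shows "(\<integral>\<^sup>+t. h (a * t) \<partial>lborel) = ennreal (1 / a) * (\<integral>\<^sup>+t. h t \<partial>lborel)"
  using nn_integral_real_affine[of h a 0] a
  by (simp add: mult.assoc[symmetric] ennreal_mult[symmetric])

text \<open>The mean value \<open>1 / 2\<close> of the squared sine accounts for
  \<open>1 / (2 * pi)\<close>. Two integrations by parts of the oscillating term leave a remainder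
  of favourable sign, which is added to the integrand in \<open>h\<close>; \<open>H\<close> collects
  the boundary terms, and only the first of them survives at \<open>pi\<close>.\<close>

lemma nn_integral_sin_sq_over_sq:
  "(\<integral>\<^sup>+y. ennreal ((sin y)\<^sup>2 / y\<^sup>2) * indicator {pi..} y \<partial>lborel) \<le> ennreal (1 / (2 * pi))"
proof -
  define H where "H y = - 1 / (2 * y) - sin (2 * y) / (4 * y\<^sup>2) - (1 - cos (2 * y)) / (4 * y ^ 3)" for y :: real
  define h where "h y = (sin y)\<^sup>2 / y\<^sup>2 + 3 * (1 - cos (2 * y)) / (4 * y ^ 4)" for y :: real
  have "(\<integral>\<^sup>+y. ennreal ((sin y)\<^sup>2 / y\<^sup>2) * indicator {pi..} y \<partial>lborel) \<le> (\<integral>\<^sup>+y. ennreal (h y) * indicator {pi..} y \<partial>lborel)"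
    by (intro nn_integral_mono mult_right_mono ennreal_leI) (auto simp: h_def)
  also have "\<dots> = ennreal (0 - H pi)"
  proof (rule nn_integral_FTC_atLeast)
    show "h \<in> borel_measurable borel" unfolding h_def by measurable
    fix x :: real assume "pi \<le> x"
    then have x: "0 < x" using pi_gt_zero by linarith
    have d1: "DERIV (\<lambda>y. - 1 / (2 * y)) x :> 1 / (2 * x\<^sup>2)"
      using x by (auto intro!: derivative_eq_intros simp: power2_eq_square)
    have d2: "DERIV (\<lambda>y. sin (2 * y) / (4 * y\<^sup>2)) x :> cos (2 * x) / (2 * x\<^sup>2) - sin (2 * x) / (2 * x ^ 3)"
      using x by (auto intro!: derivative_eq_intros simp: field_simps power2_eq_square power3_eq_cube)
    have d3: "DERIV (\<lambda>y. (1 - cos (2 * y)) / (4 * y ^ 3)) x :> sin (2 * x) / (2 * x ^ 3) - 3 * (1 - cos (2 * x)) / (4 * x ^ 4)"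
      using x by (auto intro!: derivative_eq_intros simp: field_simps power2_eq_square power3_eq_cube power4_eq_xxxx)
    have D: "DERIV H x :> 1 / (2 * x\<^sup>2) - (cos (2 * x) / (2 * x\<^sup>2) - sin (2 * x) / (2 * x ^ 3))
        - (sin (2 * x) / (2 * x ^ 3) - 3 * (1 - cos (2 * x)) / (4 * x ^ 4))"
      unfolding H_def by (rule DERIV_diff[OF DERIV_diff[OF d1 d2] d3])
    have E: "1 / (2 * x\<^sup>2) - (cos (2 * x) / (2 * x\<^sup>2) - sin (2 * x) / (2 * x ^ 3))
        - (sin (2 * x) / (2 * x ^ 3) - 3 * (1 - cos (2 * x)) / (4 * x ^ 4)) = h x"
    proof -
      have "1 / (2 * x\<^sup>2) - cos (2 * x) / (2 * x\<^sup>2) = (sin x)\<^sup>2 / x\<^sup>2"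
        using x by (simp add: cos_double_sin diff_divide_distrib[symmetric])
      then show ?thesis by (simp add: h_def)
    qed
    show "DERIV H x :> h x" using D unfolding E .
    show "0 \<le> h x" using x by (simp add: h_def)
  next
    show "(H \<longlongrightarrow> 0) at_top"
    proof (rule Lim_null_comparison)
      show "\<forall>\<^sub>F y in at_top. norm (H y) \<le> 1 / (2 * y) + 1 / (4 * y\<^sup>2) + 2 / (4 * y ^ 3)"
        using eventually_gt_at_top[of 0]
      proof eventually_elim
        case (elim y)
        have "\<bar>sin (2 * y)\<bar> / (4 * y\<^sup>2) \<le> 1 / (4 * y\<^sup>2)" by (intro divide_right_mono) auto
        moreover have "\<bar>1 - cos (2 * y)\<bar> / (4 * y ^ 3) \<le> 2 / (4 * y ^ 3)"
          using elim cos_ge_minus_one[of "2 * y"] cos_le_one[of "2 * y"]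
          by (intro divide_right_mono) (simp_all add: abs_le_iff)
        moreover have "norm (H y) \<le> \<bar>1 / (2 * y)\<bar> + \<bar>sin (2 * y) / (4 * y\<^sup>2)\<bar> + \<bar>(1 - cos (2 * y)) / (4 * y ^ 3)\<bar>"
          unfolding H_def real_norm_def by linarith
        moreover have "\<bar>(1 - cos (2 * y)) / (4 * y ^ 3)\<bar> = \<bar>1 - cos (2 * y)\<bar> / (4 * y ^ 3)"
          "\<bar>sin (2 * y) / (4 * y\<^sup>2)\<bar> = \<bar>sin (2 * y)\<bar> / (4 * y\<^sup>2)" "\<bar>1 / (2 * y)\<bar> = 1 / (2 * y)"
          using elim by (simp_all only: abs_divide abs_mult) auto
        ultimately show ?case by linarith
      qed
      show "((\<lambda>y::real. 1 / (2 * y) + 1 / (4 * y\<^sup>2) + 2 / (4 * y ^ 3)) \<longlongrightarrow> 0) at_top" by real_asymp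
    qed
  qed
  also have "0 - H pi = 1 / (2 * pi)" by (simp add: H_def)
  finally show ?thesis .
qed

text \<open>Again the mean value \<open>1 / 2\<close> gives the bound, and two integrations by parts
  leave a nonnegative excess in \<open>h\<close>.\<close>

lemma nn_integral_sin_sq_over_cube:
  "(\<integral>\<^sup>+y. ennreal ((sin y)\<^sup>2 / y ^ 3) * indicator {pi..} y \<partial>lborel) \<le> ennreal (1 / (4 * pi\<^sup>2))"
proof -
  define H where "H y = - 1 / (4 * y\<^sup>2) - sin (2 * y) / (4 * y ^ 3) - 3 * (1 - cos (2 * y)) / (8 * y ^ 4)" for y :: real
  define h where "h y = (sin y)\<^sup>2 / y ^ 3 + 3 * (1 - cos (2 * y)) / (2 * y ^ 5)" for y :: real
  have "(\<integral>\<^sup>+y. ennreal ((sin y)\<^sup>2 / y ^ 3) * indicator {pi..} y \<partial>lborel) \<le> (\<integral>\<^sup>+y. ennreal (h y) * indicator {pi..} y \<partial>lborel)"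
  proof (intro nn_integral_mono)
    fix y :: real
    have "0 \<le> 3 * (1 - cos (2 * y)) / (2 * y ^ 5)" if "pi \<le> y"
      using that order_trans[OF pi_ge_zero that] by (intro divide_nonneg_nonneg) auto
    then show "ennreal ((sin y)\<^sup>2 / y ^ 3) * indicator {pi..} y \<le> ennreal (h y) * indicator {pi..} y"
      by (auto simp: h_def intro!: ennreal_leI split: split_indicator)
  qed
  also have "\<dots> = ennreal (0 - H pi)"
  proof (rule nn_integral_FTC_atLeast)
    show "h \<in> borel_measurable borel" unfolding h_def by measurable
    fix x :: real assume "pi \<le> x"
    then have x: "0 < x" using pi_gt_zero by linarith
    have d1: "DERIV (\<lambda>y. - 1 / (4 * y\<^sup>2)) x :> 1 / (2 * x ^ 3)"
      using x by (auto intro!: derivative_eq_intros simp: field_simps power2_eq_square power3_eq_cube)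
    have d2: "DERIV (\<lambda>y. sin (2 * y) / (4 * y ^ 3)) x :> cos (2 * x) / (2 * x ^ 3) - 3 * sin (2 * x) / (4 * x ^ 4)"
      using x by (auto intro!: derivative_eq_intros simp: field_simps power2_eq_square power3_eq_cube power4_eq_xxxx)
    have d3: "DERIV (\<lambda>y. 3 * (1 - cos (2 * y)) / (8 * y ^ 4)) x :> 3 * sin (2 * x) / (4 * x ^ 4) - 3 * (1 - cos (2 * x)) / (2 * x ^ 5)"
      using x by (auto intro!: derivative_eq_intros simp: field_simps eval_nat_numeral)
    have D: "DERIV H x :> 1 / (2 * x ^ 3) - (cos (2 * x) / (2 * x ^ 3) - 3 * sin (2 * x) / (4 * x ^ 4))
        - (3 * sin (2 * x) / (4 * x ^ 4) - 3 * (1 - cos (2 * x)) / (2 * x ^ 5))"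
      unfolding H_def by (rule DERIV_diff[OF DERIV_diff[OF d1 d2] d3])
    have E: "1 / (2 * x ^ 3) - (cos (2 * x) / (2 * x ^ 3) - 3 * sin (2 * x) / (4 * x ^ 4))
        - (3 * sin (2 * x) / (4 * x ^ 4) - 3 * (1 - cos (2 * x)) / (2 * x ^ 5)) = h x"
    proof -
      have "1 / (2 * x ^ 3) - cos (2 * x) / (2 * x ^ 3) = (sin x)\<^sup>2 / x ^ 3"
        using x by (simp add: cos_double_sin diff_divide_distrib[symmetric])
      then show ?thesis by (simp add: h_def)
    qed
    show "DERIV H x :> h x" using D unfolding E .
    show "0 \<le> h x" using x by (simp add: h_def)
  next
    show "(H \<longlongrightarrow> 0) at_top"
    proof (rule Lim_null_comparison)
      show "\<forall>\<^sub>F y in at_top. norm (H y) \<le> 1 / (4 * y\<^sup>2) + 1 / (4 * y ^ 3) + 6 / (8 * y ^ 4)"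
        using eventually_gt_at_top[of 0]
      proof eventually_elim
        case (elim y)
        have "\<bar>sin (2 * y)\<bar> / (4 * y ^ 3) \<le> 1 / (4 * y ^ 3)" using elim by (intro divide_right_mono) auto
        moreover have "\<bar>3 * (1 - cos (2 * y))\<bar> \<le> 6"
        proof -
          have *: "\<bar>3 * (1 - c)\<bar> \<le> 6" if "- 1 \<le> c" "c \<le> 1" for c :: real
            using that by (simp add: abs_if)
          show ?thesis by (rule *[OF cos_ge_minus_one cos_le_one])
        qed
        then have "\<bar>3 * (1 - cos (2 * y))\<bar> / (8 * y ^ 4) \<le> 6 / (8 * y ^ 4)"
          by (intro divide_right_mono) auto
        moreover have "norm (H y) \<le> \<bar>1 / (4 * y\<^sup>2)\<bar> + \<bar>sin (2 * y) / (4 * y ^ 3)\<bar> + \<bar>3 * (1 - cos (2 * y)) / (8 * y ^ 4)\<bar>"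
          unfolding H_def real_norm_def by linarith
        moreover have "\<bar>3 * (1 - cos (2 * y)) / (8 * y ^ 4)\<bar> = \<bar>3 * (1 - cos (2 * y))\<bar> / (8 * y ^ 4)"
          "\<bar>sin (2 * y) / (4 * y ^ 3)\<bar> = \<bar>sin (2 * y)\<bar> / (4 * y ^ 3)" "\<bar>1 / (4 * y\<^sup>2)\<bar> = 1 / (4 * y\<^sup>2)"
          using elim by (simp_all only: abs_divide) auto
        ultimately show ?case by linarith
      qed
      show "((\<lambda>y::real. 1 / (4 * y\<^sup>2) + 1 / (4 * y ^ 3) + 6 / (8 * y ^ 4)) \<longlongrightarrow> 0) at_top" by real_asymp
    qed
  qed
  also have "0 - H pi = 1 / (4 * pi\<^sup>2)" by (simp add: H_def)
  finally show ?thesis .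
qed

text \<open>On \<open>[a, \<infinity>)\<close> the estimate \<open>1 / t \<le> t / a\<^sup>2\<close>
  turns the integrand into an exact derivative.\<close>

lemma nn_integral_gaussian_over_t:
  assumes c: "0 < c" and a: "0 < a"
  shows "(\<integral>\<^sup>+t. ennreal (exp (- c * t\<^sup>2) / t) * indicator {a..} t \<partial>lborel) \<le> ennreal (exp (- c * a\<^sup>2) / (2 * c * a\<^sup>2))"
proof -
  define H where "H t = - exp (- c * t\<^sup>2) / (2 * c * a\<^sup>2)" for t
  define h where "h t = exp (- c * t\<^sup>2) * t / a\<^sup>2" for t
  have "(\<integral>\<^sup>+t. ennreal (exp (- c * t\<^sup>2) / t) * indicator {a..} t \<partial>lborel) \<le> (\<integral>\<^sup>+t. ennreal (h t) * indicator {a..} t \<partial>lborel)"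
  proof (intro nn_integral_mono)
    fix t :: real
    have "1 / t \<le> t / a\<^sup>2" if "a \<le> t"
      using that a mult_mono[of a t a t] by (simp add: field_simps power2_eq_square)
    then have "exp (- c * t\<^sup>2) * (1 / t) \<le> exp (- c * t\<^sup>2) * (t / a\<^sup>2)" if "a \<le> t"
      using that by (intro mult_left_mono) auto
    then show "ennreal (exp (- c * t\<^sup>2) / t) * indicator {a..} t \<le> ennreal (h t) * indicator {a..} t"
      by (auto simp: h_def intro!: ennreal_leI split: split_indicator)
  qed
  also have "\<dots> = ennreal (0 - H a)"
  proof (rule nn_integral_FTC_atLeast)
    show "h \<in> borel_measurable borel" unfolding h_def by measurable
    fix x :: real assume "a \<le> x"
    show "DERIV H x :> h x" unfolding H_def h_def using a c
      by (auto intro!: derivative_eq_intros simp: field_simps)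
    show "0 \<le> h x" using a \<open>a \<le> x\<close> by (simp add: h_def)
  next
    have "((\<lambda>t. exp (- c * t\<^sup>2)) \<longlongrightarrow> 0) at_top" using c by real_asymp
    from tendsto_divide[OF tendsto_minus[OF this] tendsto_const[of "2 * c * a\<^sup>2"]]
    show "(H \<longlongrightarrow> 0) at_top" unfolding H_def using a c by simp
  qed
  finally show ?thesis by (simp add: H_def)
qed

lemma nn_integral_gauss_moment:
  "(\<integral>\<^sup>+t. ennreal (exp (- (t\<^sup>2 / 6)) * t ^ (2 * k)) * indicator {0..} t \<partial>lborel)
    = ennreal (6 ^ k * (sqrt (6 * pi) / 2) * (fact (2 * k) / (2 ^ (2 * k) * fact k)))"
proof -
  have "(\<integral>\<^sup>+t. ennreal (indicator {0..} t *\<^sub>R (exp (- t\<^sup>2) * t ^ (2 * k))) \<partial>lborel)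
     = ennreal (sqrt pi / 2 * (fact (2 * k) / (2 ^ (2 * k) * fact k)))"
    using gaussian_moment_even_pos[of k]
    by (subst nn_integral_eq_integral) (auto simp: has_bochner_integral_iff)
  then have *: "(\<integral>\<^sup>+t. ennreal (exp (- t\<^sup>2) * t ^ (2 * k)) * indicator {0..} t \<partial>lborel)
     = ennreal (sqrt pi / 2 * (fact (2 * k) / (2 ^ (2 * k) * fact k)))"
    by (subst (asm) nn_integral_cong[where v = "\<lambda>t. ennreal (exp (- t\<^sup>2) * t ^ (2 * k)) * indicator {0..} t"])
      (auto split: split_indicator)
  have "(\<integral>\<^sup>+t. ennreal (exp (- (t\<^sup>2 / 6)) * t ^ (2 * k)) * indicator {0..} t \<partial>lborel)
     = ennreal \<bar>sqrt 6\<bar> * (\<integral>\<^sup>+t. ennreal (exp (- ((0 + sqrt 6 * t)\<^sup>2 / 6)) * (0 + sqrt 6 * t) ^ (2 * k)) * indicator {0..} (0 + sqrt 6 * t) \<partial>lborel)"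
    by (rule nn_integral_real_affine) auto
  also have "(\<integral>\<^sup>+t. ennreal (exp (- ((0 + sqrt 6 * t)\<^sup>2 / 6)) * (0 + sqrt 6 * t) ^ (2 * k)) * indicator {0..} (0 + sqrt 6 * t) \<partial>lborel)
     = (\<integral>\<^sup>+t. ennreal (6 ^ k) * (ennreal (exp (- t\<^sup>2) * t ^ (2 * k)) * indicator {0..} t) \<partial>lborel)"
  proof (intro nn_integral_cong)
    fix t :: real
    have "sqrt 6 ^ (2 * k) = 6 ^ k" by (simp add: power_mult)
    then show "ennreal (exp (- ((0 + sqrt 6 * t)\<^sup>2 / 6)) * (0 + sqrt 6 * t) ^ (2 * k)) * indicator {0..} (0 + sqrt 6 * t)
        = ennreal (6 ^ k) * (ennreal (exp (- t\<^sup>2) * t ^ (2 * k)) * indicator {0..} t)"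
      by (auto simp: power_mult_distrib ennreal_mult[symmetric] zero_le_mult_iff mult_ac split: split_indicator)
  qed
  also have "\<dots> = ennreal (6 ^ k) * ennreal (sqrt pi / 2 * (fact (2 * k) / (2 ^ (2 * k) * fact k)))"
    by (subst nn_integral_cmult) (auto simp: *)
  also have "ennreal \<bar>sqrt 6\<bar> * \<dots> = ennreal (6 ^ k * (sqrt (6 * pi) / 2) * (fact (2 * k) / (2 ^ (2 * k) * fact k)))"
    by (simp add: ennreal_mult[symmetric] real_sqrt_mult mult_ac)
  finally show ?thesis .
qed

text \<open>The quartic factor is expanded to second order. The weight
  \<open>exp (- t\<^sup>2 / 6)\<close> is an unnormalised Gaussian of variance 3 with fourth moment
  27 and eighth moment 8505, and \<open>27 / 180 = 3 / 20\<close>,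
  \<open>8505 / 64800 = 21 / 160\<close>.\<close>

lemma nn_integral_gauss_quartic:
  assumes s: "0 \<le> s"
  shows "(\<integral>\<^sup>+t. ennreal (exp (- (t\<^sup>2 / 6 + s * t ^ 4 / 180))) * indicator {0..} t \<partial>lborel)
    \<le> ennreal (sqrt (6 * pi) / 2 * (1 - 3 / 20 * s + 21 / 160 * s\<^sup>2))"
proof -
  define e where "e k t = exp (- (t\<^sup>2 / 6)) * t ^ (2 * k)" for k and t :: real
  have int: "integrable lborel (\<lambda>t. indicator {0..} t * e k t)"
    and val: "(LINT t|lborel. indicator {0..} t * e k t) = 6 ^ k * (sqrt (6 * pi) / 2) * (fact (2 * k) / (2 ^ (2 * k) * fact k))" for k
  proof -
    have "(\<integral>\<^sup>+t. ennreal (indicator {0..} t * e k t) \<partial>lborel) = ennreal (6 ^ k * (sqrt (6 * pi) / 2) * (fact (2 * k) / (2 ^ (2 * k) * fact k)))"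
      using nn_integral_gauss_moment[of k] unfolding e_def
      by (subst (asm) nn_integral_cong[where v = "\<lambda>t. ennreal (indicator {0..} t * (exp (- (t\<^sup>2 / 6)) * t ^ (2 * k)))"])
        (auto split: split_indicator)
    then have "has_bochner_integral lborel (\<lambda>t. indicator {0..} t * e k t) (6 ^ k * (sqrt (6 * pi) / 2) * (fact (2 * k) / (2 ^ (2 * k) * fact k)))"
      by (intro has_bochner_integral_nn_integral) (auto simp: e_def split: split_indicator)
    then show "integrable lborel (\<lambda>t. indicator {0..} t * e k t)"
      "(LINT t|lborel. indicator {0..} t * e k t) = 6 ^ k * (sqrt (6 * pi) / 2) * (fact (2 * k) / (2 ^ (2 * k) * fact k))"
      by (auto simp: has_bochner_integral_iff)
  qed
  define q where "q t = indicator {0..} t * e 0 t - s / 180 * (indicator {0..} t * e 2 t) + s\<^sup>2 / 64800 * (indicator {0..} t * e 4 t)" for t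
  have q: "ennreal (exp (- (t\<^sup>2 / 6 + s * t ^ 4 / 180))) * indicator {0..} t \<le> ennreal (q t)" and q0: "0 \<le> q t" for t
  proof -
    have "exp (- (s * t ^ 4 / 180)) \<le> 1 - s * t ^ 4 / 180 + (s * t ^ 4 / 180)\<^sup>2 / 2"
      by (rule exp_minus_le_quadratic) (use s in auto)
    then have "exp (- (t\<^sup>2 / 6)) * exp (- (s * t ^ 4 / 180)) \<le> exp (- (t\<^sup>2 / 6)) * (1 - s * t ^ 4 / 180 + (s * t ^ 4 / 180)\<^sup>2 / 2)"
      by (intro mult_left_mono) auto
    also have "\<dots> = e 0 t - s / 180 * e 2 t + s\<^sup>2 / 64800 * e 4 t"
      by (simp add: e_def algebra_simps power2_eq_square eval_nat_numeral)
    finally have A: "exp (- (t\<^sup>2 / 6 + s * t ^ 4 / 180)) \<le> e 0 t - s / 180 * e 2 t + s\<^sup>2 / 64800 * e 4 t"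
      by (simp add: exp_add[symmetric])
    have B: "0 \<le> e 0 t - s / 180 * e 2 t + s\<^sup>2 / 64800 * e 4 t" by (rule order_trans[OF exp_ge_zero A])
    show "ennreal (exp (- (t\<^sup>2 / 6 + s * t ^ 4 / 180))) * indicator {0..} t \<le> ennreal (q t)"
      unfolding q_def using ennreal_leI[OF A] by (cases "0 \<le> t") auto
    show "0 \<le> q t"
      unfolding q_def using B by (cases "0 \<le> t") auto
  qed
  have "(\<integral>\<^sup>+t. ennreal (exp (- (t\<^sup>2 / 6 + s * t ^ 4 / 180))) * indicator {0..} t \<partial>lborel) \<le> (\<integral>\<^sup>+t. ennreal (q t) \<partial>lborel)"
    by (intro nn_integral_mono q)
  also have "\<dots> = ennreal (LINT t|lborel. q t)"
    by (rule nn_integral_eq_integral) (use int q0 in \<open>auto simp: q_def\<close>)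
  also have "(LINT t|lborel. q t) = sqrt (6 * pi) / 2 * (1 - 3 / 20 * s + 21 / 160 * s\<^sup>2)"
  proof -
    have "(LINT t|lborel. q t) = (LINT t|lborel. indicator {0..} t * e 0 t) - s / 180 * (LINT t|lborel. indicator {0..} t * e 2 t)
        + s\<^sup>2 / 64800 * (LINT t|lborel. indicator {0..} t * e 4 t)"
      unfolding q_def using int by simp
    also have "\<dots> = sqrt (6 * pi) / 2 * (1 - 3 / 20 * s + 21 / 160 * s\<^sup>2)"
      unfolding val by (simp add: fact_numeral algebra_simps)
    finally show ?thesis .
  qed
  finally show ?thesis .
qed

section \<open>Fourier representation of the peak\<close>

definition csinc_prod :: "real list \<Rightarrow> real \<Rightarrow> real" where
  "csinc_prod ws t = prod_list (map (\<lambda>w. csinc (w * t)) ws)"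

lemma csinc_prod_Nil[simp]: "csinc_prod [] t = 1"
  and csinc_prod_Cons[simp]: "csinc_prod (w # ws) t = csinc (w * t) * csinc_prod ws t"
  by (simp_all add: csinc_prod_def)

lemma csinc_prod_measurable[measurable]: "csinc_prod ws \<in> borel_measurable borel"
proof (induction ws)
  case (Cons w ws)
  have [measurable]: "csinc_prod ws \<in> borel_measurable borel" by fact
  show ?case unfolding csinc_prod_Cons[abs_def] by measurable
qed (simp add: csinc_prod_def[abs_def])

lemma csinc_prod_abs_le_1: "\<bar>csinc_prod ws t\<bar> \<le> 1"
proof (induction ws)
  case (Cons w ws)
  then show ?case using mult_mono[OF csinc_abs_le_1[of "w * t"] Cons] by (simp add: abs_mult)
qed simp

text \<open>Integration by parts gives the antiderivative \<open>F\<close> in terms of the sine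
  integral \<open>Si\<close>, whose limit \<open>pi / 2\<close> at infinity is the value.\<close>

lemma integral_one_minus_cos:
  assumes b: "0 < b"
  shows "set_integrable lborel {0<..} (\<lambda>t. (1 - cos (b * t)) / t\<^sup>2)"
    and "(LBINT t:{0<..}. (1 - cos (b * t)) / t\<^sup>2) = pi * b / 2"
proof -
  define F where "F t = b * Si (b * t) - (1 - cos (b * t)) / t" for t
  have Si0: "Si 0 = 0" using Si_neg[of 0] by simp
  have lim0: "((F \<circ> real_of_ereal) \<longlongrightarrow> 0) (at_right 0)"
  proof -
    have "((\<lambda>t. (1 - cos (b * t)) / t) \<longlongrightarrow> 0) (at_right 0)" using b by real_asymp
    moreover have "((\<lambda>t. b * Si (b * t)) \<longlongrightarrow> b * Si (b * 0)) (at_right 0)"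
      by (intro tendsto_intros isCont_tendsto_compose[OF isCont_Si])
    ultimately have "(F \<longlongrightarrow> b * Si (b * 0) - 0) (at_right 0)" unfolding F_def by (intro tendsto_diff)
    then show ?thesis unfolding zero_ereal_def by (simp add: ereal_tendsto_simps Si0)
  qed
  have limi: "((F \<circ> real_of_ereal) \<longlongrightarrow> pi * b / 2) (at_left \<infinity>)"
  proof -
    have "((\<lambda>t. (1 - cos (b * t)) / t) \<longlongrightarrow> 0) at_top"
    proof (rule Lim_null_comparison)
      show "\<forall>\<^sub>F t in at_top. norm ((1 - cos (b * t)) / t) \<le> 2 / t"
        using eventually_gt_at_top[of 0]
      proof eventually_elim
        case (elim t)
        have "\<bar>1 - cos (b * t)\<bar> \<le> 2" using cos_ge_minus_one[of "b * t"] cos_le_one[of "b * t"] by linarith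
        then show ?case using elim by (simp add: divide_right_mono)
      qed
      show "((\<lambda>t::real. 2 / t) \<longlongrightarrow> 0) at_top" by real_asymp
    qed
    moreover have "((\<lambda>t. b * Si (b * t)) \<longlongrightarrow> b * (pi / 2)) at_top"
      by (intro tendsto_mult tendsto_const filterlim_compose[OF Si_at_top])
        (use b in \<open>auto intro!: filterlim_tendsto_pos_mult_at_top filterlim_ident\<close>)
    ultimately have "(F \<longlongrightarrow> b * (pi / 2) - 0) at_top" unfolding F_def by (rule tendsto_diff[rotated])
    then show ?thesis by (simp add: ereal_tendsto_simps mult.commute)
  qed
  have D: "DERIV F t :> (1 - cos (b * t)) / t\<^sup>2" if "0 < t" for t
  proof -
    have "DERIV (\<lambda>t. Si (b * t)) t :> sinc (b * t) * b"
      by (rule DERIV_chain2[OF DERIV_Si]) (auto intro!: derivative_eq_intros)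
    then have 1: "DERIV (\<lambda>t. b * Si (b * t)) t :> b * sin (b * t) / t"
      using b that by (auto intro!: derivative_eq_intros)
    have 2: "DERIV (\<lambda>t. (1 - cos (b * t)) / t) t :> b * sin (b * t) / t - (1 - cos (b * t)) / t\<^sup>2"
      using that by (auto intro!: derivative_eq_intros simp: field_simps power2_eq_square)
    show ?thesis unfolding F_def using DERIV_diff[OF 1 2] by simp
  qed
  have nn: "0 \<le> (1 - cos (b * t)) / t\<^sup>2" for t by simp
  have e: "einterval 0 \<infinity> = {0<..}" by (auto simp: einterval_def zero_ereal_def)
  have C: "isCont (\<lambda>t. (1 - cos (b * t)) / t\<^sup>2) t" if "0 < t" for t
    by (intro continuous_intros) (use that in auto)
  note FTC = interval_integral_FTC_nonneg[of 0 \<infinity> F "\<lambda>t. (1 - cos (b * t)) / t\<^sup>2", OF _ _ _ _ lim0 limi]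
  have "set_integrable lborel (einterval 0 \<infinity>) (\<lambda>t. (1 - cos (b * t)) / t\<^sup>2)"
    by (rule FTC(1)) (use D C nn in auto)
  then show "set_integrable lborel {0<..} (\<lambda>t. (1 - cos (b * t)) / t\<^sup>2)" unfolding e .
  have "(LBINT t=0..\<infinity>. (1 - cos (b * t)) / t\<^sup>2) = pi * b / 2 - 0"
    by (rule FTC(2)) (use D C nn in auto)
  then show "(LBINT t:{0<..}. (1 - cos (b * t)) / t\<^sup>2) = pi * b / 2"
    by (simp add: interval_lebesgue_integral_0_infty)
qed

lemma integral_one_minus_cos':
  shows "set_integrable lborel {0<..} (\<lambda>t. (1 - cos (b * t)) / t\<^sup>2)"
    and "(LBINT t:{0<..}. (1 - cos (b * t)) / t\<^sup>2) = pi * \<bar>b\<bar> / 2"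
proof -
  have "cos (\<bar>b\<bar> * t) = cos (b * t)" for t by (cases "0 \<le> b") auto
  then have e: "(\<lambda>t. (1 - cos (b * t)) / t\<^sup>2) = (\<lambda>t. (1 - cos (\<bar>b\<bar> * t)) / t\<^sup>2)" by metis
  show "set_integrable lborel {0<..} (\<lambda>t. (1 - cos (b * t)) / t\<^sup>2)"
  proof (cases "b = 0")
    case False
    then show ?thesis unfolding e by (intro integral_one_minus_cos(1)) simp
  qed (simp add: set_integrable_def)
  show "(LBINT t:{0<..}. (1 - cos (b * t)) / t\<^sup>2) = pi * \<bar>b\<bar> / 2"
  proof (cases "b = 0")
    case False
    then show ?thesis unfolding e by (intro integral_one_minus_cos(2)) simp
  qed simp
qed

text \<open>The Fourier formula for a single box. The product of sines becomes a difference of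
  cosines, and \<open>\<bar>v + w\<bar> - \<bar>v - w\<bar>\<close> is the clamp up to the factor
  \<open>2 * w\<close>.\<close>

lemma integral_sin_csinc:
  assumes w: "0 < w"
  shows "2 / pi * (LBINT t:{0<..}. sin (v * t) / t * csinc (w * t)) = max (- 1) (min 1 (v / w))"
proof -
  have "(LBINT t:{0<..}. sin (v * t) / t * csinc (w * t))
     = (LBINT t:{0<..}. 1 / (2 * w) * ((1 - cos ((v + w) * t)) / t\<^sup>2 - (1 - cos ((v - w) * t)) / t\<^sup>2))"
  proof (intro set_lebesgue_integral_cong allI impI)
    fix t :: real assume "t \<in> {0<..}"
    have "2 * (sin (v * t) * sin (w * t)) = cos ((v - w) * t) - cos ((v + w) * t)"
      by (simp add: left_diff_distrib distrib_right cos_add cos_diff)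
    moreover have "1 / (2 * w) * ((1 - cos ((v + w) * t)) / t\<^sup>2 - (1 - cos ((v - w) * t)) / t\<^sup>2)
       = (cos ((v - w) * t) - cos ((v + w) * t)) / (2 * w * t\<^sup>2)"
      by (simp add: diff_divide_distrib[symmetric])
    moreover have "sin (v * t) / t * csinc (w * t) = 2 * (sin (v * t) * sin (w * t)) / (2 * w * t\<^sup>2)"
      using w \<open>t \<in> {0<..}\<close> by (simp add: csinc_def power2_eq_square mult_ac)
    ultimately show "sin (v * t) / t * csinc (w * t)
       = 1 / (2 * w) * ((1 - cos ((v + w) * t)) / t\<^sup>2 - (1 - cos ((v - w) * t)) / t\<^sup>2)"
      by simp
  qed simp
  also have "\<dots> = 1 / (2 * w) * ((LBINT t:{0<..}. (1 - cos ((v + w) * t)) / t\<^sup>2) - (LBINT t:{0<..}. (1 - cos ((v - w) * t)) / t\<^sup>2))"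
    using integral_one_minus_cos'(1) by (simp add: set_integral_diff)
  also have "\<dots> = 1 / (2 * w) * (pi * \<bar>v + w\<bar> / 2 - pi * \<bar>v - w\<bar> / 2)"
    unfolding integral_one_minus_cos'(2) ..
  also have "\<dots> = 1 / (2 * w) * (pi / 2) * (\<bar>v + w\<bar> - \<bar>v - w\<bar>)" by (simp add: algebra_simps)
  also have "\<bar>v + w\<bar> - \<bar>v - w\<bar> = 2 * w * max (- 1) (min 1 (v / w))"
    using w by (auto simp: field_simps max_def min_def abs_if)
  finally have E: "(LBINT t:{0<..}. sin (v * t) / t * csinc (w * t)) = pi / 2 * max (- 1) (min 1 (v / w))"
    using w by simp
  show ?thesis unfolding E by simp
qed

text \<open>The bound \<open>V\<close>, good near 0, and the bound
  \<open>1 / (w * t\<^sup>2)\<close>, good at infinity, add up. The majorant is uniform over a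
  bounded range of \<open>v\<close>, which is what Fubini over a window needs.\<close>

lemma sin_csinc_prod_bound:
  assumes t: "0 < t" and w: "0 < w" and v: "\<bar>v\<bar> \<le> V"
  shows "\<bar>sin (v * t) / t * csinc_prod (w # ws) t\<bar> \<le> (V + 1 / w) * (1 / (1 + t\<^sup>2))"
proof -
  define X where "X = \<bar>sin (v * t) / t * csinc_prod (w # ws) t\<bar>"
  have X: "X = \<bar>sin (v * t)\<bar> / t * \<bar>csinc (w * t)\<bar> * \<bar>csinc_prod ws t\<bar>"
    unfolding X_def using t by (simp add: abs_mult)
  have s: "\<bar>sin (v * t)\<bar> / t \<le> V"
  proof -
    have "\<bar>sin (v * t)\<bar> \<le> \<bar>v\<bar> * t" using abs_sin_x_le_abs_x[of "v * t"] t by (simp add: abs_mult)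
    also have "\<dots> \<le> V * t" using v t by (intro mult_right_mono) auto
    finally show ?thesis using t by (simp add: field_simps)
  qed
  have V: "0 \<le> V" using v by linarith
  have "X \<le> V * 1 * 1" unfolding X
    by (intro mult_mono s csinc_abs_le_1 csinc_prod_abs_le_1) (use t V in auto)
  moreover have "X \<le> (1 / t) * (1 / (w * t)) * 1" unfolding X
  proof (intro mult_mono csinc_prod_abs_le_1)
    show "\<bar>csinc (w * t)\<bar> \<le> 1 / (w * t)" using csinc_abs_le[of "w * t"] w t by simp
    show "\<bar>sin (v * t)\<bar> / t \<le> 1 / t" using t by (intro divide_right_mono) auto
  qed (use t w in auto)
  then have "t\<^sup>2 * X \<le> t\<^sup>2 * ((1 / t) * (1 / (w * t)))" by (intro mult_left_mono) auto
  then have "t\<^sup>2 * X \<le> 1 / w" using t w by (simp add: field_simps power2_eq_square)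
  ultimately have "(1 + t\<^sup>2) * X \<le> V + 1 / w" by (simp add: algebra_simps)
  then have "X \<le> (V + 1 / w) / (1 + t\<^sup>2)" by (simp add: field_simps add_pos_nonneg)
  then show ?thesis by (simp add: X_def)
qed

lemma set_integrable_inverse_square: "set_integrable lborel {0<..} (\<lambda>t::real. C * (1 / (1 + t\<^sup>2)))"
proof (rule set_integrable_mult_right)
  have "{x::real. 0 < x} = {0<..}" by auto
  then show "set_integrable lborel {0<..} (\<lambda>t::real. 1 / (1 + t\<^sup>2))"
    using integrable_I0i_1_div_plus_square
    by (simp add: interval_lebesgue_integrable_def einterval_def zero_ereal_def)
qed

lemma set_integrable_sin_csinc_prod:
  assumes "0 < w"
  shows "set_integrable lborel {0<..} (\<lambda>t. sin (v * t) / t * csinc_prod (w # ws) t)"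
  unfolding set_integrable_def
proof (rule Bochner_Integration.integrable_bound[OF set_integrable_inverse_square[of "\<bar>v\<bar> + 1 / w", unfolded set_integrable_def]])
  show "AE t in lborel. norm (indicat_real {0<..} t *\<^sub>R (sin (v * t) / t * csinc_prod (w # ws) t))
      \<le> norm (indicat_real {0<..} t *\<^sub>R ((\<bar>v\<bar> + 1 / w) * (1 / (1 + t\<^sup>2))))"
  proof (intro AE_I2)
    fix t :: real
    have "0 \<le> (\<bar>v\<bar> + 1 / w) * (1 / (1 + t\<^sup>2))" using assms by (intro mult_nonneg_nonneg) (auto intro: add_nonneg_nonneg)
    then show "norm (indicat_real {0<..} t *\<^sub>R (sin (v * t) / t * csinc_prod (w # ws) t))
      \<le> norm (indicat_real {0<..} t *\<^sub>R ((\<bar>v\<bar> + 1 / w) * (1 / (1 + t\<^sup>2))))"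
      using sin_csinc_prod_bound[of t w v "\<bar>v\<bar>" ws] assms by (cases "0 < t") auto
  qed
qed measurable

text \<open>Fourier inversion for the probability of a symmetric interval. Averaging
  \<open>sin (r * t)\<close> over the window of radius \<open>w\<close> around \<open>v\<close>
  gives \<open>sin (v * t) * csinc (w * t)\<close>, so each further box contributes one
  factor.\<close>

theorem box_conc_fourier:
  assumes "ws \<noteq> []" "\<And>w. w \<in> set ws \<Longrightarrow> 0 < w"
  shows "box_conc ws v = 2 / pi * (LBINT t:{0<..}. sin (v * t) / t * csinc_prod ws t)"
  using assms
proof (induction ws arbitrary: v rule: box_conc.induct)
  case (2 w)
  then show ?case using integral_sin_csinc[of w v] by simp
next
  case (3 w w' ws)
  then have w: "0 < w" "0 < w'" by auto
  let ?W = "w' # ws"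
  define K where "K r t = sin (r * t) / t * csinc_prod ?W t" for r t
  have [measurable]: "(\<lambda>(r, t). K r t) \<in> borel_measurable (lborel \<Otimes>\<^sub>M lborel)" unfolding K_def by measurable
  define C where "C = \<bar>v\<bar> + w + 1 / w'"
  have C: "0 \<le> C" using w by (simp add: C_def)
  let ?I = "\<lambda>r t. indicator {v - w..v + w} r * (indicator {0<..} t * K r t)"
  \<comment> \<open>The majorant \<open>Dm\<close> is a product of a bounded window in
    \<open>r\<close> and a multiple of \<open>1 / (1 + t\<^sup>2)\<close> in \<open>t\<close>, which
    justifies exchanging the integrals.\<close>
  have int: "integrable (lborel \<Otimes>\<^sub>M lborel) (\<lambda>(r, t). ?I r t)"
  proof -
    have *: "integrable lborel (\<lambda>t. indicator {0<..} t * (C * (1 / (1 + t\<^sup>2))))"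
      using set_integrable_inverse_square[of C] by (simp add: set_integrable_def)
    define Dm :: "real \<Rightarrow> real \<Rightarrow> real" where "Dm r t = indicator {v - w..v + w} r * (indicator {0<..} t * (C * (1 / (1 + t\<^sup>2))))" for r t
    have Dm0: "0 \<le> Dm r t" for r t using C by (simp add: Dm_def)
    have [measurable]: "case_prod Dm \<in> borel_measurable (lborel \<Otimes>\<^sub>M lborel)" unfolding Dm_def by measurable
    have "integrable (lborel \<Otimes>\<^sub>M lborel) (case_prod Dm)"
    proof (rule lborel_pair.Fubini_integrable)
      have "(\<lambda>r. LINT t|lborel. norm (case_prod Dm (r, t)))
          = (\<lambda>r. indicator {v - w..v + w} r * (LINT t|lborel. indicator {0<..} t * (C * (1 / (1 + t\<^sup>2)))))"
      proof -
        have "norm (case_prod Dm (r, t)) = Dm r t" for r t using Dm0[of r t] by simp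
        then show ?thesis by (simp only: Dm_def integral_mult_right_zero)
      qed
      moreover have "integrable lborel (indicator {v - w..v + w} :: real \<Rightarrow> real)"
        by (rule integrable_real_indicator) (use w in simp_all)
      ultimately show "integrable lborel (\<lambda>r. LINT t|lborel. norm (case_prod Dm (r, t)))" by simp
      show "AE r in lborel. integrable lborel (\<lambda>t. case_prod Dm (r, t))"
      proof (intro AE_I2)
        fix r show "integrable lborel (\<lambda>t. case_prod Dm (r, t))"
          unfolding case_prod_conv Dm_def by (rule integrable_mult_right) (rule *)
      qed
    qed measurable
    then show ?thesis
    proof (rule Bochner_Integration.integrable_bound)
      show "AE x in lborel \<Otimes>\<^sub>M lborel. norm (case x of (r, t) \<Rightarrow> ?I r t) \<le> norm (case_prod Dm x)"
      proof (intro AE_I2, clarify)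
        fix r t :: real
        have "\<bar>K r t\<bar> \<le> C * (1 / (1 + t\<^sup>2))" if "r \<in> {v - w..v + w}" "0 < t"
          unfolding K_def C_def by (rule sin_csinc_prod_bound) (use that w in \<open>auto simp: abs_if\<close>)
        then show "norm (?I r t) \<le> norm (Dm r t)"
          using C by (auto simp: Dm_def split: split_indicator)
      qed
    qed measurable
  qed
  have inner: "(LINT r|lborel. ?I r t) = 2 * w * (indicator {0<..} t * (sin (v * t) / t * csinc_prod (w # ?W) t))" for t
  proof (cases "0 < t")
    case True
    define F where "F r = - cos (r * t) / t * (csinc_prod ?W t / t)" for r
    have "(LINT r|lborel. ?I r t) = (LINT r|lborel. K r t * indicator {v - w..v + w} r)"
      using True by (intro Bochner_Integration.integral_cong) auto
    also have "\<dots> = F (v + w) - F (v - w)"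
    proof (rule integral_FTC_Icc_real)
      fix r show "DERIV F r :> K r t" unfolding F_def K_def using True
        by (auto intro!: derivative_eq_intros)
      show "isCont (\<lambda>r. K r t) r" unfolding K_def using True by (auto intro!: continuous_intros)
    qed (use w in auto)
    also have "\<dots> = (cos ((v - w) * t) - cos ((v + w) * t)) / t * (csinc_prod ?W t / t)"
      using True by (simp add: F_def field_simps)
    also have "cos ((v - w) * t) - cos ((v + w) * t) = 2 * (sin (v * t) * sin (w * t))"
      by (simp add: left_diff_distrib distrib_right cos_add cos_diff)
    finally show ?thesis using True w by (simp add: csinc_def field_simps)
  qed simp
  have cont: "continuous_on UNIV (box_conc ?W)"
    using odd_concave_box_conc[of ?W] 3 by (simp add: odd_concave_def)
  have IH: "box_conc ?W r = 2 / pi * (LINT t|lborel. indicator {0<..} t * K r t)" for r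
    using 3 by (simp add: set_lebesgue_integral_def K_def)
  have "integral {v - w..v + w} (box_conc ?W) = (LBINT r:{v - w..v + w}. box_conc ?W r)"
    by (rule set_borel_integral_eq_integral(2)[symmetric], rule borel_integrable_atLeastAtMost')
      (use cont continuous_on_subset in blast)
  also have "\<dots> = (LINT r|lborel. 2 / pi * (LINT t|lborel. ?I r t))"
    unfolding set_lebesgue_integral_def by (intro Bochner_Integration.integral_cong) (simp_all add: IH)
  also have "\<dots> = 2 / pi * (LINT r|lborel. LINT t|lborel. ?I r t)" by simp
  also have "(LINT r|lborel. LINT t|lborel. ?I r t) = (LINT t|lborel. LINT r|lborel. ?I r t)"
    by (rule lborel_pair.Fubini_integral[OF int, symmetric])
  also have "\<dots> = 2 * w * (LBINT t:{0<..}. sin (v * t) / t * csinc_prod (w # ?W) t)"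
    by (simp only: inner set_lebesgue_integral_def real_scaleR_def integral_mult_right_zero)
  finally show ?case using w by (simp add: window_avg_def)
qed simp

text \<open>The first weight takes the role of \<open>v\<close>, and
  \<open>sin (w1 * t) / (w1 * t)\<close> supplies its factor. With two factors the product is
  absolutely integrable, which a single \<open>csinc\<close> is not.\<close>

lemma box_peak_fourier:
  assumes "\<And>w. w \<in> set (w1 # w2 # ws) \<Longrightarrow> 0 < w"
  shows "set_integrable lborel {0<..} (csinc_prod (w1 # w2 # ws))"
    and "box_peak (w1 # w2 # ws) = 2 / pi * (LBINT t:{0<..}. csinc_prod (w1 # w2 # ws) t)"
proof -
  have w: "0 < w1" "0 < w2" using assms by auto
  have e: "csinc_prod (w1 # w2 # ws) t = 1 / w1 * (sin (w1 * t) / t * csinc_prod (w2 # ws) t)" if "t \<in> {0<..}" for t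
    using that w by (simp add: csinc_def)
  have "set_integrable lborel {0<..} (\<lambda>t. 1 / w1 * (sin (w1 * t) / t * csinc_prod (w2 # ws) t))"
    by (rule set_integrable_mult_right) (rule set_integrable_sin_csinc_prod[OF w(2)])
  then show "set_integrable lborel {0<..} (csinc_prod (w1 # w2 # ws))"
    by (rule set_integrable_cong[THEN iffD1, rotated -1]) (use e in auto)
  have "box_peak (w1 # w2 # ws) = 2 / pi * (1 / w1 * (LBINT t:{0<..}. sin (w1 * t) / t * csinc_prod (w2 # ws) t))"
    using box_conc_fourier[of "w2 # ws" w1] assms by simp
  also have "1 / w1 * (LBINT t:{0<..}. sin (w1 * t) / t * csinc_prod (w2 # ws) t)
     = (LBINT t:{0<..}. 1 / w1 * (sin (w1 * t) / t * csinc_prod (w2 # ws) t))"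
    by (rule set_integral_mult_right[symmetric])
  also have "\<dots> = (LBINT t:{0<..}. csinc_prod (w1 # w2 # ws) t)"
    by (intro set_lebesgue_integral_cong) (use e in auto)
  finally show "box_peak (w1 # w2 # ws) = 2 / pi * (LBINT t:{0<..}. csinc_prod (w1 # w2 # ws) t)" .
qed

text \<open>Since \<open>ennreal\<close> sends negative numbers to 0, the majorant \<open>U\<close>
  has to dominate only the positive part of the product. Ranges of \<open>t\<close> where the
  product is negative are thereby discarded for free.\<close>

lemma box_peak_le_nn_integral:
  assumes pos: "\<And>w. w \<in> set (w1 # w2 # ws) \<Longrightarrow> 0 < w"
    and U: "\<And>t. 0 < t \<Longrightarrow> ennreal (csinc_prod (w1 # w2 # ws) t) \<le> U t"
    and c: "(\<integral>\<^sup>+t. U t * indicator {0<..} t \<partial>lborel) \<le> ennreal c" "0 \<le> c"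
  shows "box_peak (w1 # w2 # ws) \<le> 2 / pi * c"
proof -
  define f where "f t = indicator {0<..} t * csinc_prod (w1 # w2 # ws) t" for t
  have f: "integrable lborel f" using box_peak_fourier(1)[of w1 w2 ws] pos by (simp add: f_def[abs_def] set_integrable_def)
  have "(LINT t|lborel. f t) \<le> (LINT t|lborel. max 0 (f t))"
    by (rule integral_mono) (use f in auto)
  moreover have "ennreal (LINT t|lborel. max 0 (f t)) \<le> ennreal c"
  proof -
    have "ennreal (LINT t|lborel. max 0 (f t)) = (\<integral>\<^sup>+t. ennreal (max 0 (f t)) \<partial>lborel)"
      by (rule nn_integral_eq_integral[symmetric]) (use f in auto)
    also have "\<dots> \<le> (\<integral>\<^sup>+t. U t * indicator {0<..} t \<partial>lborel)"
      by (intro nn_integral_mono) (use U in \<open>auto simp: f_def max_def ennreal_neg split: split_indicator\<close>)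
    also note c(1)
    finally show ?thesis .
  qed
  then have "(LINT t|lborel. max 0 (f t)) \<le> c" using c(2) by (simp only: ennreal_le_iff)
  ultimately have "(LINT t|lborel. f t) \<le> c" by linarith
  then show ?thesis using box_peak_fourier(2)[of w1 w2 ws] pos
    by (simp add: set_lebesgue_integral_def f_def divide_right_mono mult_left_mono)
qed

section \<open>Small weights\<close>

text \<open>Jensen's inequality for \<open>exp\<close> at the points \<open>ln (x w) / c w\<close>;
  a vanishing factor is set apart because of the logarithm. The inequality stands in for Hoelder's:
  after integration only single powers have to be bounded.\<close>

lemma weighted_amgm_list:
  fixes x c :: "'a \<Rightarrow> real"
  assumes c: "\<And>w. w \<in> set ws \<Longrightarrow> 0 < c w" "sum_list (map c ws) = 1" and x: "\<And>w. w \<in> set ws \<Longrightarrow> 0 \<le> x w"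
  shows "prod_list (map x ws) \<le> (\<Sum>w\<leftarrow>ws. c w * x w powr (1 / c w))"
proof (cases "\<exists>w\<in>set ws. x w = 0")
  case True
  then have "prod_list (map x ws) = 0" by (auto simp: prod_list_zero_iff)
  also have "0 \<le> (\<Sum>w\<leftarrow>ws. c w * x w powr (1 / c w))" using c by (intro sum_list_nonneg) (auto intro!: mult_nonneg_nonneg dest: less_imp_le)
  finally show ?thesis .
next
  case False
  then have x: "\<And>w. w \<in> set ws \<Longrightarrow> 0 < x w" using x by (auto simp: less_le)
  let ?n = "length ws"
  have nz: "{0..<?n} \<noteq> {}" using c(2) by auto
  have cp: "0 < c (ws ! i)" and xp: "0 < x (ws ! i)" if "i \<in> {0..<?n}" for i using that c(1) x by auto
  have "prod_list (map x ws) = (\<Prod>i=0..<?n. x (ws ! i))" by (simp add: prod.list_conv_set_nth)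
  also have "\<dots> = exp (\<Sum>i=0..<?n. c (ws ! i) * (ln (x (ws ! i)) / c (ws ! i)))"
  proof -
    have "(\<Sum>i=0..<?n. c (ws ! i) * (ln (x (ws ! i)) / c (ws ! i))) = (\<Sum>i=0..<?n. ln (x (ws ! i)))"
      by (intro sum.cong) (use cp in \<open>auto simp: less_imp_neq[symmetric]\<close>)
    also have "exp \<dots> = (\<Prod>i=0..<?n. exp (ln (x (ws ! i))))" by (simp add: exp_sum)
    also have "\<dots> = (\<Prod>i=0..<?n. x (ws ! i))" by (intro prod.cong) (use xp in auto)
    finally show ?thesis ..
  qed
  also have "\<dots> \<le> (\<Sum>i=0..<?n. c (ws ! i) * exp (ln (x (ws ! i)) / c (ws ! i)))"
    using convex_on_sum[of "{0..<?n}" UNIV exp "\<lambda>i. c (ws ! i)" "\<lambda>i. ln (x (ws ! i)) / c (ws ! i)"]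
      nz exp_convex c(2) cp by (simp add: sum_list_sum_nth less_imp_le)
  also have "\<dots> = (\<Sum>i=0..<?n. c (ws ! i) * x (ws ! i) powr (1 / c (ws ! i)))"
  proof (intro sum.cong refl)
    fix i assume "i \<in> {0..<?n}"
    then have "0 < x (ws ! i)" by (rule xp)
    then show "c (ws ! i) * exp (ln (x (ws ! i)) / c (ws ! i)) = c (ws ! i) * x (ws ! i) powr (1 / c (ws ! i))"
      by (simp add: powr_def)
  qed
  also have "\<dots> = (\<Sum>w\<leftarrow>ws. c w * x w powr (1 / c w))" by (simp add: sum_list_sum_nth)
  finally show ?thesis .
qed

lemma ennreal_sum_list: "(\<And>x. x \<in> set xs \<Longrightarrow> 0 \<le> f x) \<Longrightarrow> ennreal (\<Sum>x\<leftarrow>xs. f x) = (\<Sum>x\<leftarrow>xs. ennreal (f x))"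
proof (induction xs)
  case (Cons x xs)
  have "0 \<le> (\<Sum>x\<leftarrow>xs. f x)" using Cons.prems by (intro sum_list_nonneg) auto
  then show ?case using Cons by simp
qed simp

lemma nn_integral_weighted_sum_list:
  fixes g :: "'a \<Rightarrow> real \<Rightarrow> ennreal"
  assumes "\<And>w. w \<in> set ws \<Longrightarrow> g w \<in> borel_measurable borel"
    and "\<And>w. w \<in> set ws \<Longrightarrow> (\<integral>\<^sup>+t. g w t \<partial>lborel) \<le> K" and "\<And>w. w \<in> set ws \<Longrightarrow> 0 \<le> c w"
  shows "(\<integral>\<^sup>+t. (\<Sum>w\<leftarrow>ws. ennreal (c w) * g w t) \<partial>lborel) \<le> ennreal (\<Sum>w\<leftarrow>ws. c w) * K"
    and "(\<lambda>t. \<Sum>w\<leftarrow>ws. ennreal (c w) * g w t) \<in> borel_measurable borel"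
  using assms
proof (induction ws)
  case (Cons w ws)
  {
    case 2
    have [measurable]: "g w \<in> borel_measurable borel" "(\<lambda>t. \<Sum>w\<leftarrow>ws. ennreal (c w) * g w t) \<in> borel_measurable borel"
      using 2 Cons.IH(2) by auto
    show ?case by simp
  }
  {
    case 1
    have [measurable]: "g w \<in> borel_measurable borel" "(\<lambda>t. \<Sum>w\<leftarrow>ws. ennreal (c w) * g w t) \<in> borel_measurable borel"
      using 1 Cons.IH(2) by auto
    have "(\<integral>\<^sup>+t. (\<Sum>w\<leftarrow>w # ws. ennreal (c w) * g w t) \<partial>lborel)
        = ennreal (c w) * (\<integral>\<^sup>+t. g w t \<partial>lborel) + (\<integral>\<^sup>+t. (\<Sum>w\<leftarrow>ws. ennreal (c w) * g w t) \<partial>lborel)"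
      by (simp add: nn_integral_add nn_integral_cmult)
    also have "\<dots> \<le> ennreal (c w) * K + ennreal (\<Sum>w\<leftarrow>ws. c w) * K"
      using 1 Cons.IH(1) by (intro add_mono mult_left_mono) auto
    also have "\<dots> = ennreal (\<Sum>w\<leftarrow>w # ws. c w) * K"
    proof -
      have "0 \<le> (\<Sum>w\<leftarrow>ws. c w)" using 1 by (intro sum_list_nonneg) auto
      then show ?thesis using 1 by (simp add: distrib_right)
    qed
    finally show ?case .
  }
qed simp_all

section \<open>Numerical bounds for integrals of single powers\<close>

lemma sqrt_6_pi_le: "sqrt (6 * pi) / 2 \<le> 217085 / 100000"
proof -
  have "6 * pi \<le> (2 * 217085 / 100000)\<^sup>2" using pi_approx(2) by (simp add: power2_eq_square)
  then have "sqrt (6 * pi) \<le> 2 * 217085 / 100000" by (intro real_le_lsqrt) auto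
  then show ?thesis by simp
qed

text \<open>Since \<open>1 - \<epsilon> > 74 / 75\<close>, a peak of at most \<open>\<surd>2 (74 / 75)\<close> contradicts the hypothesis. The integral
  estimates aim at \<open>2.1917\<close>, slightly less than this bound times \<open>\<pi> / 2\<close>.\<close>

lemma target_le: "21917 / 10000 \<le> pi / sqrt 2 * (74 / 75)"
proof -
  have "sqrt 2 \<le> 141422 / 100000" by (rule real_le_lsqrt) (auto simp: power2_eq_square)
  then have "sqrt 2 * (21917 / 10000) \<le> 141422 / 100000 * (21917 / 10000)" by (intro mult_right_mono) auto
  also have "\<dots> \<le> pi * (74 / 75)" using pi_approx(1) by simp
  finally show ?thesis by (simp add: field_simps)
qed

lemma nn_integral_gauss_quartic_numeric:
  assumes "0 \<le> s" "s \<le> 8 / 7"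
  shows "(\<integral>\<^sup>+t. ennreal (exp (- (t\<^sup>2 / 6 + s * t ^ 4 / 180))) * indicator {0..} t \<partial>lborel)
    \<le> ennreal (217085 / 100000 * (1 - 3 / 20 * s + 21 / 160 * s\<^sup>2))"
proof -
  have "0 \<le> 1 - 3 / 20 * s + 21 / 160 * s\<^sup>2" using assms by simp
  then have "sqrt (6 * pi) / 2 * (1 - 3 / 20 * s + 21 / 160 * s\<^sup>2) \<le> 217085 / 100000 * (1 - 3 / 20 * s + 21 / 160 * s\<^sup>2)"
    by (intro mult_right_mono sqrt_6_pi_le)
  then show ?thesis using order_trans[OF nn_integral_gauss_quartic[OF assms(1)] ennreal_leI] by blast
qed

text \<open>Replaces a real power by the two integer powers whose integrals against the squared sine
  are known. The bound \<open>s \<le> 1 / 5 + 5 / 4 * s\<^sup>2\<close> is sharp at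
  \<open>s = 2 / 5\<close>, that is \<open>y = 25 / 4\<close>, close to \<open>2 * pi\<close>; and
  \<open>y powr u \<ge> 1 + u\<close> because \<open>ln y \<ge> 1\<close>.\<close>

lemma powr_tail_bound:
  assumes y: "pi \<le> y" and u: "0 \<le> u"
  shows "1 / y powr (5 / 2 + u) \<le> (1 / 5 / y\<^sup>2 + 5 / 4 / y ^ 3) / (1 + u)"
proof -
  have y3: "3 < y" using y pi_gt3 by linarith
  define s where "s = 1 / sqrt y"
  have s2: "s\<^sup>2 = 1 / y" and s0: "0 < s" using y3 by (simp_all add: s_def power_divide)
  have "s \<le> 1 / 5 + 5 / 4 * s\<^sup>2"
  proof -
    have "1 / 5 + 5 / 4 * s\<^sup>2 - s = 5 / 4 * (s - 2 / 5)\<^sup>2" by (simp add: power2_eq_square algebra_simps)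
    then show ?thesis by (metis diff_ge_0_iff_ge zero_le_divide_iff zero_le_mult_iff zero_le_numeral zero_le_power2)
  qed
  then have "s / y\<^sup>2 \<le> (1 / 5 + 5 / 4 * (1 / y)) / y\<^sup>2" unfolding s2 by (intro divide_right_mono) auto
  also have "\<dots> = 1 / 5 / y\<^sup>2 + 5 / 4 / y ^ 3" using y3 by (simp add: field_simps power2_eq_square power3_eq_cube)
  finally have 1: "s / y\<^sup>2 \<le> 1 / 5 / y\<^sup>2 + 5 / 4 / y ^ 3" .
  have ln: "1 \<le> ln y" using exp_le y3 by (subst ln_ge_iff) auto
  have "1 + u * 1 \<le> 1 + u * ln y" using ln u by (intro add_left_mono mult_left_mono) auto
  also have "\<dots> \<le> y powr u" using exp_ge_add_one_self[of "u * ln y"] y3 by (simp add: powr_def)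
  finally have 2: "1 / y powr u \<le> 1 / (1 + u)" using u by (intro divide_left_mono mult_pos_pos) (use y3 in auto)
  have "y powr (5 / 2) = y powr 2 * y powr (1 / 2)" by (simp add: powr_add[symmetric])
  also have "\<dots> = y\<^sup>2 * sqrt y" using y3 by (simp add: powr_half_sqrt)
  finally have "1 / y powr (5 / 2 + u) = (s / y\<^sup>2) * (1 / y powr u)"
    by (simp add: powr_add s_def)
  also have "\<dots> \<le> (1 / 5 / y\<^sup>2 + 5 / 4 / y ^ 3) * (1 / (1 + u))"
    using 1 2 s0 y3 by (intro mult_mono) auto
  finally show ?thesis by simp
qed

text \<open>In terms of \<open>q = a\<^sup>2\<close> only the square root \<open>a\<close> is not
  rational; it is replaced by a slightly rounded tangent of the square root at
  \<open>q = 2 / 5\<close>.\<close>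

lemma powr_region_numeric:
  assumes a: "0 < a" "a\<^sup>2 \<le> 2 / 5"
  shows "217085 / 100000 * (1 - 3 / 20 * a\<^sup>2 + 21 / 160 * (a\<^sup>2)\<^sup>2)
     + (1 / (10 * pi) + 5 / (16 * pi\<^sup>2)) / (a * (1 + (1 / a\<^sup>2 - 5 / 2))) \<le> 21917 / 10000"
proof -
  define q where "q = a\<^sup>2"
  have q: "0 < q" "q \<le> 2 / 5" using a by (simp_all add: q_def)
  define K where "K = 1 / (10 * pi) + 5 / (16 * pi\<^sup>2)"
  have pi: "314159 / 100000 \<le> pi" using pi_approx(1) by simp
  have "1 / (10 * pi) \<le> 1 / (10 * (314159 / 100000))" using pi by (intro divide_left_mono) auto
  moreover have "5 / (16 * pi\<^sup>2) \<le> 5 / (16 * (314159 / 100000)\<^sup>2)"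
    using pi by (intro divide_left_mono mult_left_mono power_mono mult_pos_pos) auto
  ultimately have K: "K \<le> 635 / 10000" "0 < K" unfolding K_def
    by (auto simp: power2_eq_square add_pos_pos)
  have "K / (a * (1 + (1 / a\<^sup>2 - 5 / 2))) = K * a / (1 - 3 / 2 * q)"
    using a q by (simp add: q_def field_simps power2_eq_square)
  also have "\<dots> \<le> 635 / 10000 * (79058 / 100000 * (q + 2 / 5)) / (1 - 3 / 2 * q)"
  proof (intro divide_right_mono mult_mono)
    have "0 \<le> (a - 63245 / 100000)\<^sup>2" by simp
    then have "2 * (63245 / 100000) * a \<le> q + (63245 / 100000)\<^sup>2" by (simp add: q_def power2_eq_square algebra_simps)
    also have "(63245 / 100000)\<^sup>2 \<le> (2 / 5 :: real)" by (simp add: power2_eq_square)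
    finally show "a \<le> 79058 / 100000 * (q + 2 / 5)" using q by simp
  qed (use K q a in auto)
  finally have 1: "K / (a * (1 + (1 / a\<^sup>2 - 5 / 2))) \<le> 635 / 10000 * (79058 / 100000 * (q + 2 / 5)) / (1 - 3 / 2 * q)" .
  \<comment> \<open>With denominators cleared, the cubic in \<open>q\<close> is arranged by the
    factors \<open>q\<close> and \<open>2 / 5 - q\<close>, so that it is visibly nonnegative on the
    range.\<close>
  have "(21917 / 10000 - 217085 / 100000 * (1 - 3 / 20 * q + 21 / 160 * q\<^sup>2)) * (1 - 3 / 2 * q)
      - 635 / 10000 * (79058 / 100000 * (q + 2 / 5))
      = 192317 / 250000000 + q * (39829 / 12500000 + (2 / 5 - q) * (2474769 / 3200000 - 2735271 / 6400000 * (2 / 5 + q)))"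
    by (simp add: power2_eq_square field_simps)
  moreover have "0 \<le> q * (39829 / 12500000 + (2 / 5 - q) * (2474769 / 3200000 - 2735271 / 6400000 * (2 / 5 + q)))"
    using q by (intro mult_nonneg_nonneg add_nonneg_nonneg) auto
  ultimately have "635 / 10000 * (79058 / 100000 * (q + 2 / 5)) \<le> (21917 / 10000 - 217085 / 100000 * (1 - 3 / 20 * q + 21 / 160 * q\<^sup>2)) * (1 - 3 / 2 * q)"
    by linarith
  then have "635 / 10000 * (79058 / 100000 * (q + 2 / 5)) / (1 - 3 / 2 * q) \<le> 21917 / 10000 - 217085 / 100000 * (1 - 3 / 20 * q + 21 / 160 * q\<^sup>2)"
    by (subst pos_divide_le_eq) (use q in auto)
  with 1 have "217085 / 100000 * (1 - 3 / 20 * q + 21 / 160 * q\<^sup>2) + K / (a * (1 + (1 / a\<^sup>2 - 5 / 2))) \<le> 21917 / 10000"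
    by linarith
  then show ?thesis unfolding K_def q_def .
qed

lemma ennreal_lincomb:
  assumes "0 \<le> k" "0 \<le> a" "0 \<le> b" "0 \<le> x" "0 \<le> y"
  shows "ennreal (k * (a * x + b * y)) = ennreal k * (ennreal a * ennreal x + ennreal b * ennreal y)"
  using assms by (simp add: ennreal_mult)

text \<open>The exponent \<open>1 / a\<^sup>2\<close> makes the quadratic part of the exponential
  bound equal to \<open>t\<^sup>2 / 6\<close> for every \<open>a\<close>, and the quartic part is
  the gain. Past the first zero the exponent is at least \<open>5 / 2\<close>. For exponent 2 the
  integral would be exactly \<open>pi / sqrt 2\<close>, with no room below the target.\<close>

lemma nn_integral_csinc_powr:
  assumes a: "0 < a" "a\<^sup>2 \<le> 2 / 5"
  shows "(\<integral>\<^sup>+t. ennreal (\<bar>csinc (a * t)\<bar> powr (1 / a\<^sup>2)) * indicator {0<..} t \<partial>lborel) \<le> ennreal (21917 / 10000)"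
proof -
  define p u where "p = 1 / a\<^sup>2" and "u = p - 5 / 2"
  have p: "5 / 2 \<le> p" "p * a\<^sup>2 = 1" using a by (simp_all add: p_def field_simps)
  then have u: "0 \<le> u" by (simp add: u_def)
  define A where "A t = ennreal (exp (- (t\<^sup>2 / 6 + a\<^sup>2 * t ^ 4 / 180))) * indicator {0..} t" for t
  define h where "h y = ennreal (1 / (1 + u)) * (ennreal (1 / 5) * (ennreal ((sin y)\<^sup>2 / y\<^sup>2) * indicator {pi..} y)
      + ennreal (5 / 4) * (ennreal ((sin y)\<^sup>2 / y ^ 3) * indicator {pi..} y))" for y
  have [measurable]: "A \<in> borel_measurable borel" "h \<in> borel_measurable borel" unfolding A_def h_def by measurable
  have pt: "ennreal (\<bar>csinc (a * t)\<bar> powr p) * indicator {0<..} t \<le> A t + h (a * t)" for t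
  proof (cases "0 < t")
    case True
    show ?thesis
    proof (cases "a * t \<le> pi")
      case le: True
      have "\<bar>csinc (a * t)\<bar> \<le> exp (- ((a * t)\<^sup>2 / 6 + (a * t) ^ 4 / 180))"
        using csinc_le_exp[of "a * t"] csinc_nonneg[of "a * t"] le a True by simp
      then have "\<bar>csinc (a * t)\<bar> powr p \<le> exp (- ((a * t)\<^sup>2 / 6 + (a * t) ^ 4 / 180)) powr p"
        by (intro powr_mono2) (use p in auto)
      also have "\<dots> = exp (- (p * a\<^sup>2 * t\<^sup>2 / 6 + p * a\<^sup>2 * a\<^sup>2 * t ^ 4 / 180))"
        by (simp add: powr_def algebra_simps power_mult_distrib power2_eq_square power4_eq_xxxx)
      also have "\<dots> = exp (- (t\<^sup>2 / 6 + a\<^sup>2 * t ^ 4 / 180))" unfolding p(2) by simp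
      finally have "ennreal (\<bar>csinc (a * t)\<bar> powr p) * indicator {0<..} t \<le> A t"
        using True by (auto simp: A_def intro: ennreal_leI)
      then show ?thesis by (rule add_increasing2[OF zero_le])
    next
      case False
      define y where "y = a * t"
      have y: "pi \<le> y" "0 < y" using False a True by (auto simp: y_def)
      have "\<bar>csinc y\<bar> powr p = \<bar>sin y\<bar> powr p * (1 / y powr (5 / 2 + u))"
        using y by (simp add: csinc_def abs_divide powr_divide u_def)
      also have "\<dots> \<le> (sin y)\<^sup>2 * ((1 / 5 / y\<^sup>2 + 5 / 4 / y ^ 3) / (1 + u))"
      proof (intro mult_mono powr_tail_bound y u)
        have "\<bar>sin y\<bar> powr p \<le> \<bar>sin y\<bar> powr 2" by (rule powr_mono') (use p in auto)
        also have "\<dots> = (sin y)\<^sup>2" by (cases "sin y = 0") auto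
        finally show "\<bar>sin y\<bar> powr p \<le> (sin y)\<^sup>2" .
      qed auto
      also have "\<dots> = 1 / (1 + u) * (1 / 5 * ((sin y)\<^sup>2 / y\<^sup>2) + 5 / 4 * ((sin y)\<^sup>2 / y ^ 3))"
        using y u by (simp add: field_simps)
      finally have "ennreal (\<bar>csinc y\<bar> powr p) \<le> ennreal (1 / (1 + u) * (1 / 5 * ((sin y)\<^sup>2 / y\<^sup>2) + 5 / 4 * ((sin y)\<^sup>2 / y ^ 3)))"
        by (rule ennreal_leI)
      also have "\<dots> = h y" using y u unfolding h_def
        by (subst ennreal_lincomb) auto
      finally have "ennreal (\<bar>csinc (a * t)\<bar> powr p) * indicator {0<..} t \<le> h (a * t)" using True by (simp add: y_def)
      then show ?thesis by (rule add_increasing[OF zero_le])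
    qed
  qed simp
  have "(\<integral>\<^sup>+t. ennreal (\<bar>csinc (a * t)\<bar> powr p) * indicator {0<..} t \<partial>lborel) \<le> (\<integral>\<^sup>+t. A t + h (a * t) \<partial>lborel)"
    by (intro nn_integral_mono pt)
  also have "\<dots> = (\<integral>\<^sup>+t. A t \<partial>lborel) + (\<integral>\<^sup>+t. h (a * t) \<partial>lborel)"
    by (rule nn_integral_add) measurable
  also have "(\<integral>\<^sup>+t. h (a * t) \<partial>lborel) = ennreal (1 / a) * (\<integral>\<^sup>+y. h y \<partial>lborel)"
    by (rule nn_integral_scale) (use a in auto)
  also have "(\<integral>\<^sup>+y. h y \<partial>lborel) = ennreal (1 / (1 + u)) * (ennreal (1 / 5) * (\<integral>\<^sup>+y. ennreal ((sin y)\<^sup>2 / y\<^sup>2) * indicator {pi..} y \<partial>lborel)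
      + ennreal (5 / 4) * (\<integral>\<^sup>+y. ennreal ((sin y)\<^sup>2 / y ^ 3) * indicator {pi..} y \<partial>lborel))"
    unfolding h_def by (simp add: nn_integral_add nn_integral_cmult)
  also have "(\<integral>\<^sup>+t. A t \<partial>lborel) + ennreal (1 / a) * \<dots> \<le> ennreal (217085 / 100000 * (1 - 3 / 20 * a\<^sup>2 + 21 / 160 * (a\<^sup>2)\<^sup>2))
      + ennreal (1 / a) * (ennreal (1 / (1 + u)) * (ennreal (1 / 5) * ennreal (1 / (2 * pi)) + ennreal (5 / 4) * ennreal (1 / (4 * pi\<^sup>2))))"
    unfolding A_def
    by (intro add_mono mult_left_mono nn_integral_gauss_quartic_numeric nn_integral_sin_sq_over_sq nn_integral_sin_sq_over_cube)
      (use a in auto)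
  also have "\<dots> = ennreal (217085 / 100000 * (1 - 3 / 20 * a\<^sup>2 + 21 / 160 * (a\<^sup>2)\<^sup>2)
      + 1 / a * (1 / (1 + u) * (1 / 5 * (1 / (2 * pi)) + 5 / 4 * (1 / (4 * pi\<^sup>2)))))"
  proof -
    have "0 \<le> 1 - 3 / 20 * a\<^sup>2 + 21 / 160 * (a\<^sup>2)\<^sup>2" using a by simp
    then show ?thesis using a u
      by (simp add: ennreal_mult[symmetric] ennreal_plus[symmetric] del: ennreal_plus)
  qed
  also have "\<dots> \<le> ennreal (21917 / 10000)"
    using powr_region_numeric[OF a] a u by (intro ennreal_leI) (simp add: u_def p_def field_simps)
  finally show ?thesis by (simp add: p_def)
qed


lemma sqrt2_target: "2 / pi * (21917 / 10000) \<le> sqrt 2 * (74 / 75)"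
proof -
  have "2 / pi * (21917 / 10000) \<le> 2 / pi * (pi / sqrt 2 * (74 / 75))"
    by (intro mult_left_mono target_le) simp
  also have "\<dots> = sqrt 2 * (74 / 75)" by (simp add: field_simps)
  finally show ?thesis .
qed

section \<open>Products of \<open>csinc\<close> factors\<close>

lemma csinc_prod_abs_power: "prod_list (map (\<lambda>w. \<bar>csinc (w * t)\<bar> ^ k) ws) = \<bar>csinc_prod ws t\<bar> ^ k"
  by (induction ws) (simp_all add: abs_mult power_mult_distrib)

text \<open>The AM-GM weights \<open>w\<^sup>2 / q\<close> are proportional to the quadratic
  coefficients of the factors, so all the resulting powers share the same Gaussian behaviour near 0.
  The case \<open>k = 2\<close> serves a product that is squared before AM-GM is applied.\<close>

lemma csinc_prod_power_le:
  assumes pos: "\<And>w. w \<in> set ws \<Longrightarrow> 0 < w" and ne: "ws \<noteq> []" and k: "0 < k"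
  defines "q \<equiv> \<Sum>w\<leftarrow>ws. w\<^sup>2"
  shows "\<bar>csinc_prod ws t\<bar> ^ k \<le> (\<Sum>w\<leftarrow>ws. w\<^sup>2 / q * \<bar>csinc (w * t)\<bar> powr (real k * q / w\<^sup>2))"
proof -
  have q: "0 < q"
  proof -
    obtain v vs where v: "ws = v # vs" using ne by (cases ws) auto
    have "0 \<le> (\<Sum>w\<leftarrow>vs. w\<^sup>2)" by (rule sum_list_nonneg) auto
    moreover have "0 < v\<^sup>2" using pos v by auto
    ultimately show ?thesis by (simp add: q_def v add_pos_nonneg)
  qed
  have "\<bar>csinc_prod ws t\<bar> ^ k \<le> (\<Sum>w\<leftarrow>ws. w\<^sup>2 / q * (\<bar>csinc (w * t)\<bar> ^ k) powr (1 / (w\<^sup>2 / q)))"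
    unfolding csinc_prod_abs_power[symmetric]
  proof (rule weighted_amgm_list)
    show "(\<Sum>w\<leftarrow>ws. w\<^sup>2 / q) = 1"
      using q sum_list_mult_const[of "\<lambda>w. w\<^sup>2" "1 / q" ws] by (simp add: q_def)
    show "0 < w\<^sup>2 / q" if "w \<in> set ws" for w
      using pos[OF that] q by simp
  qed auto
  also have "(\<lambda>w. w\<^sup>2 / q * (\<bar>csinc (w * t)\<bar> ^ k) powr (1 / (w\<^sup>2 / q))) = (\<lambda>w. w\<^sup>2 / q * \<bar>csinc (w * t)\<bar> powr (real k * q / w\<^sup>2))"
  proof
    fix w
    have "(\<bar>c\<bar> ^ k) powr y = \<bar>c\<bar> powr (real k * y)" for c y :: real
      using k by (cases "c = 0") (simp_all add: powr_powr powr_realpow[symmetric])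
    then show "w\<^sup>2 / q * (\<bar>csinc (w * t)\<bar> ^ k) powr (1 / (w\<^sup>2 / q)) = w\<^sup>2 / q * \<bar>csinc (w * t)\<bar> powr (real k * q / w\<^sup>2)"
      by simp
  qed
  finally show ?thesis .
qed

lemma csinc_prod_le_exp:
  assumes "\<And>w. w \<in> set ws \<Longrightarrow> 0 \<le> w * t \<and> w * t \<le> pi"
  shows "0 \<le> csinc_prod ws t"
    and "csinc_prod ws t \<le> exp (- ((\<Sum>w\<leftarrow>ws. w\<^sup>2) * t\<^sup>2 / 6 + (\<Sum>w\<leftarrow>ws. w ^ 4) * t ^ 4 / 180))"
  using assms
proof (induction ws)
  case (Cons w ws)
  {
    case 1
    then show ?case using Cons.IH(1) csinc_nonneg[of "w * t"] by simp
  }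
  {
    case 2
    have "csinc (w * t) * csinc_prod ws t \<le> exp (- ((w * t)\<^sup>2 / 6 + (w * t) ^ 4 / 180))
        * exp (- ((\<Sum>w\<leftarrow>ws. w\<^sup>2) * t\<^sup>2 / 6 + (\<Sum>w\<leftarrow>ws. w ^ 4) * t ^ 4 / 180))"
      using 2 Cons.IH csinc_nonneg[of "w * t"] csinc_le_exp[of "w * t"] by (intro mult_mono) auto
    also have "\<dots> = exp (- ((\<Sum>w\<leftarrow>w # ws. w\<^sup>2) * t\<^sup>2 / 6 + (\<Sum>w\<leftarrow>w # ws. w ^ 4) * t ^ 4 / 180))"
      by (simp add: exp_add[symmetric] power_mult_distrib distrib_right add_divide_distrib)
    finally show ?case by simp
  }
qed simp_all

text \<open>All exponents \<open>1 / w\<^sup>2\<close> are at least \<open>5 / 2\<close>, so every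
  single-power integral meets the same target, and the AM-GM weights sum to 1.\<close>

lemma box_peak_le_small:
  assumes pos: "\<And>w. w \<in> set (w1 # w2 # ws) \<Longrightarrow> 0 < w" and sq: "(\<Sum>w\<leftarrow>w1 # w2 # ws. w\<^sup>2) = 1"
    and small: "\<And>w. w \<in> set (w1 # w2 # ws) \<Longrightarrow> w\<^sup>2 \<le> 2 / 5"
  shows "box_peak (w1 # w2 # ws) \<le> sqrt 2 * (74 / 75)"
proof -
  define L where "L = w1 # w2 # ws"
  define g where "g w t = ennreal (\<bar>csinc (w * t)\<bar> powr (1 / w\<^sup>2)) * indicator {0<..} t" for w t
  have "box_peak L \<le> 2 / pi * (21917 / 10000)"
    unfolding L_def
  proof (rule box_peak_le_nn_integral[OF pos])
    fix t :: real assume t: "0 < t"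
    have "csinc_prod L t \<le> \<bar>csinc_prod L t\<bar> ^ 1" by simp
    also have "\<dots> \<le> (\<Sum>w\<leftarrow>L. w\<^sup>2 / (\<Sum>w\<leftarrow>L. w\<^sup>2) * \<bar>csinc (w * t)\<bar> powr (real 1 * (\<Sum>w\<leftarrow>L. w\<^sup>2) / w\<^sup>2))"
      by (rule csinc_prod_power_le) (use pos in \<open>auto simp: L_def\<close>)
    also have "\<dots> = (\<Sum>w\<leftarrow>L. w\<^sup>2 * \<bar>csinc (w * t)\<bar> powr (1 / w\<^sup>2))" using sq by (simp add: L_def)
    finally have "ennreal (csinc_prod L t) \<le> ennreal (\<Sum>w\<leftarrow>L. w\<^sup>2 * \<bar>csinc (w * t)\<bar> powr (1 / w\<^sup>2))"
      by (rule ennreal_leI)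
    also have "\<dots> = (\<Sum>w\<leftarrow>L. ennreal (w\<^sup>2) * ennreal (\<bar>csinc (w * t)\<bar> powr (1 / w\<^sup>2)))"
      by (simp add: ennreal_sum_list ennreal_mult)
    finally show "ennreal (csinc_prod (w1 # w2 # ws) t) \<le> (\<Sum>w\<leftarrow>L. ennreal (w\<^sup>2) * g w t)"
      using t by (simp add: g_def L_def)
  next
    have "(\<Sum>w\<leftarrow>L. ennreal (w\<^sup>2) * g w t) * indicator {0<..} t = (\<Sum>w\<leftarrow>L. ennreal (w\<^sup>2) * g w t)" for t
      by (induction L) (auto simp: g_def split: split_indicator)
    moreover have "(\<integral>\<^sup>+t. (\<Sum>w\<leftarrow>L. ennreal (w\<^sup>2) * g w t) \<partial>lborel) \<le> ennreal (\<Sum>w\<leftarrow>L. w\<^sup>2) * ennreal (21917 / 10000)"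
    proof (rule nn_integral_weighted_sum_list(1))
      fix w assume "w \<in> set L"
      then have w: "0 < w" "w\<^sup>2 \<le> 2 / 5" using pos small by (auto simp: L_def)
      show "g w \<in> borel_measurable borel" unfolding g_def by measurable
      show "(\<integral>\<^sup>+t. g w t \<partial>lborel) \<le> ennreal (21917 / 10000)"
        unfolding g_def by (rule nn_integral_csinc_powr[OF w])
    qed simp
    ultimately show "(\<integral>\<^sup>+t. (\<Sum>w\<leftarrow>L. ennreal (w\<^sup>2) * g w t) * indicator {0<..} t \<partial>lborel) \<le> ennreal (21917 / 10000)"
      using sq by (simp add: L_def)
  qed simp_all
  also note sqrt2_target
  finally show ?thesis by (simp add: L_def)
qed

text \<open>Majorant beyond \<open>t1\<close> of one factor \<open>csinc (a * t)\<close> times the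
  power \<open>\<theta> / w\<^sup>2\<close> of \<open>csinc (w * t)\<close>. The first factor
  contributes \<open>1 / (a * t)\<close>; the second is Gaussian up to its first zero and at most
  its own square afterwards.\<close>

definition tail_fun :: "real \<Rightarrow> real \<Rightarrow> real \<Rightarrow> real \<Rightarrow> real \<Rightarrow> ennreal" where
  "tail_fun a \<theta> t1 w t = ennreal (1 / a) * (ennreal (exp (- (\<theta> / 6) * t\<^sup>2) / t) * indicator {t1..} t
     + ennreal w * (ennreal ((sin (w * t))\<^sup>2 / (w * t) ^ 3) * indicator {pi..} (w * t)))"

lemma tail_fun_measurable[measurable]: "tail_fun a \<theta> t1 w \<in> borel_measurable borel"
  unfolding tail_fun_def[abs_def] by measurable

text \<open>The prefactor \<open>w\<close> cancels the Jacobian, so the bound is the same for every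
  weight.\<close>

lemma nn_integral_sin_sq_over_cube_scaled:
  assumes "0 < w"
  shows "(\<integral>\<^sup>+t. ennreal w * (ennreal ((sin (w * t))\<^sup>2 / (w * t) ^ 3) * indicator {pi..} (w * t)) \<partial>lborel)
    \<le> ennreal (1 / (4 * pi\<^sup>2))"
proof -
  have "(\<integral>\<^sup>+t. ennreal w * (ennreal ((sin (w * t))\<^sup>2 / (w * t) ^ 3) * indicator {pi..} (w * t)) \<partial>lborel)
     = ennreal w * (ennreal (1 / w) * (\<integral>\<^sup>+y. ennreal ((sin y)\<^sup>2 / y ^ 3) * indicator {pi..} y \<partial>lborel))"
    using nn_integral_scale[of "\<lambda>y. ennreal ((sin y)\<^sup>2 / y ^ 3) * indicator {pi..} y" w] assms
    by (simp add: nn_integral_cmult)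
  also have "\<dots> = (\<integral>\<^sup>+y. ennreal ((sin y)\<^sup>2 / y ^ 3) * indicator {pi..} y \<partial>lborel)"
    using assms by (simp add: mult.assoc[symmetric] ennreal_mult[symmetric])
  finally show ?thesis using nn_integral_sin_sq_over_cube by simp
qed

lemma nn_integral_tail_fun:
  assumes "0 < a" "0 < \<theta>" "0 < t1" "0 < w"
  shows "(\<integral>\<^sup>+t. tail_fun a \<theta> t1 w t \<partial>lborel)
    \<le> ennreal (1 / a * (3 * exp (- (\<theta> * t1\<^sup>2 / 6)) / (\<theta> * t1\<^sup>2) + 1 / (4 * pi\<^sup>2)))"
proof -
  have "(\<integral>\<^sup>+t. tail_fun a \<theta> t1 w t \<partial>lborel) = ennreal (1 / a) * ((\<integral>\<^sup>+t. ennreal (exp (- (\<theta> / 6) * t\<^sup>2) / t) * indicator {t1..} t \<partial>lborel)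
     + (\<integral>\<^sup>+t. ennreal w * (ennreal ((sin (w * t))\<^sup>2 / (w * t) ^ 3) * indicator {pi..} (w * t)) \<partial>lborel))"
  proof -
    define G where "G t = ennreal (exp (- (\<theta> / 6) * t\<^sup>2) / t) * indicator {t1..} t" for t
    define S where "S t = ennreal w * (ennreal ((sin (w * t))\<^sup>2 / (w * t) ^ 3) * indicator {pi..} (w * t))" for t
    have [measurable]: "G \<in> borel_measurable borel" "S \<in> borel_measurable borel"
      unfolding G_def S_def by measurable
    have "(\<integral>\<^sup>+t. ennreal (1 / a) * (G t + S t) \<partial>lborel) = ennreal (1 / a) * ((\<integral>\<^sup>+t. G t \<partial>lborel) + (\<integral>\<^sup>+t. S t \<partial>lborel))"
      by (simp add: nn_integral_cmult nn_integral_add)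
    then show ?thesis unfolding tail_fun_def G_def S_def .
  qed
  also have "\<dots> \<le> ennreal (1 / a) * (ennreal (exp (- (\<theta> / 6) * t1\<^sup>2) / (2 * (\<theta> / 6) * t1\<^sup>2)) + ennreal (1 / (4 * pi\<^sup>2)))"
    by (intro mult_left_mono add_mono nn_integral_gaussian_over_t nn_integral_sin_sq_over_cube_scaled) (use assms in auto)
  also have "\<dots> = ennreal (1 / a * (3 * exp (- (\<theta> * t1\<^sup>2 / 6)) / (\<theta> * t1\<^sup>2) + 1 / (4 * pi\<^sup>2)))"
    using assms by (simp add: ennreal_mult[symmetric] ennreal_plus[symmetric] del: ennreal_plus)
  finally show ?thesis .
qed

lemma csinc_tail_le_tail_fun:
  assumes a: "0 < a" and w: "0 < w" "2 * w\<^sup>2 \<le> \<theta>" and t: "0 < t1" "t1 \<le> t"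
  shows "ennreal (\<bar>csinc (a * t)\<bar> * \<bar>csinc (w * t)\<bar> powr (\<theta> / w\<^sup>2)) \<le> tail_fun a \<theta> t1 w t"
proof -
  have t0: "0 < t" using t by simp
  have c: "\<bar>csinc (a * t)\<bar> \<le> 1 / a * (1 / t)" using csinc_abs_le[of "a * t"] a t0 by simp
  have r: "2 \<le> \<theta> / w\<^sup>2" using w by (simp add: field_simps)
  show ?thesis
  proof (cases "w * t \<le> pi")
    case True
    have "\<bar>csinc (w * t)\<bar> \<le> exp (- ((w * t)\<^sup>2 / 6 + (w * t) ^ 4 / 180))"
      using csinc_le_exp[of "w * t"] csinc_nonneg[of "w * t"] True w t0 by simp
    also have "\<dots> \<le> exp (- ((w * t)\<^sup>2 / 6))" by simp
    finally have "\<bar>csinc (w * t)\<bar> powr (\<theta> / w\<^sup>2) \<le> exp (- ((w * t)\<^sup>2 / 6)) powr (\<theta> / w\<^sup>2)"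
      by (intro powr_mono2) (use r in auto)
    also have "\<dots> = exp (- (\<theta> / 6) * t\<^sup>2)" using w by (simp add: powr_def power_mult_distrib)
    finally have "\<bar>csinc (a * t)\<bar> * \<bar>csinc (w * t)\<bar> powr (\<theta> / w\<^sup>2) \<le> (1 / a * (1 / t)) * exp (- (\<theta> / 6) * t\<^sup>2)"
      using c a t0 by (intro mult_mono) auto
    also have "\<dots> = 1 / a * (exp (- (\<theta> / 6) * t\<^sup>2) / t)" by simp
    finally have "ennreal (\<bar>csinc (a * t)\<bar> * \<bar>csinc (w * t)\<bar> powr (\<theta> / w\<^sup>2)) \<le> ennreal (1 / a * (exp (- (\<theta> / 6) * t\<^sup>2) / t))"
      by (rule ennreal_leI)
    also have "\<dots> = ennreal (1 / a) * (ennreal (exp (- (\<theta> / 6) * t\<^sup>2) / t) * indicator {t1..} t)"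
      using a t t0 by (simp add: ennreal_mult[symmetric])
    also have "\<dots> \<le> tail_fun a \<theta> t1 w t" unfolding tail_fun_def
      by (intro mult_left_mono add_increasing2) auto
    finally show ?thesis .
  next
    case False
    define y where "y = w * t"
    have y: "pi \<le> y" "0 < y" using False w t0 by (auto simp: y_def)
    \<comment> \<open>Past the first zero the exponent is lowered to 2; together with the extra
      \<open>1 / t\<close> this gives the squared sine over a cube.\<close>
    have "\<bar>csinc y\<bar> powr (\<theta> / w\<^sup>2) \<le> \<bar>csinc y\<bar> powr 2"
      by (rule powr_mono') (use r csinc_abs_le_1 in auto)
    also have "\<dots> = (csinc y)\<^sup>2" by (cases "csinc y = 0") auto
    also have "\<dots> = (sin y)\<^sup>2 / y\<^sup>2" using y by (simp add: csinc_def power_divide)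
    finally have "\<bar>csinc (a * t)\<bar> * \<bar>csinc y\<bar> powr (\<theta> / w\<^sup>2) \<le> (1 / a * (1 / t)) * ((sin y)\<^sup>2 / y\<^sup>2)"
      using c a t0 by (intro mult_mono) auto
    also have "\<dots> = 1 / a * (w * ((sin y)\<^sup>2 / y ^ 3))"
      using w t0 by (simp add: y_def power2_eq_square power3_eq_cube)
    finally have "ennreal (\<bar>csinc (a * t)\<bar> * \<bar>csinc y\<bar> powr (\<theta> / w\<^sup>2)) \<le> ennreal (1 / a * (w * ((sin y)\<^sup>2 / y ^ 3)))"
      by (rule ennreal_leI)
    also have "\<dots> = ennreal (1 / a) * (ennreal w * (ennreal ((sin y)\<^sup>2 / y ^ 3) * indicator {pi..} y))"
      using a w y by (simp add: ennreal_mult[symmetric])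
    also have "\<dots> \<le> tail_fun a \<theta> t1 w t" unfolding tail_fun_def y_def
      by (intro mult_left_mono add_increasing) auto
    finally show ?thesis by (simp add: y_def)
  qed
qed

text \<open>The factor of frequency \<open>a\<close> is kept aside for its decay
  \<open>1 / t\<close>, and AM-GM acts on the others. The integral bound of \<open>tail_fun\<close>
  is free of \<open>w\<close>, so averaging with weights of sum 1 leaves it unchanged. The condition
  \<open>2 * w\<^sup>2 \<le> real k * q\<close> keeps every exponent at least 2.\<close>

lemma csinc_prod_tail:
  assumes a: "0 < a" and pos: "\<And>w. w \<in> set ws \<Longrightarrow> 0 < w" and ne: "ws \<noteq> []" and k: "0 < k" and t1: "0 < t1"
    and q: "q = (\<Sum>w\<leftarrow>ws. w\<^sup>2)" and small: "\<And>w. w \<in> set ws \<Longrightarrow> 2 * w\<^sup>2 \<le> real k * q"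
  defines "T \<equiv> \<lambda>t. \<Sum>w\<leftarrow>ws. ennreal (w\<^sup>2 / q) * tail_fun a (real k * q) t1 w t"
  shows "t1 \<le> t \<Longrightarrow> ennreal (\<bar>csinc (a * t)\<bar> * \<bar>csinc_prod ws t\<bar> ^ k) \<le> T t"
    and "T \<in> borel_measurable borel"
    and "(\<integral>\<^sup>+t. T t \<partial>lborel) \<le> ennreal (1 / a * (3 * exp (- (real k * q * t1\<^sup>2 / 6)) / (real k * q * t1\<^sup>2) + 1 / (4 * pi\<^sup>2)))"
proof -
  have q0: "0 < q"
  proof -
    obtain v where v: "v \<in> set ws" using ne by (cases ws) auto
    have "0 < 2 * v\<^sup>2" using pos[OF v] by simp
    then have "0 < real k * q" using small[OF v] by linarith
    then show ?thesis using k by (simp add: zero_less_mult_iff)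
  qed
  show "ennreal (\<bar>csinc (a * t)\<bar> * \<bar>csinc_prod ws t\<bar> ^ k) \<le> T t" if t: "t1 \<le> t"
  proof -
    have "\<bar>csinc (a * t)\<bar> * \<bar>csinc_prod ws t\<bar> ^ k
       \<le> \<bar>csinc (a * t)\<bar> * (\<Sum>w\<leftarrow>ws. w\<^sup>2 / q * \<bar>csinc (w * t)\<bar> powr (real k * q / w\<^sup>2))"
      unfolding q by (intro mult_left_mono csinc_prod_power_le) (use pos ne k in auto)
    also have "\<dots> = (\<Sum>w\<leftarrow>ws. w\<^sup>2 / q * (\<bar>csinc (a * t)\<bar> * \<bar>csinc (w * t)\<bar> powr (real k * q / w\<^sup>2)))"
      unfolding sum_list_const_mult[symmetric] by (simp only: mult.left_commute)
    finally have "ennreal (\<bar>csinc (a * t)\<bar> * \<bar>csinc_prod ws t\<bar> ^ k)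
       \<le> ennreal (\<Sum>w\<leftarrow>ws. w\<^sup>2 / q * (\<bar>csinc (a * t)\<bar> * \<bar>csinc (w * t)\<bar> powr (real k * q / w\<^sup>2)))"
      by (rule ennreal_leI)
    also have "\<dots> = (\<Sum>w\<leftarrow>ws. ennreal (w\<^sup>2 / q) * ennreal (\<bar>csinc (a * t)\<bar> * \<bar>csinc (w * t)\<bar> powr (real k * q / w\<^sup>2)))"
    proof -
      have nn: "0 \<le> w\<^sup>2 / q" "0 \<le> \<bar>csinc (a * t)\<bar> * \<bar>csinc (w * t)\<bar> powr (real k * q / w\<^sup>2)" for w
        using q0 by simp_all
      show ?thesis
        by (subst ennreal_sum_list) (simp_all only: ennreal_mult[OF nn] mult_nonneg_nonneg[OF nn])
    qed
    also have "\<dots> \<le> T t" unfolding T_def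
      by (intro sum_list_mono mult_left_mono csinc_tail_le_tail_fun) (use a pos small t1 t in auto)
    finally show ?thesis .
  qed
  show "T \<in> borel_measurable borel" unfolding T_def
    by (rule nn_integral_weighted_sum_list(2)[where K = \<infinity>]) (use q0 in auto)
  have "(\<integral>\<^sup>+t. T t \<partial>lborel) \<le> ennreal (\<Sum>w\<leftarrow>ws. w\<^sup>2 / q)
      * ennreal (1 / a * (3 * exp (- (real k * q * t1\<^sup>2 / 6)) / (real k * q * t1\<^sup>2) + 1 / (4 * pi\<^sup>2)))"
    unfolding T_def
    by (intro nn_integral_weighted_sum_list(1) nn_integral_tail_fun) (use a pos t1 k q0 in auto)
  also have "(\<Sum>w\<leftarrow>ws. w\<^sup>2 / q) = 1"
    using q0 sum_list_mult_const[of "\<lambda>w. w\<^sup>2" "1 / q" ws] by (simp add: q)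
  finally show "(\<integral>\<^sup>+t. T t \<partial>lborel) \<le> ennreal (1 / a * (3 * exp (- (real k * q * t1\<^sup>2 / 6)) / (real k * q * t1\<^sup>2) + 1 / (4 * pi\<^sup>2)))"
    by simp
qed

section \<open>Large weights and the stability of the peak\<close>

text \<open>Between the first zero \<open>\<pi> / w1\<close> and the next sign change the product is negative, so a tail
  bound is only needed beyond \<open>min (\<pi> / w2) (2 \<pi> / w1)\<close>.\<close>

lemma box_peak_le_main_tail:
  assumes pos: "\<And>w. w \<in> set (w1 # w2 # ws) \<Longrightarrow> 0 < w" and ord: "w2 \<le> w1" "\<And>w. w \<in> set ws \<Longrightarrow> w \<le> w2"
    and sq: "w1\<^sup>2 + w2\<^sup>2 + (\<Sum>w\<leftarrow>ws. w\<^sup>2) = 1"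
    and s: "0 \<le> s" "s \<le> 1" "s \<le> w1 ^ 4 + w2 ^ 4"
    and [measurable]: "T \<in> borel_measurable borel"
    and tail: "\<And>t. 0 < t \<Longrightarrow> pi < w1 * t \<Longrightarrow> 2 * pi < w1 * t \<or> pi < w2 * t \<Longrightarrow> ennreal \<bar>csinc_prod (w1 # w2 # ws) t\<bar> \<le> T t"
    and T: "(\<integral>\<^sup>+t. T t \<partial>lborel) \<le> ennreal \<tau>" "0 \<le> \<tau>"
    and num: "217085 / 100000 * (1 - 3 / 20 * s + 21 / 160 * s\<^sup>2) + \<tau> \<le> 21917 / 10000"
  shows "box_peak (w1 # w2 # ws) \<le> sqrt 2 * (74 / 75)"
proof -
  define L where "L = w1 # w2 # ws"
  define A where "A t = ennreal (exp (- (t\<^sup>2 / 6 + s * t ^ 4 / 180))) * indicator {0..} t" for t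
  have [measurable]: "A \<in> borel_measurable borel" unfolding A_def by measurable
  have L1: "w \<le> w1" "0 \<le> w" if "w \<in> set L" for w using that ord pos by (auto simp: L_def intro: order_trans less_imp_le)
  have "box_peak L \<le> 2 / pi * (21917 / 10000)" unfolding L_def
  proof (rule box_peak_le_nn_integral[OF pos])
    fix t :: real assume t: "0 < t"
    show "ennreal (csinc_prod (w1 # w2 # ws) t) \<le> A t + T t"
    proof (cases "w1 * t \<le> pi")
      case True
      have wt: "0 \<le> w * t \<and> w * t \<le> pi" if "w \<in> set L" for w
        using L1[OF that] t True by (auto intro: order_trans[OF mult_right_mono])
      have "csinc_prod L t \<le> exp (- ((\<Sum>w\<leftarrow>L. w\<^sup>2) * t\<^sup>2 / 6 + (\<Sum>w\<leftarrow>L. w ^ 4) * t ^ 4 / 180))"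
        using wt by (rule csinc_prod_le_exp(2))
      also have "\<dots> \<le> exp (- (t\<^sup>2 / 6 + s * t ^ 4 / 180))"
      proof -
        have "0 \<le> (\<Sum>w\<leftarrow>ws. w ^ 4)" by (rule sum_list_nonneg) auto
        then have "s \<le> (\<Sum>w\<leftarrow>L. w ^ 4)" using s by (simp add: L_def)
        moreover have "(\<Sum>w\<leftarrow>L. w\<^sup>2) = 1" using sq by (simp add: L_def)
        ultimately show ?thesis by (simp add: mult_right_mono)
      qed
      finally have "ennreal (csinc_prod L t) \<le> A t" using t by (simp add: A_def ennreal_leI)
      then show ?thesis unfolding L_def by (rule add_increasing2[OF zero_le])
    next
      case False
      show ?thesis
      proof (cases "2 * pi < w1 * t \<or> pi < w2 * t")
        case True
        have "ennreal (csinc_prod L t) \<le> ennreal \<bar>csinc_prod L t\<bar>" by (rule ennreal_leI) simp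
        also have "\<dots> \<le> T t" unfolding L_def by (rule tail) (use t True False in auto)
        finally show ?thesis unfolding L_def by (rule add_increasing[OF zero_le])
      next
        case F: False
        have wt: "0 \<le> w * t \<and> w * t \<le> pi" if "w \<in> set (w2 # ws)" for w
        proof -
          have "w \<le> w2" "0 < w" using that ord pos by auto
          then have "w * t \<le> w2 * t" using t by (intro mult_right_mono) auto
          then have "w * t \<le> pi" using F by linarith
          then show ?thesis using t \<open>0 < w\<close> by simp
        qed
        have "csinc (w1 * t) \<le> 0" using F False by (intro csinc_nonpos) auto
        moreover have "0 \<le> csinc_prod (w2 # ws) t" using wt by (rule csinc_prod_le_exp(1))
        ultimately have "csinc_prod (w1 # w2 # ws) t \<le> 0"
          by (simp add: mult_nonpos_nonneg del: csinc_prod_Cons add: csinc_prod_Cons[of w1])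
        then show ?thesis by (simp add: ennreal_neg del: csinc_prod_Cons)
      qed
    qed
  next
    have "(\<integral>\<^sup>+t. (A t + T t) * indicator {0<..} t \<partial>lborel) \<le> (\<integral>\<^sup>+t. A t + T t \<partial>lborel)"
      by (intro nn_integral_mono) (auto split: split_indicator)
    also have "\<dots> = (\<integral>\<^sup>+t. A t \<partial>lborel) + (\<integral>\<^sup>+t. T t \<partial>lborel)" by (rule nn_integral_add) measurable
    also have "\<dots> \<le> ennreal (217085 / 100000 * (1 - 3 / 20 * s + 21 / 160 * s\<^sup>2)) + ennreal \<tau>"
      unfolding A_def by (intro add_mono nn_integral_gauss_quartic_numeric T) (use s in auto)
    also have "\<dots> = ennreal (217085 / 100000 * (1 - 3 / 20 * s + 21 / 160 * s\<^sup>2) + \<tau>)"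
      using s T by (intro ennreal_plus[symmetric]) auto
    also have "\<dots> \<le> ennreal (21917 / 10000)" using num by (rule ennreal_leI)
    finally show "(\<integral>\<^sup>+t. (A t + T t) * indicator {0<..} t \<partial>lborel) \<le> ennreal (21917 / 10000)" .
  qed simp_all
  also note sqrt2_target
  finally show ?thesis by (simp add: L_def)
qed

text \<open>The squared Taylor bound at \<open>c / 2\<close> is sharper than the Taylor bound at
  \<open>c\<close>, and it stays rational for rational \<open>c\<close>.\<close>

lemma exp_minus_le_inverse_square:
  fixes u :: real
  assumes "0 \<le> c" "c \<le> u"
  shows "exp (- u) \<le> 1 / (1 + c / 2 + (c / 2)\<^sup>2 / 2)\<^sup>2"
proof -
  have "1 + c / 2 + (c / 2)\<^sup>2 / 2 \<le> exp (c / 2)" using assms by (intro exp_lower_Taylor_quadratic) auto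
  then have "(1 + c / 2 + (c / 2)\<^sup>2 / 2)\<^sup>2 \<le> (exp (c / 2))\<^sup>2" using assms by (intro power_mono) auto
  also have "\<dots> = exp c" by (simp add: exp_double[symmetric])
  also have "\<dots> \<le> exp u" using assms by simp
  finally have *: "(1 + c / 2 + (c / 2)\<^sup>2 / 2)\<^sup>2 \<le> exp u" .
  have "0 < (1 + c / 2 + (c / 2)\<^sup>2 / 2)\<^sup>2" using assms by (intro zero_less_power add_pos_nonneg) auto
  then have "1 / exp u \<le> 1 / (1 + c / 2 + (c / 2)\<^sup>2 / 2)\<^sup>2" using * by (intro divide_left_mono) auto
  then show ?thesis by (simp add: exp_minus inverse_eq_divide)
qed

lemma pi_sq_ge: "98695 / 10000 \<le> pi\<^sup>2"
proof -
  have "(314159 / 100000)\<^sup>2 \<le> pi\<^sup>2" using pi_approx(1) by (intro power_mono) auto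
  then show ?thesis by (simp add: power2_eq_square)
qed

text \<open>The second weight is small: relative to \<open>q = 1 - w1\<^sup>2\<close> all weights
  but the first have exponent at least 2, so AM-GM can act on all of them together.\<close>

lemma box_peak_le_one_large:
  assumes pos: "\<And>w. w \<in> set (w1 # w2 # ws) \<Longrightarrow> 0 < w" and ord: "w2 \<le> w1" "\<And>w. w \<in> set ws \<Longrightarrow> w \<le> w2"
    and sq: "w1\<^sup>2 + w2\<^sup>2 + (\<Sum>w\<leftarrow>ws. w\<^sup>2) = 1"
    and x: "2 / 5 \<le> w1\<^sup>2" "w1\<^sup>2 \<le> 5137 / 10000" and z: "2 * w2\<^sup>2 \<le> 1 - w1\<^sup>2"
  shows "box_peak (w1 # w2 # ws) \<le> sqrt 2 * (74 / 75)"
proof -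
  have w: "0 < w1" "0 < w2" using pos by auto
  define q where "q = 1 - w1\<^sup>2"
  have q: "q = (\<Sum>w\<leftarrow>w2 # ws. w\<^sup>2)" using sq by (simp add: q_def)
  have q0: "4863 / 10000 \<le> q" using x by (simp add: q_def)
  \<comment> \<open>Chosen so that \<open>q * t1\<^sup>2 = 2 * pi\<^sup>2\<close>: each of
    \<open>2 * pi < w1 * t\<close> and \<open>pi < w2 * t\<close>, the two ways to leave the
    negative range, forces \<open>t \<ge> t1\<close>.\<close>
  define t1 where "t1 = pi * sqrt (2 / q)"
  have t1: "0 < t1" "q * t1\<^sup>2 = 2 * pi\<^sup>2" using q0 by (simp_all add: t1_def power_mult_distrib)
  define T where "T t = (\<Sum>w\<leftarrow>w2 # ws. ennreal (w\<^sup>2 / q) * tail_fun w1 (real 1 * q) t1 w t)" for t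
  note TT = csinc_prod_tail[of w1 "w2 # ws" 1 t1 q, folded T_def[abs_def]]
  have small: "2 * v\<^sup>2 \<le> real 1 * q" if "v \<in> set (w2 # ws)" for v
  proof -
    have "v\<^sup>2 \<le> w2\<^sup>2" using that ord pos by (intro power_mono) (auto intro: less_imp_le)
    then show ?thesis using z by (simp add: q_def)
  qed
  define \<tau> where "\<tau> = 1 / w1 * (3 * exp (- (real 1 * q * t1\<^sup>2 / 6)) / (real 1 * q * t1\<^sup>2) + 1 / (4 * pi\<^sup>2))"
  have i: "1 / w1 \<le> 15813 / 10000"
  proof -
    have "(6324 / 10000)\<^sup>2 \<le> w1\<^sup>2" using x by (simp add: power2_eq_square)
    then have "6324 / 10000 \<le> w1" using w by (intro power2_le_imp_le[of "6324 / 10000" w1]) auto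
    then have "1 / w1 \<le> 1 / (6324 / 10000)" using w by (intro divide_left_mono) auto
    then show ?thesis by simp
  qed
  show ?thesis
  \<comment> \<open>The value \<open>s = 4 / 25\<close> is the square of the lower bound
    \<open>2 / 5\<close> for \<open>w1\<^sup>2\<close>.\<close>
  proof (rule box_peak_le_main_tail[OF pos ord sq, where s = "4 / 25" and T = T and \<tau> = \<tau>])
    have "(2 / 5)\<^sup>2 \<le> (w1\<^sup>2)\<^sup>2" using x by (intro power_mono) auto
    moreover have "(w1\<^sup>2)\<^sup>2 = w1 ^ 4" "(2 / 5 :: real)\<^sup>2 = 4 / 25" by (simp_all add: power2_eq_square[of "2 / 5"])
    moreover have "0 \<le> w2 ^ 4" by simp
    ultimately show "4 / 25 \<le> w1 ^ 4 + w2 ^ 4" by linarith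
    show "T \<in> borel_measurable borel"
      unfolding T_def[abs_def] by (rule csinc_prod_tail(2)) (use w pos q small t1 in auto)
    show "(\<integral>\<^sup>+t. T t \<partial>lborel) \<le> ennreal \<tau>"
      unfolding T_def \<tau>_def by (rule csinc_prod_tail(3)) (use w pos q small t1 in auto)
    show "0 \<le> \<tau>" using w q0 t1 by (simp add: \<tau>_def)
    show "ennreal \<bar>csinc_prod (w1 # w2 # ws) t\<bar> \<le> T t"
      if t: "0 < t" "pi < w1 * t" "2 * pi < w1 * t \<or> pi < w2 * t" for t
    proof -
      have "t1\<^sup>2 \<le> t\<^sup>2"
      proof -
        have "2 * pi\<^sup>2 \<le> q * t\<^sup>2" using t(3)
        proof
          assume "2 * pi < w1 * t"
          then have "(2 * pi)\<^sup>2 \<le> (w1 * t)\<^sup>2" by (intro power_mono) auto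
          then have "4 * pi\<^sup>2 \<le> w1\<^sup>2 * t\<^sup>2" by (simp add: power_mult_distrib)
          also have "\<dots> \<le> (2 * q) * t\<^sup>2" using x q0 by (intro mult_right_mono) auto
          finally show ?thesis by simp
        next
          assume "pi < w2 * t"
          then have "pi\<^sup>2 \<le> (w2 * t)\<^sup>2" by (intro power_mono) auto
          then have "2 * pi\<^sup>2 \<le> (2 * w2\<^sup>2) * t\<^sup>2" by (simp add: power_mult_distrib)
          also have "\<dots> \<le> q * t\<^sup>2" using z by (intro mult_right_mono) (auto simp: q_def)
          finally show ?thesis .
        qed
        then have "q * t1\<^sup>2 \<le> q * t\<^sup>2" using t1 by simp
        then show ?thesis using q0 by simp
      qed
      then have "t1 \<le> t" by (rule power2_le_imp_le) (use t(1) in simp)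
      then have "ennreal (\<bar>csinc (w1 * t)\<bar> * \<bar>csinc_prod (w2 # ws) t\<bar> ^ 1) \<le> T t"
        unfolding T_def by (intro csinc_prod_tail(1)) (use w pos q small t1 in auto)
      then show ?thesis by (simp add: abs_mult del: csinc_prod_Cons add: csinc_prod_Cons[of w1])
    qed
    have u: "328 / 100 \<le> 2 * pi\<^sup>2 / 6" using pi_sq_ge by simp
    have "exp (- (2 * pi\<^sup>2 / 6)) \<le> 1 / (1 + (328 / 100) / 2 + ((328 / 100) / 2)\<^sup>2 / 2)\<^sup>2"
      by (rule exp_minus_le_inverse_square[OF _ u]) simp
    also have "\<dots> \<le> 10 / 158" by (simp add: power2_eq_square)
    finally have e: "exp (- (2 * pi\<^sup>2 / 6)) \<le> 10 / 158" .
    have "3 * exp (- (2 * pi\<^sup>2 / 6)) / (2 * pi\<^sup>2) \<le> 3 * (10 / 158) / (2 * (98695 / 10000))"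
      using e pi_sq_ge by (intro frac_le mult_left_mono) auto
    moreover have "1 / (4 * pi\<^sup>2) \<le> 1 / (4 * (98695 / 10000))"
      using pi_sq_ge by (intro frac_le mult_left_mono) auto
    ultimately have "3 * exp (- (2 * pi\<^sup>2 / 6)) / (2 * pi\<^sup>2) + 1 / (4 * pi\<^sup>2) \<le> 35 / 1000" by simp
    then have "\<tau> \<le> 15813 / 10000 * (35 / 1000)" unfolding \<tau>_def using i w
      by (intro mult_mono) (auto simp: t1)
    then show "217085 / 100000 * (1 - 3 / 20 * (4 / 25) + 21 / 160 * (4 / 25)\<^sup>2) + \<tau> \<le> 21917 / 10000"
      by (simp add: power2_eq_square)
  qed simp_all
qed

text \<open>The second weight is too large for exponent 2 relative to \<open>1 - w1\<^sup>2\<close>.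
  Its factor \<open>b\<close> and the product \<open>c\<close> of the remaining ones are separated
  by \<open>b * c \<le> (b\<^sup>2 + c\<^sup>2) / 2\<close>. Squaring doubles the exponents, which
  are now relative to \<open>d\<close> and so at least 2, and \<open>d \<ge> 21 / 100\<close>
  guarantees the Gaussian decay of the squared \<open>c\<close>.\<close>

lemma box_peak_le_two_large:
  assumes pos: "\<And>w. w \<in> set (w1 # w2 # ws) \<Longrightarrow> 0 < w" and ord: "w2 \<le> w1" "\<And>w. w \<in> set ws \<Longrightarrow> w \<le> w2"
    and sq: "w1\<^sup>2 + w2\<^sup>2 + (\<Sum>w\<leftarrow>ws. w\<^sup>2) = 1"
    and x: "2 / 5 \<le> w1\<^sup>2" "w1\<^sup>2 \<le> 5137 / 10000" and z: "1 - w1\<^sup>2 \<le> 2 * w2\<^sup>2"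
    and d21: "21 / 100 \<le> (\<Sum>w\<leftarrow>ws. w\<^sup>2)"
  shows "box_peak (w1 # w2 # ws) \<le> sqrt 2 * (74 / 75)"
proof -
  have w: "0 < w1" "0 < w2" using pos by auto
  have ne: "ws \<noteq> []" using d21 by auto
  define d where "d = (\<Sum>w\<leftarrow>ws. w\<^sup>2)"
  have d: "d = 1 - w1\<^sup>2 - w2\<^sup>2" "21 / 100 \<le> d" using sq d21 by (auto simp: d_def)
  have z39: "w2\<^sup>2 \<le> 39 / 100" using d x by simp
  define t1 where "t1 = pi / w2"
  have t1: "0 < t1" using w by (simp add: t1_def)
  have dt: "real 2 * d * t1\<^sup>2 = 2 * (d / w2\<^sup>2) * pi\<^sup>2" by (simp add: t1_def power_divide)
  define B where "B t = ennreal (1 / w1) * (ennreal w2 * (ennreal ((sin (w2 * t))\<^sup>2 / (w2 * t) ^ 3) * indicator {pi..} (w2 * t)))" for t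
  define T' where "T' t = (\<Sum>w\<leftarrow>ws. ennreal (w\<^sup>2 / d) * tail_fun w1 (real 2 * d) t1 w t)" for t
  define T where "T t = ennreal (1 / 2) * B t + ennreal (1 / 2) * T' t" for t
  have small: "2 * v\<^sup>2 \<le> real 2 * d" if "v \<in> set ws" for v
  proof -
    have "v\<^sup>2 \<le> d" unfolding d_def by (rule member_le_sum_list) (use that in auto)
    then show ?thesis by simp
  qed
  have [measurable]: "B \<in> borel_measurable borel" unfolding B_def by measurable
  have [measurable]: "T' \<in> borel_measurable borel"
    unfolding T'_def[abs_def] by (rule csinc_prod_tail(2)) (use w pos ne d_def small t1 in auto)
  define \<tau>' where "\<tau>' = 1 / w1 * (3 * exp (- (real 2 * d * t1\<^sup>2 / 6)) / (real 2 * d * t1\<^sup>2) + 1 / (4 * pi\<^sup>2))"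
  define \<tau> where "\<tau> = 1 / 2 * (1 / w1 * (1 / (4 * pi\<^sup>2))) + 1 / 2 * \<tau>'"
  have \<tau>': "0 \<le> \<tau>'" using w d by (simp add: \<tau>'_def)
  have i: "1 / w1 \<le> 15813 / 10000"
  proof -
    have "(6324 / 10000)\<^sup>2 \<le> w1\<^sup>2" using x by (simp add: power2_eq_square)
    then have "6324 / 10000 \<le> w1" using w by (intro power2_le_imp_le[of "6324 / 10000" w1]) auto
    then have "1 / w1 \<le> 1 / (6324 / 10000)" using w by (intro divide_left_mono) auto
    then show ?thesis by simp
  qed
  show ?thesis
  \<comment> \<open>With \<open>x = w1\<^sup>2\<close>, \<open>x\<^sup>2 + ((1 - x) / 2)\<^sup>2 - 1
    / 4 = x * (5 * x - 2) / 4\<close>, which is nonnegative from \<open>x = 2 / 5\<close> on; hence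
    \<open>s = 1 / 4\<close>.\<close>
  proof (rule box_peak_le_main_tail[OF pos ord sq, where s = "1 / 4" and T = T and \<tau> = \<tau>])
    have "0 \<le> w1\<^sup>2 * (5 * w1\<^sup>2 - 2) / 4" using x by simp
    moreover have "((1 - w1\<^sup>2) / 2)\<^sup>2 \<le> (w2\<^sup>2)\<^sup>2" using z x by (intro power_mono) auto
    ultimately show "1 / 4 \<le> w1 ^ 4 + w2 ^ 4" by (simp add: power2_eq_square power4_eq_xxxx field_simps)
    show "T \<in> borel_measurable borel" unfolding T_def by measurable
    have "(\<integral>\<^sup>+t. T t \<partial>lborel) = ennreal (1 / 2) * (\<integral>\<^sup>+t. B t \<partial>lborel) + ennreal (1 / 2) * (\<integral>\<^sup>+t. T' t \<partial>lborel)"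
      unfolding T_def by (simp add: nn_integral_add nn_integral_cmult)
    also have "\<dots> \<le> ennreal (1 / 2) * ennreal (1 / w1 * (1 / (4 * pi\<^sup>2))) + ennreal (1 / 2) * ennreal \<tau>'"
    proof (intro add_mono mult_left_mono)
      define S where "S t = ennreal w2 * (ennreal ((sin (w2 * t))\<^sup>2 / (w2 * t) ^ 3) * indicator {pi..} (w2 * t))" for t
      have [measurable]: "S \<in> borel_measurable borel" unfolding S_def by measurable
      have "(\<integral>\<^sup>+t. B t \<partial>lborel) = ennreal (1 / w1) * (\<integral>\<^sup>+t. S t \<partial>lborel)"
        unfolding B_def S_def[symmetric] by (rule nn_integral_cmult) measurable
      also have "\<dots> \<le> ennreal (1 / w1) * ennreal (1 / (4 * pi\<^sup>2))"
        unfolding S_def by (intro mult_left_mono nn_integral_sin_sq_over_cube_scaled w) simp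
      finally show "(\<integral>\<^sup>+t. B t \<partial>lborel) \<le> ennreal (1 / w1 * (1 / (4 * pi\<^sup>2)))"
        using w by (simp add: ennreal_mult[symmetric])
      show "(\<integral>\<^sup>+t. T' t \<partial>lborel) \<le> ennreal \<tau>'"
        unfolding T'_def \<tau>'_def by (rule csinc_prod_tail(3)) (use w pos ne d_def small t1 in auto)
    qed simp_all
    also have "\<dots> = ennreal \<tau>" 
    proof -
      have "ennreal (1 * (1 / 2 * (1 / w1 * (1 / (4 * pi\<^sup>2))) + 1 / 2 * \<tau>'))
         = ennreal 1 * (ennreal (1 / 2) * ennreal (1 / w1 * (1 / (4 * pi\<^sup>2))) + ennreal (1 / 2) * ennreal \<tau>')"
        by (rule ennreal_lincomb) (use w \<tau>' in auto)
      then show ?thesis by (simp only: mult_1_left ennreal_1 \<tau>_def)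
    qed
    finally show "(\<integral>\<^sup>+t. T t \<partial>lborel) \<le> ennreal \<tau>" .
    show "0 \<le> \<tau>" using w \<tau>' by (simp add: \<tau>_def)
    show "ennreal \<bar>csinc_prod (w1 # w2 # ws) t\<bar> \<le> T t"
      if t: "0 < t" "pi < w1 * t" "2 * pi < w1 * t \<or> pi < w2 * t" for t
    proof -
      \<comment> \<open>As \<open>w1 \<le> 2 * w2\<close>, the alternative
        \<open>2 * pi < w1 * t\<close> implies the other one, and \<open>t \<ge> t1\<close> follows
        in both cases.\<close>
      have "w1\<^sup>2 \<le> (2 * w2)\<^sup>2" using z x by (simp add: power_mult_distrib)
      then have "w1 \<le> 2 * w2" by (rule power2_le_imp_le) (use w in auto)
      then have "w1 * t \<le> 2 * w2 * t" using t by (intro mult_right_mono) auto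
      then have y: "pi < w2 * t" using t(3) by auto
      then have t1t: "t1 \<le> t" using w by (simp add: t1_def field_simps)
      define a b c where "a = \<bar>csinc (w1 * t)\<bar>" and "b = \<bar>csinc (w2 * t)\<bar>" and "c = \<bar>csinc_prod ws t\<bar>"
      have abc: "0 \<le> a" "0 \<le> b" "0 \<le> c" by (simp_all add: a_def b_def c_def)
      have "0 \<le> a * (b - c)\<^sup>2" using abc by simp
      then have "a * b * c \<le> 1 / 2 * (a * b\<^sup>2) + 1 / 2 * (a * c\<^sup>2)" by (simp add: power2_eq_square algebra_simps)
      then have "\<bar>csinc_prod (w1 # w2 # ws) t\<bar> \<le> 1 / 2 * (a * b\<^sup>2) + 1 / 2 * (a * c\<^sup>2)"
        by (simp add: a_def b_def c_def abs_mult)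
      then have "ennreal \<bar>csinc_prod (w1 # w2 # ws) t\<bar> \<le> ennreal (1 / 2 * (a * b\<^sup>2) + 1 / 2 * (a * c\<^sup>2))"
        by (rule ennreal_leI)
      also have "\<dots> = ennreal (1 / 2) * ennreal (a * b\<^sup>2) + ennreal (1 / 2) * ennreal (a * c\<^sup>2)"
      proof -
        have "ennreal (1 * (1 / 2 * (a * b\<^sup>2) + 1 / 2 * (a * c\<^sup>2)))
           = ennreal 1 * (ennreal (1 / 2) * ennreal (a * b\<^sup>2) + ennreal (1 / 2) * ennreal (a * c\<^sup>2))"
          by (rule ennreal_lincomb) (use abc in auto)
        then show ?thesis by (simp only: mult_1_left ennreal_1)
      qed
      also have "\<dots> \<le> T t" unfolding T_def
      proof (intro add_mono mult_left_mono)
        show "ennreal (a * c\<^sup>2) \<le> T' t" unfolding T'_def a_def c_def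
          by (rule csinc_prod_tail(1)[OF _ _ _ _ _ _ _ t1t]) (use w pos ne d_def small t1 in auto)
        have "a * b\<^sup>2 \<le> (1 / w1 * (1 / t)) * ((sin (w2 * t))\<^sup>2 / (w2 * t)\<^sup>2)"
        proof (rule mult_mono)
          show "a \<le> 1 / w1 * (1 / t)" using csinc_abs_le[of "w1 * t"] w t by (simp add: a_def)
          show "b\<^sup>2 \<le> (sin (w2 * t))\<^sup>2 / (w2 * t)\<^sup>2" using w t by (simp add: b_def csinc_def power_divide)
        qed (use w t in auto)
        also have "\<dots> = 1 / w1 * (w2 * ((sin (w2 * t))\<^sup>2 / (w2 * t) ^ 3))"
          using w t by (simp add: power2_eq_square power3_eq_cube)
        finally have "ennreal (a * b\<^sup>2) \<le> ennreal (1 / w1 * (w2 * ((sin (w2 * t))\<^sup>2 / (w2 * t) ^ 3)))"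
          by (rule ennreal_leI)
        also have "\<dots> = B t" using w y t unfolding B_def by (simp add: ennreal_mult[symmetric])
        finally show "ennreal (a * b\<^sup>2) \<le> B t" .
      qed simp_all
      finally show ?thesis .
    qed
    \<comment> \<open>The ratio \<open>7 / 13\<close> is \<open>21 / 39\<close>, from
      \<open>d \<ge> 21 / 100\<close> and \<open>w2\<^sup>2 \<le> 39 / 100\<close>. It fixes the
      Gaussian exponent at the point \<open>t1\<close>.\<close>
    have rho: "7 / 13 \<le> d / w2\<^sup>2"
    proof -
      have "7 / 13 * w2\<^sup>2 \<le> d" using z39 d by simp
      then show ?thesis using w by (simp add: field_simps)
    qed
    define Y where "Y = (d / w2\<^sup>2) * pi\<^sup>2"
    have "(7 / 13) * (98695 / 10000) \<le> Y" unfolding Y_def using rho pi_sq_ge d by (intro mult_mono) auto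
    then have "177 / 100 \<le> Y / 3" by simp
    moreover have "real 2 * d * t1\<^sup>2 / 6 = Y / 3" unfolding dt Y_def by simp
    ultimately have u: "177 / 100 \<le> real 2 * d * t1\<^sup>2 / 6" by simp
    have "exp (- (real 2 * d * t1\<^sup>2 / 6)) \<le> 1 / (1 + (177 / 100) / 2 + ((177 / 100) / 2)\<^sup>2 / 2)\<^sup>2"
      by (rule exp_minus_le_inverse_square[OF _ u]) simp
    also have "\<dots> \<le> 100 / 518" by (simp add: power2_eq_square)
    finally have e: "exp (- (real 2 * d * t1\<^sup>2 / 6)) \<le> 100 / 518" .
    have "3 * exp (- (real 2 * d * t1\<^sup>2 / 6)) / (real 2 * d * t1\<^sup>2) \<le> 3 * (100 / 518) / (6 * (177 / 100))"
      using e u by (intro frac_le mult_left_mono) auto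
    moreover have 4: "1 / (4 * pi\<^sup>2) \<le> 1 / (4 * (98695 / 10000))"
      using pi_sq_ge by (intro frac_le mult_left_mono) auto
    ultimately have "3 * exp (- (real 2 * d * t1\<^sup>2 / 6)) / (real 2 * d * t1\<^sup>2) + 1 / (4 * pi\<^sup>2)
        \<le> 3 * (100 / 518) / (6 * (177 / 100)) + 1 / (4 * (98695 / 10000))"
      by (rule add_mono)
    also have "\<dots> \<le> (7990 / 100000 :: real)" by simp
    finally have "3 * exp (- (real 2 * d * t1\<^sup>2 / 6)) / (real 2 * d * t1\<^sup>2) + 1 / (4 * pi\<^sup>2) \<le> 7990 / 100000" .
    then have "\<tau>' \<le> 15813 / 10000 * (7990 / 100000)" unfolding \<tau>'_def using i w d
      by (intro mult_mono) auto
    moreover have "1 / w1 * (1 / (4 * pi\<^sup>2)) \<le> 15813 / 10000 * (1 / (4 * (98695 / 10000)))"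
      using i 4 by (intro mult_mono) auto
    ultimately have "\<tau> \<le> 8321 / 100000" unfolding \<tau>_def by simp
    then show "217085 / 100000 * (1 - 3 / 20 * (1 / 4) + 21 / 160 * (1 / 4)\<^sup>2) + \<tau> \<le> 21917 / 10000"
      by (simp add: power2_eq_square)
  qed simp_all
qed


section \<open>Real-side bounds when two weights dominate\<close>

lemma box_peak_le_inverse_hd:
  assumes "\<And>w. w \<in> set (w1 # ws) \<Longrightarrow> 0 < w"
  shows "box_peak (w1 # ws) \<le> 1 / w1"
proof (cases ws)
  case (Cons w ws')
  have "box_conc (w # ws') w1 \<le> 1"
    using odd_concave_box_conc[of "w # ws'"] assms Cons by (auto simp: odd_concave_def)
  moreover have "0 < w1" using assms by simp
  ultimately show ?thesis using divide_right_mono[of "box_conc (w # ws') w1" 1 w1] Cons by simp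
qed simp

text \<open>The two largest boxes convolve to a trapezoid; the remaining ones enter only through a
  linear bound on their concentration function, as if they were a single box.\<close>

lemma box_peak_le_trapezoid:
  assumes pos: "\<And>w. w \<in> set (w1 # w2 # ws) \<Longrightarrow> 0 < w" and ne: "ws \<noteq> []" and ord: "w2 \<le> w1"
    and k: "0 < k" "\<And>r. 0 \<le> r \<Longrightarrow> box_conc ws r \<le> k * r"
    and m: "k * (w1 - w2) \<le> 1" "1 \<le> k * (w1 + w2)"
  shows "box_peak (w1 # w2 # ws) \<le> 1 / w1 * (1 - (1 - k * (w1 - w2))\<^sup>2 / (4 * k * w2))"
proof -
  have w: "0 < w1" "0 < w2" using pos by auto
  obtain v vs where v: "ws = v # vs" using ne by (cases ws) auto
  have oc: "odd_concave (box_conc ws)" using odd_concave_box_conc[OF ne] pos by auto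
  then have le1: "box_conc ws r \<le> 1" for r by (simp add: odd_concave_def)
  have i: "box_conc ws integrable_on {a..b}" for a b
    using oc by (intro integrable_continuous_real) (auto simp: odd_concave_def intro: continuous_on_subset)
  have 1: "((\<lambda>r. k * r) has_integral (k * (1 / k)\<^sup>2 / 2 - k * (w1 - w2)\<^sup>2 / 2)) {w1 - w2..1 / k}"
  proof (rule fundamental_theorem_of_calculus)
    show "w1 - w2 \<le> 1 / k" using m k by (simp add: field_simps)
    show "((\<lambda>r. k * r\<^sup>2 / 2) has_vector_derivative k * r) (at r within {w1 - w2..1 / k})" for r
      unfolding has_real_derivative_iff_has_vector_derivative[symmetric]
      by (auto intro!: derivative_eq_intros)
  qed
  \<comment> \<open>The split is at \<open>1 / k\<close>, where the linear bound
    \<open>k * r\<close> overtakes the trivial bound 1; the hypotheses \<open>m\<close> place this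
    point inside the window.\<close>
  have "integral {w1 - w2..w1 + w2} (box_conc ws)
     = integral {w1 - w2..1 / k} (box_conc ws) + integral {1 / k..w1 + w2} (box_conc ws)"
    by (rule Henstock_Kurzweil_Integration.integral_combine[symmetric]) (use m k i in \<open>auto simp: field_simps\<close>)
  also have "\<dots> \<le> integral {w1 - w2..1 / k} (\<lambda>r. k * r) + integral {1 / k..w1 + w2} (\<lambda>r. 1)"
    using i 1 k(2) le1 ord by (intro add_mono integral_le) (auto intro: has_integral_integrable)
  also have "\<dots> = (k * (1 / k)\<^sup>2 / 2 - k * (w1 - w2)\<^sup>2 / 2) + (w1 + w2 - 1 / k)"
    using integral_unique[OF 1] m k by (simp add: field_simps)
  also have "\<dots> = 2 * w2 - (1 - k * (w1 - w2))\<^sup>2 / (2 * k)"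
    using k by (simp add: field_simps power2_eq_square)
  finally have *: "integral {w1 - w2..w1 + w2} (box_conc ws) \<le> 2 * w2 - (1 - k * (w1 - w2))\<^sup>2 / (2 * k)" .
  have "box_peak (w1 # w2 # ws) = integral {w1 - w2..w1 + w2} (box_conc ws) / (2 * w2) / w1"
    by (simp add: v window_avg_def)
  also have "\<dots> \<le> (2 * w2 - (1 - k * (w1 - w2))\<^sup>2 / (2 * k)) / (2 * w2) / w1"
    using * w by (intro divide_right_mono) auto
  also have "\<dots> = 1 / w1 * (1 - (1 - k * (w1 - w2))\<^sup>2 / (4 * k * w2))"
    using w k by (simp add: field_simps)
  finally show ?thesis .
qed

text \<open>Here \<open>\<alpha> = sqrt 2 * w1\<close>, \<open>\<beta> = sqrt 2 * w2\<close> and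
  \<open>g = sqrt d\<close>. After multiplication by \<beta> the half-sum \<open>c\<close> is
  eliminated by bounding its square root expression linearly. What remains is
  \<open>g\<^sup>2 * (1 / 2 + 1 / 27) \<le> g / 4\<close> and
  \<open>3 / 8 \<le> 1 / (4 * g)\<close>; the first ties the constant 27 to the bound
  \<open>46 / 100\<close> on \<open>g\<close>.\<close>

lemma trapezoid_numeric:
  fixes \<alpha> \<beta> g :: real
  assumes sq: "\<alpha>\<^sup>2 + \<beta>\<^sup>2 = 2 - 2 * g\<^sup>2" and g: "0 < g" "g\<^sup>2 \<le> 21 / 100" and pos: "0 < \<beta>" "\<beta> \<le> \<alpha>" and m: "\<alpha> - \<beta> \<le> g"
  shows "1 - (g - (\<alpha> - \<beta>))\<^sup>2 / (4 * g * \<beta>) \<le> \<alpha> * (1 - g\<^sup>2 / 27)"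
proof -
  define c m where "c = (\<alpha> + \<beta>) / 2" and "m = \<alpha> - \<beta>"
  have g46: "g \<le> 46 / 100"
    using g by (intro power2_le_imp_le[of g "46 / 100"]) (auto simp: power2_eq_square)
  have \<alpha>: "\<alpha> = c + m / 2" and \<beta>: "\<beta> = c - m / 2" by (simp_all add: c_def m_def field_simps)
  have c2: "c\<^sup>2 = 1 - g\<^sup>2 - m\<^sup>2 / 4" using sq unfolding \<alpha> \<beta> by (simp add: power2_eq_square algebra_simps)
  have c0: "0 \<le> c" using pos by (simp add: c_def)
  have m0: "0 \<le> m" "m \<le> g" using pos assms(6) by (simp_all add: m_def)
  have "c \<le> 1 - g\<^sup>2 / 2 - m\<^sup>2 / 8"
  proof (rule power2_le_imp_le)
    have "0 \<le> (g\<^sup>2 / 2 + m\<^sup>2 / 8)\<^sup>2" by simp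
    then show "c\<^sup>2 \<le> (1 - g\<^sup>2 / 2 - m\<^sup>2 / 8)\<^sup>2" unfolding c2 by (simp add: power2_eq_square algebra_simps)
    have "m\<^sup>2 \<le> g\<^sup>2" using m0 by (intro power_mono) auto
    then show "0 \<le> 1 - g\<^sup>2 / 2 - m\<^sup>2 / 8" using g by linarith
  qed
  moreover have ab: "\<alpha> * \<beta> = 1 - g\<^sup>2 - m\<^sup>2 / 2"
    using c2 unfolding \<alpha> \<beta> by (simp add: power2_eq_square algebra_simps)
  moreover have "\<beta> * (1 - \<alpha> * (1 - g\<^sup>2 / 27)) = \<beta> - \<alpha> * \<beta> + \<alpha> * \<beta> * g\<^sup>2 / 27" by (simp add: algebra_simps)
  moreover have "\<alpha> * \<beta> * g\<^sup>2 / 27 \<le> g\<^sup>2 / 27"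
  proof -
    have "\<alpha> * \<beta> \<le> 1" unfolding ab using zero_le_power2[of g] zero_le_power2[of m] by linarith
    then show ?thesis using mult_right_mono[of "\<alpha> * \<beta>" 1 "g\<^sup>2"] by simp
  qed
  ultimately have 1: "\<beta> * (1 - \<alpha> * (1 - g\<^sup>2 / 27)) \<le> g\<^sup>2 / 2 + 3 / 8 * m\<^sup>2 - m / 2 + g\<^sup>2 / 27"
    unfolding \<beta> by linarith
  have "g\<^sup>2 * (1 / 2 + 1 / 27) \<le> g / 4"
    using mult_left_mono[OF g46, of g] g by (simp add: power2_eq_square)
  moreover have "3 / 8 * m\<^sup>2 \<le> m\<^sup>2 / (4 * g)"
  proof -
    have "3 / 8 \<le> 1 / (4 * g)" using g g46 by (simp add: field_simps)
    from mult_right_mono[OF this, of "m\<^sup>2"] show ?thesis by simp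
  qed
  moreover have "(g - m)\<^sup>2 / (4 * g) = g / 4 - m / 2 + m\<^sup>2 / (4 * g)"
    using g by (simp add: field_simps power2_eq_square)
  ultimately have "\<beta> * (1 - \<alpha> * (1 - g\<^sup>2 / 27)) \<le> (g - m)\<^sup>2 / (4 * g)" using 1 by (simp add: algebra_simps)
  then have "(1 - \<alpha> * (1 - g\<^sup>2 / 27)) * \<beta> \<le> (g - m)\<^sup>2 / (4 * g)"
    by (simp only: mult.commute[of _ \<beta>])
  then have "(1 - \<alpha> * (1 - g\<^sup>2 / 27)) \<le> (g - m)\<^sup>2 / (4 * g) / \<beta>"
    by (simp only: pos_le_divide_eq[OF pos(1)])
  then show ?thesis by (simp add: m_def mult.assoc)
qed

text \<open>With the square sum fixed, a gap larger than \<open>g\<close> pushes \<alpha> above 1 by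
  at least \<open>15 / 100 * g\<close>. This outweighs the deficit, which is of order
  \<open>g\<^sup>2\<close>, so the trivial bound \<open>1 / w1\<close> is enough.\<close>

lemma gap_numeric:
  fixes \<alpha> \<beta> g :: real
  assumes sq: "\<alpha>\<^sup>2 + \<beta>\<^sup>2 = 2 - 2 * g\<^sup>2" and g: "0 < g" "g\<^sup>2 \<le> 21 / 100" and pos: "0 < \<beta>" and m: "g < \<alpha> - \<beta>"
    and \<alpha>: "\<alpha>\<^sup>2 \<le> 10274 / 10000"
  shows "1 \<le> \<alpha> * (1 - g\<^sup>2 / 27)"
proof -
  define e where "e = \<alpha> - 1"
  have g46: "g \<le> 46 / 100"
    using g by (intro power2_le_imp_le[of g "46 / 100"]) (auto simp: power2_eq_square)
  have "\<alpha> \<le> 102 / 100"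
    using \<alpha> by (intro power2_le_imp_le[of \<alpha> "102 / 100"]) (auto simp: power2_eq_square)
  then have e: "e \<le> 2 / 100" by (simp add: e_def)
  have \<alpha>0: "0 < \<alpha>" using pos g m by linarith
  have "\<beta>\<^sup>2 \<le> (\<alpha> - g)\<^sup>2" using pos m by (intro power_mono) auto
  then have "2 - 2 * g\<^sup>2 \<le> \<alpha>\<^sup>2 + (\<alpha> - g)\<^sup>2" using sq by linarith
  then have 1: "2 * g - 3 * g\<^sup>2 \<le> e * (4 + 2 * e - 2 * g)"
    by (simp add: e_def power2_eq_square algebra_simps)
  have "g\<^sup>2 \<le> 46 / 100 * g" using g g46 by (simp add: power2_eq_square)
  then have 2: "62 / 100 * g \<le> e * (4 + 2 * e - 2 * g)" using 1 by linarith
  have "0 < 4 + 2 * e - 2 * g" using \<alpha>0 g46 by (simp add: e_def)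
  moreover have "0 < e * (4 + 2 * e - 2 * g)" using 2 g by linarith
  ultimately have e0: "0 < e" by (rule zero_less_mult_pos2[rotated])
  have "e * (4 + 2 * e - 2 * g) \<le> e * (404 / 100)" using e e0 g by (intro mult_left_mono) auto
  then have "15 / 100 * g \<le> e" using 2 g by linarith
  then have e3: "15 / 46 * g\<^sup>2 \<le> e" using \<open>g\<^sup>2 \<le> 46 / 100 * g\<close> by linarith
  have "\<alpha> * (1 - g\<^sup>2 / 27) = 1 + e - \<alpha> * g\<^sup>2 / 27" by (simp add: e_def algebra_simps)
  moreover have "\<alpha> * g\<^sup>2 \<le> 102 / 100 * g\<^sup>2" using \<open>\<alpha> \<le> 102 / 100\<close> by (intro mult_right_mono) auto
  ultimately show ?thesis using e3 zero_le_power2[of g] by linarith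
qed

text \<open>The assumption \<open>rest\<close> is Ball's inequality for the remaining weights. It is
  left as an assumption because it is supplied by the induction hypothesis in
  \<open>ball_box_peak\<close> and by that theorem itself later on.\<close>

lemma box_peak_dichotomy:
  assumes pos: "\<And>w. w \<in> set (w1 # w2 # ws) \<Longrightarrow> 0 < w" and ord: "w2 \<le> w1" "\<And>w. w \<in> set ws \<Longrightarrow> w \<le> w2"
    and sq: "w1\<^sup>2 + w2\<^sup>2 + (\<Sum>w\<leftarrow>ws. w\<^sup>2) = 1" and x: "w1\<^sup>2 \<le> 5137 / 10000"
    and rest: "ws \<noteq> [] \<Longrightarrow> box_peak ws * sqrt (\<Sum>w\<leftarrow>ws. w\<^sup>2) \<le> sqrt 2"
  defines "d \<equiv> \<Sum>w\<leftarrow>ws. w\<^sup>2"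
  shows "box_peak (w1 # w2 # ws) \<le> sqrt 2 * (74 / 75) \<or> (d \<le> 21 / 100 \<and> box_peak (w1 # w2 # ws) \<le> sqrt 2 * (1 - d / 27))"
proof -
  have w: "0 < w1" "0 < w2" using pos by auto
  have d0: "0 \<le> d" unfolding d_def by (rule sum_list_nonneg) auto
  consider "w1\<^sup>2 \<le> 2 / 5" | "2 / 5 \<le> w1\<^sup>2" "21 / 100 \<le> d" | "d \<le> 21 / 100" "ws = []"
    | "d \<le> 21 / 100" "ws \<noteq> []" by linarith
  then show ?thesis
  proof cases
    case 1
    have "w\<^sup>2 \<le> 2 / 5" if "w \<in> set (w1 # w2 # ws)" for w
    proof -
      have "w \<le> w1" "0 \<le> w" using that ord pos by (auto intro: order_trans less_imp_le)
      then have "w\<^sup>2 \<le> w1\<^sup>2" by (intro power_mono) auto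
      then show ?thesis using 1 by simp
    qed
    then show ?thesis using box_peak_le_small[of w1 w2 ws] pos sq by simp
  next
    case 2
    then show ?thesis
      using box_peak_le_one_large[OF pos ord sq _ x] box_peak_le_two_large[OF pos ord sq _ x]
      by (cases "2 * w2\<^sup>2 \<le> 1 - w1\<^sup>2") (auto simp: d_def)
  next
    case 3
    have "w2\<^sup>2 \<le> w1\<^sup>2" using ord w by (intro power_mono) auto
    then have "1 / 2 \<le> w1\<^sup>2" using sq 3 by simp
    then have "(1 / sqrt 2)\<^sup>2 \<le> w1\<^sup>2" by (simp add: power_divide)
    then have "1 / sqrt 2 \<le> w1" by (rule power2_le_imp_le) (use w in simp)
    then have "1 / w1 \<le> sqrt 2" using w by (simp add: field_simps)
    with box_peak_le_inverse_hd[OF pos] have "box_peak (w1 # w2 # ws) \<le> sqrt 2" by (rule order_trans)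
    then show ?thesis using 3 by (simp add: d_def del: box_peak.simps)
  next
    case 4
    obtain v where v: "v \<in> set ws" using 4 by (cases ws) auto
    have "v\<^sup>2 \<le> d" unfolding d_def by (rule member_le_sum_list) (use v in auto)
    moreover have "0 < v" using v pos by auto
    then have "0 < v\<^sup>2" by simp
    ultimately have d1: "0 < d" by linarith
    define g where "g = sqrt d"
    have g: "0 < g" "g\<^sup>2 = d" using d1 by (simp_all add: g_def)
    define \<alpha> \<beta> where "\<alpha> = sqrt 2 * w1" and "\<beta> = sqrt 2 * w2"
    have s2: "sqrt 2 * sqrt 2 = (2::real)" by simp
    have sqab: "\<alpha>\<^sup>2 + \<beta>\<^sup>2 = 2 - 2 * g\<^sup>2" using sq g by (simp add: \<alpha>_def \<beta>_def power_mult_distrib d_def)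
    have ab: "0 < \<beta>" "\<beta> \<le> \<alpha>" using w ord by (simp_all add: \<alpha>_def \<beta>_def)
    have inv: "1 / w1 = sqrt 2 / \<alpha>" using w by (simp add: \<alpha>_def)
    have "box_peak (w1 # w2 # ws) \<le> sqrt 2 * (1 - d / 27)"
    \<comment> \<open>Ball's inequality bounds the slope of the remaining concentration function by
      \<open>k = sqrt 2 / g\<close>, and the condition says \<open>k * (w1 - w2) \<le> 1\<close>:
      the linear bound is below 1 at the start of the window, so the trapezoid estimate can gain.
      Otherwise the two weights are unequal enough for \<open>1 / w1\<close>.\<close>
    proof (cases "\<alpha> - \<beta> \<le> g")
      case True
      define k where "k = sqrt 2 / g"
      have k: "0 < k" using g by (simp add: k_def)
      have kb: "box_conc ws r \<le> k * r" if "0 \<le> r" for r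
      proof -
        have "box_conc ws r \<le> r * box_peak ws" by (rule box_conc_le_peak) (use 4 pos that in auto)
        also have "box_peak ws \<le> k" using rest 4 g by (simp add: k_def g_def d_def field_simps)
        then have "r * box_peak ws \<le> r * k" using that by (rule mult_left_mono)
        finally show ?thesis by (simp add: mult.commute)
      qed
      have km: "k * (w1 - w2) = (\<alpha> - \<beta>) / g" by (simp add: k_def \<alpha>_def \<beta>_def algebra_simps diff_divide_distrib)
      have kp: "k * (w1 + w2) = (\<alpha> + \<beta>) / g" by (simp add: k_def \<alpha>_def \<beta>_def algebra_simps add_divide_distrib)
      have "g\<^sup>2 \<le> (\<alpha> + \<beta>)\<^sup>2"
      proof -
        have "g\<^sup>2 \<le> \<alpha>\<^sup>2 + \<beta>\<^sup>2" using sqab 4(1) g by simp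
        also have "\<dots> \<le> (\<alpha> + \<beta>)\<^sup>2" using ab by (simp add: power2_sum)
        finally show ?thesis .
      qed
      then have gab: "g \<le> \<alpha> + \<beta>" by (rule power2_le_imp_le) (use ab in auto)
      have "box_peak (w1 # w2 # ws) \<le> 1 / w1 * (1 - (1 - k * (w1 - w2))\<^sup>2 / (4 * k * w2))"
        by (rule box_peak_le_trapezoid[OF pos 4(2) ord(1) k kb])
          (use True gab g in \<open>auto simp: km kp\<close>)
      also have "(1 - k * (w1 - w2))\<^sup>2 / (4 * k * w2) = (g - (\<alpha> - \<beta>))\<^sup>2 / (4 * g * \<beta>)"
      proof -
        have "1 - k * (w1 - w2) = (g - (\<alpha> - \<beta>)) / g" unfolding km using g by (simp add: field_simps)
        moreover have "4 * k * w2 = 4 * \<beta> / g" by (simp add: k_def \<beta>_def)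
        ultimately show ?thesis using g(1) by (simp add: power2_eq_square)
      qed
      also have "1 / w1 * (1 - (g - (\<alpha> - \<beta>))\<^sup>2 / (4 * g * \<beta>)) \<le> 1 / w1 * (\<alpha> * (1 - g\<^sup>2 / 27))"
        by (intro mult_left_mono trapezoid_numeric[OF sqab g(1) _ ab True]) (use w 4 g in auto)
      also have "\<dots> = sqrt 2 * (1 - d / 27)" using w g by (simp add: \<alpha>_def)
      finally show ?thesis .
    next
      case False
      have "\<alpha>\<^sup>2 \<le> 10274 / 10000" using x by (simp add: \<alpha>_def power_mult_distrib)
      then have *: "1 \<le> \<alpha> * (1 - g\<^sup>2 / 27)"
        by (intro gap_numeric[OF sqab g(1) _ ab(1)]) (use False 4 g in auto)
      have "box_peak (w1 # w2 # ws) \<le> 1 / w1" by (rule box_peak_le_inverse_hd[OF pos])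
      also have "\<dots> \<le> 1 / w1 * (\<alpha> * (1 - g\<^sup>2 / 27))" using mult_left_mono[OF *, of "1 / w1"] w by simp
      also have "\<dots> = sqrt 2 * (1 - d / 27)" using w g by (simp add: \<alpha>_def)
      finally show ?thesis .
    qed
    then show ?thesis using 4 by simp
  qed
qed

text \<open>Induction on the length, with two weights removed at a time. If the normalised largest
  weight has square at least \<open>1 / 2\<close>, the trivial bound \<open>1 / w1\<close> suffices;
  if not, both alternatives of the dichotomy are at most \<open>sqrt 2\<close>.\<close>

theorem ball_box_peak:
  assumes "ws \<noteq> []" "sorted_wrt (\<ge>) ws" "\<And>w. w \<in> set ws \<Longrightarrow> 0 < w"
  shows "box_peak ws * sqrt (\<Sum>w\<leftarrow>ws. w\<^sup>2) \<le> sqrt 2"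
  using assms
proof (induction "length ws" arbitrary: ws rule: less_induct)
  case less
  define r where "r = sqrt (\<Sum>w\<leftarrow>ws. w\<^sup>2)"
  obtain v vs where v: "ws = v # vs" using less.prems by (cases ws) auto
  have "0 \<le> (\<Sum>w\<leftarrow>vs. w\<^sup>2)" by (rule sum_list_nonneg) auto
  moreover have "0 < v" using less.prems v by simp
  then have "0 < v\<^sup>2" by simp
  ultimately have r: "0 < r" "r\<^sup>2 = (\<Sum>w\<leftarrow>ws. w\<^sup>2)" by (auto simp: r_def v add_pos_nonneg intro: add_nonneg_nonneg)
  define us where "us = map ((*) (1 / r)) ws"
  have peak: "box_peak us = box_peak ws * r"
    unfolding us_def using box_peak_scale[of "1 / r" ws] r less.prems by simp
  have pos: "\<And>w. w \<in> set us \<Longrightarrow> 0 < w" using less.prems r by (auto simp: us_def)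
  have sorted: "sorted_wrt (\<ge>) us" unfolding us_def sorted_wrt_map
    using less.prems(2) r by (auto elim!: sorted_wrt_mono_rel[rotated] intro!: divide_right_mono)
  have one: "(\<Sum>w\<leftarrow>us. w\<^sup>2) = 1"
  proof -
    have "(\<Sum>w\<leftarrow>us. w\<^sup>2) = (\<Sum>w\<leftarrow>ws. (1 / r\<^sup>2) * w\<^sup>2)"
      unfolding us_def by (simp add: o_def power_divide)
    also have "\<dots> = 1 / r\<^sup>2 * (\<Sum>w\<leftarrow>ws. w\<^sup>2)" by (rule sum_list_const_mult)
    also have "\<dots> = 1" unfolding r(2)[symmetric] using r(1) by simp
    finally show ?thesis .
  qed
  have len: "length us = length ws" by (simp add: us_def)
  have "box_peak us \<le> sqrt 2"
  proof (cases us rule: box_peak.cases)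
    case (2 w)
    then have "w = 1" using one pos[of w] by (auto simp: power2_eq_1_iff)
    then show ?thesis using 2 by simp
  next
    case (3 w1 w2 ws')
    have w: "0 < w1" using pos 3 by simp
    show ?thesis
    proof (cases "1 / 2 \<le> w1\<^sup>2")
      case True
      then have "(1 / sqrt 2)\<^sup>2 \<le> w1\<^sup>2" by (simp add: power_divide)
    then have "1 / sqrt 2 \<le> w1" by (rule power2_le_imp_le) (use w in simp)
      then have "1 / w1 \<le> sqrt 2" using w by (simp add: field_simps)
      then show ?thesis using box_peak_le_inverse_hd[of w1 "w2 # ws'"] pos 3 by simp
    next
      case False
      have IH: "box_peak ws' * sqrt (\<Sum>w\<leftarrow>ws'. w\<^sup>2) \<le> sqrt 2" if "ws' \<noteq> []"
        by (rule less.hyps) (use that 3 len sorted pos in auto)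
      have d0: "0 \<le> (\<Sum>w\<leftarrow>ws'. w\<^sup>2)" by (rule sum_list_nonneg) auto
      have "box_peak (w1 # w2 # ws') \<le> sqrt 2 * (74 / 75) \<or> ((\<Sum>w\<leftarrow>ws'. w\<^sup>2) \<le> 21 / 100 \<and>
          box_peak (w1 # w2 # ws') \<le> sqrt 2 * (1 - (\<Sum>w\<leftarrow>ws'. w\<^sup>2) / 27))"
        by (rule box_peak_dichotomy[OF _ _ _ _ _ IH]) (use 3 pos sorted one False in auto)
      moreover have "sqrt 2 * (74 / 75) \<le> sqrt 2 * 1" by (intro mult_left_mono) auto
      moreover have "sqrt 2 * (1 - (\<Sum>w\<leftarrow>ws'. w\<^sup>2) / 27) \<le> sqrt 2 * 1" using d0 by (intro mult_left_mono) auto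
      ultimately have "box_peak (w1 # w2 # ws') \<le> sqrt 2" by linarith
      then show ?thesis unfolding 3 .
    qed
  qed (use one in simp)
  then show ?case by (simp add: peak r_def)
qed

section \<open>Densities of sums of independent variables\<close>

context prob_space
begin

lemma distr_sum_insert:
  fixes X :: "'i \<Rightarrow> 'a \<Rightarrow> real"
  assumes "finite I" "i \<notin> I" "indep_vars (\<lambda>_. borel) X (insert i I)"
  shows "distr M borel (\<lambda>\<omega>. \<Sum>j\<in>insert i I. X j \<omega>) = (distr M borel (X i) \<star> distr M borel (\<lambda>\<omega>. \<Sum>j\<in>I. X j \<omega>))"
proof -
  have "X j \<in> borel_measurable M" if "j \<in> insert i I" for j using assms(3) that by (auto simp: indep_vars_def)
  then have "distr M borel (\<lambda>\<omega>. X i \<omega> + (\<Sum>j\<in>I. X j \<omega>)) = (distr M borel (X i) \<star> distr M borel (\<lambda>\<omega>. \<Sum>j\<in>I. X j \<omega>))"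
    by (intro sum_indep_random_variable indep_vars_sum assms borel_measurable_sum) auto
  then show ?thesis using assms by simp
qed

lemma spread_bounded_sum:
  fixes X :: "'i \<Rightarrow> 'a \<Rightarrow> real"
  assumes "is \<noteq> []" "distinct is" "indep_vars (\<lambda>_. borel) X (set is)"
    and "\<And>i. i \<in> set is \<Longrightarrow> 0 < w i"
    and "\<And>i A. i \<in> set is \<Longrightarrow> A \<in> sets borel \<Longrightarrow> ennreal (w i) * emeasure (distr M borel (X i)) A \<le> emeasure lborel A"
  shows "spread_bounded (distr M borel (\<lambda>\<omega>. \<Sum>i\<in>set is. X i \<omega>)) (box_conc (map w is))"
  using assms
proof (induction "is" rule: induct_list012)
  case (2 i)
  then have "X i \<in> borel_measurable M" by (auto simp: indep_vars_def)
  then show ?case using 2 spread_bounded_clamp[of "distr M borel (X i)" "w i"] by (simp add: prob_space_distr)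
next
  case (3 i j js)
  have m: "X k \<in> borel_measurable M" if "k \<in> set (i # j # js)" for k
    using 3(5) that by (auto simp: indep_vars_def)
  have "spread_bounded (distr M borel (\<lambda>\<omega>. \<Sum>i\<in>set (j # js). X i \<omega>)) (box_conc (map w (j # js)))"
    by (rule 3(2)) (use 3 in \<open>auto intro: indep_vars_subset\<close>)
  then have "spread_bounded (distr M borel (X i) \<star> distr M borel (\<lambda>\<omega>. \<Sum>i\<in>set (j # js). X i \<omega>))
      (window_avg (w i) (box_conc (map w (j # js))))"
    by (intro spread_bounded_convolution prob_space_distr odd_concave_box_conc)
      (use 3 m in \<open>auto intro!: borel_measurable_sum\<close>)
  also have "(distr M borel (X i) \<star> distr M borel (\<lambda>\<omega>. \<Sum>i\<in>set (j # js). X i \<omega>)) = distr M borel (\<lambda>\<omega>. \<Sum>i\<in>set (i # j # js). X i \<omega>)"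
    using distr_sum_insert[of "set (j # js)" i X] 3 by simp
  finally show ?case by simp
qed simp

text \<open>All summands but the first enter through the spread bound, and the first through the
  peak version of the convolution estimate, as in the recursion of \<open>box_peak\<close>.\<close>

lemma density_sum_le_box_peak:
  fixes X :: "'i \<Rightarrow> 'a \<Rightarrow> real"
  assumes "is \<noteq> []" "distinct is" "indep_vars (\<lambda>_. borel) X (set is)"
    and w: "\<And>i. i \<in> set is \<Longrightarrow> 0 < w i"
    and d: "\<And>i A. i \<in> set is \<Longrightarrow> A \<in> sets borel \<Longrightarrow> ennreal (w i) * emeasure (distr M borel (X i)) A \<le> emeasure lborel A"
    and A: "A \<in> sets borel" "emeasure lborel A < \<infinity>"
  shows "emeasure (distr M borel (\<lambda>\<omega>. \<Sum>i\<in>set is. X i \<omega>)) A \<le> ennreal (box_peak (map w is)) * emeasure lborel A"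
proof -
  obtain i js where "is": "is = i # js" using assms(1) by (cases "is") auto
  have m: "X k \<in> borel_measurable M" if "k \<in> set is" for k
    using assms(3) that by (auto simp: indep_vars_def)
  show ?thesis
  proof (cases js)
    case Nil
    have "ennreal (1 / w i) * (ennreal (w i) * emeasure (distr M borel (X i)) A) \<le> ennreal (1 / w i) * emeasure lborel A"
      by (intro mult_left_mono d) (use "is" A in auto)
    then show ?thesis using w[of i] "is" Nil by (simp add: mult.assoc[symmetric] ennreal_mult[symmetric])
  next
    case (Cons j js')
    have sb: "spread_bounded (distr M borel (\<lambda>\<omega>. \<Sum>i\<in>set js. X i \<omega>)) (box_conc (map w js))"
      by (rule spread_bounded_sum) (use "is" Cons assms in \<open>auto intro: indep_vars_subset\<close>)
    have "0 \<le> box_conc (map w js) (w i)"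
      by (rule odd_concave_nonneg[OF odd_concave_box_conc]) (use "is" Cons w[of i] w in \<open>auto simp: less_imp_le\<close>)
    then have "emeasure (distr M borel (X i) \<star> distr M borel (\<lambda>\<omega>. \<Sum>i\<in>set js. X i \<omega>)) A
        \<le> ennreal (box_conc (map w js) (w i) / w i) * emeasure lborel A"
      by (intro spread_bounded_convolution_peak[OF _ _ _ _ _ _ sb] prob_space_distr)
        (use "is" w d m A in \<open>auto intro!: borel_measurable_sum\<close>)
    also have "(distr M borel (X i) \<star> distr M borel (\<lambda>\<omega>. \<Sum>i\<in>set js. X i \<omega>)) = distr M borel (\<lambda>\<omega>. \<Sum>i\<in>set is. X i \<omega>)"
      using distr_sum_insert[of "set js" i X] "is" assms by simp
    also have "box_conc (map w js) (w i) / w i = box_peak (map w is)" using "is" Cons by simp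
    finally show ?thesis .
  qed
qed

text \<open>Conditioning on one summand translates the law of the other; the density bound is
  translation invariant and survives averaging.\<close>

lemma density_convolution_le:
  fixes \<mu> \<nu> :: "real measure"
  assumes "prob_space \<mu>" "prob_space \<nu>" "sets \<mu> = sets borel" "sets \<nu> = sets borel"
    and d: "\<And>A. A \<in> sets borel \<Longrightarrow> emeasure lborel A < \<infinity> \<Longrightarrow> emeasure \<nu> A \<le> c * emeasure lborel A"
    and A: "A \<in> sets borel" "emeasure lborel A < \<infinity>"
  shows "emeasure (\<mu> \<star> \<nu>) A \<le> c * emeasure lborel A"
proof -
  interpret \<mu>: prob_space \<mu> by fact
  interpret \<nu>: prob_space \<nu> by fact
  have "emeasure (\<mu> \<star> \<nu>) A = (\<integral>\<^sup>+x. \<integral>\<^sup>+y. indicator A (x + y) \<partial>\<nu> \<partial>\<mu>)"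
    by (rule convolution_emeasure') (use assms \<mu>.finite_measure_axioms \<nu>.finite_measure_axioms in auto)
  also have "\<dots> \<le> (\<integral>\<^sup>+x. c * emeasure lborel A \<partial>\<mu>)"
  proof (rule nn_integral_mono)
    fix x
    have [measurable]: "(\<lambda>y. x + y) -` A \<in> sets borel"
      using measurable_sets[of "\<lambda>y. x + y" borel borel A] A by simp
    have e: "emeasure lborel ((\<lambda>y. x + y) -` A) = emeasure lborel A"
      using nn_integral_real_affine[of "indicator A" 1 x] A by (simp add: indicator_vimage[symmetric] o_def)
    have "(\<integral>\<^sup>+y. indicator A (x + y) \<partial>\<nu>) = (\<integral>\<^sup>+y. indicator ((\<lambda>y. x + y) -` A) y \<partial>\<nu>)"
      by (simp add: indicator_def)
    also have "\<dots> = emeasure \<nu> ((\<lambda>y. x + y) -` A)" using assms(4) by simp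
    also have "\<dots> \<le> c * emeasure lborel A" using d[of "(\<lambda>y. x + y) -` A"] A by (simp add: e)
    finally show "(\<integral>\<^sup>+y. indicator A (x + y) \<partial>\<nu>) \<le> c * emeasure lborel A" .
  qed
  also have "\<dots> = c * emeasure lborel A" by (simp add: \<mu>.emeasure_space_1)
  finally show ?thesis .
qed

text \<open>Admits summands without a bounded density, the set \<open>K\<close>: adding an
  independent summand cannot raise a density bound.\<close>

lemma density_sum_mono:
  fixes X :: "'i \<Rightarrow> 'a \<Rightarrow> real"
  assumes "finite K" "finite J" "J \<inter> K = {}" "indep_vars (\<lambda>_. borel) X (J \<union> K)"
    and d: "\<And>A. A \<in> sets borel \<Longrightarrow> emeasure lborel A < \<infinity> \<Longrightarrow>
        emeasure (distr M borel (\<lambda>\<omega>. \<Sum>i\<in>J. X i \<omega>)) A \<le> c * emeasure lborel A"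
    and A: "A \<in> sets borel" "emeasure lborel A < \<infinity>"
  shows "emeasure (distr M borel (\<lambda>\<omega>. \<Sum>i\<in>J \<union> K. X i \<omega>)) A \<le> c * emeasure lborel A"
  using assms(1,3,4) A
proof (induction K arbitrary: A rule: finite_induct)
  case (insert k K)
  have m: "X i \<in> borel_measurable M" if "i \<in> insert k (J \<union> K)" for i
    using insert(5) that by (auto simp: indep_vars_def)
  have "emeasure (distr M borel (X k) \<star> distr M borel (\<lambda>\<omega>. \<Sum>i\<in>J \<union> K. X i \<omega>)) A \<le> c * emeasure lborel A"
  proof (rule density_convolution_le)
    fix B :: "real set" assume "B \<in> sets borel" "emeasure lborel B < \<infinity>"
    then show "emeasure (distr M borel (\<lambda>\<omega>. \<Sum>i\<in>J \<union> K. X i \<omega>)) B \<le> c * emeasure lborel B"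
      by (intro insert.IH) (use insert in \<open>auto intro: indep_vars_subset\<close>)
  qed (use m insert in \<open>auto intro!: prob_space_distr borel_measurable_sum\<close>)
  also have "(distr M borel (X k) \<star> distr M borel (\<lambda>\<omega>. \<Sum>i\<in>J \<union> K. X i \<omega>)) = distr M borel (\<lambda>\<omega>. \<Sum>i\<in>insert k (J \<union> K). X i \<omega>)"
    by (rule distr_sum_insert[symmetric]) (use insert assms(2) in auto)
  finally show ?case by simp
qed (use d in simp)

text \<open>A zero constant would make every bounded interval null, and these exhaust the line. This
  keeps the reciprocal of a finite maximal density meaningful.\<close>

lemma density_bound_nonzero:
  fixes X :: "'a \<Rightarrow> real"
  assumes X: "X \<in> borel_measurable M"
    and d: "\<And>A. A \<in> sets borel \<Longrightarrow> emeasure lborel A < \<infinity> \<Longrightarrow> emeasure (distr M borel X) A \<le> c * emeasure lborel A"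
  shows "c \<noteq> 0"
proof
  assume c: "c = 0"
  have "emeasure (distr M borel X) (\<Union>n. {- real n..real n}) = 0"
  proof (rule emeasure_UN_eq_0)
    fix n :: nat show "emeasure (distr M borel X) {- real n..real n} = 0"
      using d[of "{- real n..real n}"] c by simp
  qed auto
  moreover have "(\<Union>n. {- real n..real n}) = UNIV"
  proof -
    have "\<exists>n. - real n \<le> x \<and> x \<le> real n" for x
    proof -
      obtain n :: nat where "\<bar>x\<bar> \<le> real n" using real_arch_simple by blast
      then show ?thesis by (intro exI[of _ n]) (auto simp: abs_le_iff)
    qed
    then show ?thesis by auto
  qed
  moreover have "emeasure (distr M borel X) UNIV = 1"
    using X emeasure_space_1 by (simp add: emeasure_distr)
  ultimately show False by simp
qed

text \<open>The infimum is attained: for a set of positive finite measure, probability over measure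
  is a lower bound for all admissible constants. For a null set any one admissible constant will
  do.\<close>

lemma emeasure_le_max_density:
  assumes X: "X \<in> borel_measurable M" and fin: "max_density M X < \<infinity>"
    and A: "A \<in> sets borel" "emeasure lborel A < \<infinity>"
  shows "emeasure (distr M borel X) A \<le> max_density M X * emeasure lborel A"
proof -
  define S where "S = {c. \<forall>A \<in> sets (borel :: real measure). emeasure M {\<omega> \<in> space M. X \<omega> \<in> A} \<le> c * emeasure lborel A}"
  have e: "emeasure (distr M borel X) A = emeasure M {\<omega> \<in> space M. X \<omega> \<in> A}"
    using X A by (simp add: emeasure_distr vimage_def Int_def conj_commute)
  have le: "emeasure (distr M borel X) A \<le> c * emeasure lborel A" if "c \<in> S" for c
    unfolding e using that A by (auto simp: S_def)
  show ?thesis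
  proof (cases "emeasure lborel A = 0")
    case True
    have "S \<noteq> {}" using fin unfolding max_density_def S_def[symmetric] by (auto simp: top_ennreal.rep_eq)
    then show ?thesis using le True by fastforce
  next
    case False
    then obtain v where v: "emeasure lborel A = ennreal v" "0 < v"
      using A by (cases "emeasure lborel A") (auto simp: less_le)
    have "emeasure (distr M borel X) A / ennreal v \<le> Inf S"
    proof (rule Inf_greatest)
      fix c assume "c \<in> S"
      then show "emeasure (distr M borel X) A / ennreal v \<le> c"
        using le[of c] v divide_right_mono_ennreal[of _ "c * ennreal v" "ennreal v"]
        by (simp add: ennreal_mult_divide_eq)
    qed
    then have "emeasure (distr M borel X) A / ennreal v * ennreal v \<le> Inf S * ennreal v"
      by (rule mult_right_mono) simp
    also have "emeasure (distr M borel X) A / ennreal v * ennreal v = emeasure (distr M borel X) A * ennreal v / ennreal v"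
      by (simp only: mult.commute[of _ "ennreal v"] ennreal_times_divide)
    also have "\<dots> = emeasure (distr M borel X) A" by (rule ennreal_mult_divide_eq) (use v in auto)
    finally show ?thesis unfolding max_density_def S_def[symmetric] v(1) .
  qed
qed

text \<open>The root of the min-entropy power is the reciprocal of the maximal density: the length
  of the interval whose uniform law has that density. It serves as the weight of the
  summand.\<close>

lemma min_entropy_power_density:
  assumes X: "X \<in> borel_measurable M" and N: "0 < min_entropy_power M X" and A: "A \<in> sets borel"
  shows "ennreal (sqrt (min_entropy_power M X)) * emeasure (distr M borel X) A \<le> emeasure lborel A"
proof (cases "emeasure lborel A < \<infinity>")
  case True
  have fin: "max_density M X < \<infinity>" using N by (auto simp: min_entropy_power_def split: if_splits)
  then obtain m where m: "max_density M X = ennreal m" "0 \<le> m" by (cases "max_density M X") auto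
  have m0: "0 < m" using N m by (cases "m = 0") (auto simp: min_entropy_power_def)
  have w: "sqrt (min_entropy_power M X) = 1 / m"
    using m m0 by (simp add: min_entropy_power_def real_sqrt_divide)
  have "ennreal (1 / m) * emeasure (distr M borel X) A \<le> ennreal (1 / m) * (ennreal m * emeasure lborel A)"
    using emeasure_le_max_density[OF X fin A True] m by (intro mult_left_mono) auto
  then show ?thesis unfolding w using m0 by (simp add: mult.assoc[symmetric] ennreal_mult[symmetric])
qed (simp add: less_top[symmetric])

lemma min_entropy_power_scaled_ge:
  assumes X: "X \<in> borel_measurable M" and a: "0 < a" and c: "0 \<le> c"
    and d: "\<And>A. A \<in> sets borel \<Longrightarrow> emeasure lborel A < \<infinity> \<Longrightarrow> emeasure (distr M borel X) A \<le> ennreal c * emeasure lborel A"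
  shows "0 < c" and "(a / c)\<^sup>2 \<le> min_entropy_power M (\<lambda>\<omega>. a * X \<omega>)"
proof -
  show c0: "0 < c" using density_bound_nonzero[OF X d] c by (cases "c = 0") auto
  have aX: "(\<lambda>\<omega>. a * X \<omega>) \<in> borel_measurable M" using X by simp
  have le: "max_density M (\<lambda>\<omega>. a * X \<omega>) \<le> ennreal (c / a)" unfolding max_density_def
  proof (rule Inf_lower, rule CollectI, rule ballI)
    fix A :: "real set" assume A: "A \<in> sets borel"
    show "emeasure M {\<omega> \<in> space M. a * X \<omega> \<in> A} \<le> ennreal (c / a) * emeasure lborel A"
    proof (cases "emeasure lborel A < \<infinity>")
      case True
      define B where "B = (\<lambda>x. a * x) -` A"
      have B: "B \<in> sets borel" unfolding B_def using measurable_sets[of "\<lambda>x. a * x" borel borel A] A by simp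
      have eB: "emeasure lborel B = ennreal (1 / a) * emeasure lborel A"
      proof -
        have "emeasure lborel B = (\<integral>\<^sup>+t. indicator B t \<partial>lborel)"
          using B by (intro nn_integral_indicator[symmetric]) simp
        also have "\<dots> = (\<integral>\<^sup>+t. indicator A (a * t) \<partial>lborel)" by (simp add: B_def indicator_def)
        also have "\<dots> = ennreal (1 / a) * (\<integral>\<^sup>+t. indicator A t \<partial>lborel)"
          by (rule nn_integral_scale) (use A a in auto)
        finally show ?thesis using A by simp
      qed
      have "emeasure M {\<omega> \<in> space M. a * X \<omega> \<in> A} = emeasure (distr M borel X) B"
        using X B by (simp add: emeasure_distr B_def vimage_def Int_def conj_commute)
      also have "\<dots> \<le> ennreal c * emeasure lborel B"
        by (rule d[OF B]) (use True in \<open>simp add: eB ennreal_mult_less_top\<close>)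
      also have "\<dots> = ennreal (c / a) * emeasure lborel A"
        unfolding eB using a c by (simp add: mult.assoc[symmetric] ennreal_mult[symmetric])
      finally show ?thesis .
    next
      \<comment> \<open>Here \<open>0 < c\<close> matters: it makes the right side infinite.\<close>
      case False
      then have "emeasure lborel A = \<infinity>" by (simp add: less_top[symmetric])
      then show ?thesis using a c0 by (simp add: ennreal_mult_top)
    qed
  qed
  then have fin: "max_density M (\<lambda>\<omega>. a * X \<omega>) < \<infinity>" by (rule order.strict_trans1) simp
  then obtain m where m: "max_density M (\<lambda>\<omega>. a * X \<omega>) = ennreal m" "0 \<le> m"
    by (cases "max_density M (\<lambda>\<omega>. a * X \<omega>)") auto
  have "max_density M (\<lambda>\<omega>. a * X \<omega>) \<noteq> 0"
    by (rule density_bound_nonzero[OF aX emeasure_le_max_density[OF aX fin]])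
  then have m0: "0 < m" using m by (cases "m = 0") auto
  have "m \<le> c / a" using le m a c by simp
  then have "a / c \<le> 1 / m" using a c0 m0 by (simp add: field_simps)
  then have "(a / c)\<^sup>2 \<le> (1 / m)\<^sup>2" using a c0 by (intro power_mono) auto
  also have "\<dots> = min_entropy_power M (\<lambda>\<omega>. a * X \<omega>)"
    using m m0 by (simp add: min_entropy_power_def power_divide)
  finally show "(a / c)\<^sup>2 \<le> min_entropy_power M (\<lambda>\<omega>. a * X \<omega>)" .
qed

end

text \<open>The shares of the two largest summands and of the rest. The lower share loses
  \<open>27 + 21 / 20 = 28.05\<close> times \<epsilon>, while
  \<open>(1 - 37.5 * \<epsilon>)\<^sup>2 / 2\<close> allows for \<open>28.125\<close> times
  \<epsilon> once \<open>\<epsilon>\<^sup>2 \<le> \<epsilon> / 75\<close> is used. This explains the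
  constant 27 in the deficit.\<close>

lemma conclusion_numeric:
  fixes x z d \<epsilon> :: real
  assumes sum: "x + z + d = 1" and "z \<le> x" and e: "0 < \<epsilon>" "\<epsilon> < 1 / 75" and x: "(1 - \<epsilon>)\<^sup>2 * (2 * x) \<le> 1"
    and d: "0 \<le> d" "d \<le> 27 * \<epsilon>"
  shows "x \<le> (1 + 2 * \<epsilon>)\<^sup>2 * (1 / 2)" and "(1 - 37.5 * \<epsilon>)\<^sup>2 * (1 / 2) \<le> z"
proof -
  \<comment> \<open>A linear upper bound for the reciprocal of
    \<open>(1 - \<epsilon>)\<^sup>2\<close>; the slope 2.1, slightly above the derivative 2,
    suffices on this range.\<close>
  have "1 \<le> (1 - \<epsilon>)\<^sup>2 * (1 + 21 / 10 * \<epsilon>)"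
  proof -
    have "0 \<le> \<epsilon> * (1 / 10 - 32 / 10 * \<epsilon>) + 21 / 10 * \<epsilon> ^ 3" using e by (intro add_nonneg_nonneg mult_nonneg_nonneg) auto
    then show ?thesis by (simp add: power2_eq_square power3_eq_cube field_simps)
  qed
  then have "(1 - \<epsilon>)\<^sup>2 * (2 * x) \<le> (1 - \<epsilon>)\<^sup>2 * (1 + 21 / 10 * \<epsilon>)" using x by linarith
  then have x': "2 * x \<le> 1 + 21 / 10 * \<epsilon>" using e by (simp add: mult_le_cancel_left)
  also have "\<dots> \<le> (1 + 2 * \<epsilon>)\<^sup>2" using e by (simp add: power2_eq_square algebra_simps)
  finally show "x \<le> (1 + 2 * \<epsilon>)\<^sup>2 * (1 / 2)" by simp
  have "1 / 2 - 75 / 2 * \<epsilon> + 5625 / 8 * q \<le> 1 - 27 * \<epsilon> - (1 + 21 / 10 * \<epsilon>) / 2" if "q \<le> \<epsilon> * (1 / 75)" for q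
    using that e by (simp add: field_simps)
  moreover have "\<epsilon> * \<epsilon> \<le> \<epsilon> * (1 / 75)" using e by (intro mult_left_mono) auto
  moreover have "(1 - 37.5 * \<epsilon>)\<^sup>2 * (1 / 2) = 1 / 2 - 75 / 2 * \<epsilon> + 5625 / 8 * (\<epsilon> * \<epsilon>)"
    by (simp add: power2_eq_square field_simps)
  ultimately have "(1 - 37.5 * \<epsilon>)\<^sup>2 * (1 / 2) \<le> 1 - 27 * \<epsilon> - (1 + 21 / 10 * \<epsilon>) / 2"
    by metis
  also have "\<dots> \<le> z" using x' sum d by argo
  finally show "(1 - 37.5 * \<epsilon>)\<^sup>2 * (1 / 2) \<le> z" .
qed

theorem corollary6:
  fixes P :: "'a measure" and X :: "nat \<Rightarrow> 'a \<Rightarrow> real" and n :: nat and \<epsilon> :: real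
  assumes "prob_space P"
    and "n \<ge> 1"
    and "prob_space.indep_vars P (\<lambda>_. borel) X {1..n}"
    and "0 < \<epsilon>" and "\<epsilon> < 1 / 75"
    and "min_entropy_power P (\<lambda>\<omega>. (1 - \<epsilon>) * (\<Sum>i=1..n. X i \<omega>))
           \<le> 1 / 2 * (\<Sum>i=1..n. min_entropy_power P (X i))"
  shows "\<exists>i0 \<in> {1..n}. \<exists>i1 \<in> {1..n}.
           (n \<ge> 2 \<longrightarrow> i0 \<noteq> i1) \<and>
           (\<forall>j \<in> {i0, i1}.
              (1 - 37.5 * \<epsilon>)\<^sup>2 * (1 / 2 * (\<Sum>i=1..n. min_entropy_power P (X i)))
                \<le> min_entropy_power P (X j) \<and>
              min_entropy_power P (X j)
                \<le> (1 + 2 * \<epsilon>)\<^sup>2 * (1 / 2 * (\<Sum>i=1..n. min_entropy_power P (X i)))) \<and>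
           (\<Sum>i \<in> {1..n} - {i0, i1}. min_entropy_power P (X i))
             \<le> 50 * \<epsilon> * (\<Sum>i=1..n. min_entropy_power P (X i))"
proof -
  interpret prob_space P by fact
  define N where "N i = min_entropy_power P (X i)" for i
  define S where "S = (\<Sum>i=1..n. N i)"
  have N0: "0 \<le> N i" for i by (simp add: N_def min_entropy_power_def)
  have S0: "0 \<le> S" unfolding S_def by (intro sum_nonneg N0)
  have m: "X i \<in> borel_measurable P" if "i \<in> {1..n}" for i
    using assms(3) that by (auto simp: indep_vars_def)
  have goal: "\<exists>i0 \<in> {1..n}. \<exists>i1 \<in> {1..n}. (n \<ge> 2 \<longrightarrow> i0 \<noteq> i1) \<and>
      (\<forall>j \<in> {i0, i1}. (1 - 37.5 * \<epsilon>)\<^sup>2 * (1 / 2 * S) \<le> N j \<and> N j \<le> (1 + 2 * \<epsilon>)\<^sup>2 * (1 / 2 * S)) \<and>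
      (\<Sum>i \<in> {1..n} - {i0, i1}. N i) \<le> 50 * \<epsilon> * S"
  proof (cases "S = 0")
    case True
    then have z: "N i = 0" if "i \<in> {1..n}" for i
      using sum_nonneg_eq_0_iff[of "{1..n}" N] N0 that by (auto simp: S_def)
    \<comment> \<open>In the degenerate case any two indices serve, and \<open>min n 2\<close>
      differs from 1 as soon as \<open>n \<ge> 2\<close>.\<close>
    have "(\<Sum>i \<in> {1..n} - {1, min n 2}. N i) = 0" by (rule sum.neutral) (use z in auto)
    then show ?thesis using assms(2) True z
      by (intro bexI[of _ 1] bexI[of _ "min n 2"]) (auto simp: min_def)
  next
    case False
    then have S: "0 < S" using S0 by simp
    define w where "w i = sqrt (N i)" for i
    \<comment> \<open>Only these summands have a bounded density and a positive weight; the others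
      are restored by \<open>density_sum_mono\<close>.\<close>
    define J where "J = {i \<in> {1..n}. 0 < N i}"
    \<comment> \<open>The key is negated to list the weights in decreasing order.\<close>
    define L where "L = sort_key (\<lambda>i. - w i) (sorted_list_of_set J)"
    have J: "finite J" "J \<subseteq> {1..n}" by (auto simp: J_def)
    have L: "set L = J" "distinct L" using J by (simp_all add: L_def)
    have SJ: "S = (\<Sum>i\<in>J. N i)" unfolding S_def J_def
      by (rule sum.mono_neutral_right) (use N0 in \<open>auto simp: less_le\<close>)
    have Lne: "L \<noteq> []" using L S SJ by auto
    have w2: "(w i)\<^sup>2 = N i" for i using N0 by (simp add: w_def)
    have wpos: "0 < w i" if "i \<in> set L" for i using that L by (simp add: w_def J_def)
    have ind: "indep_vars (\<lambda>_. borel) X (set L)"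
      by (rule indep_vars_subset[OF assms(3)]) (use L J in auto)
    have dens: "ennreal (w i) * emeasure (distr P borel (X i)) A \<le> emeasure lborel A"
      if "i \<in> set L" "A \<in> sets borel" for i A
    proof -
      have "i \<in> {1..n}" "0 < min_entropy_power P (X i)" using that(1) L(1) by (auto simp: J_def N_def)
      then show ?thesis unfolding w_def N_def by (intro min_entropy_power_density m that(2))
    qed
    define c where "c = box_peak (map w L)"
    have JU: "J \<union> ({1..n} - J) = {1..n}" using J by auto
    have sumle: "emeasure (distr P borel (\<lambda>\<omega>. \<Sum>i=1..n. X i \<omega>)) A \<le> ennreal c * emeasure lborel A"
      if A: "A \<in> sets borel" "emeasure lborel A < \<infinity>" for A
    proof -
      have "emeasure (distr P borel (\<lambda>\<omega>. \<Sum>i\<in>J \<union> ({1..n} - J). X i \<omega>)) A \<le> ennreal c * emeasure lborel A"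
      proof (rule density_sum_mono[OF _ J(1) _ _ _ A])
        fix B :: "real set" assume B: "B \<in> sets borel" "emeasure lborel B < \<infinity>"
        have "emeasure (distr P borel (\<lambda>\<omega>. \<Sum>i\<in>set L. X i \<omega>)) B \<le> ennreal c * emeasure lborel B"
          unfolding c_def by (rule density_sum_le_box_peak[OF Lne L(2) ind wpos dens B])
        then show "emeasure (distr P borel (\<lambda>\<omega>. \<Sum>i\<in>J. X i \<omega>)) B \<le> ennreal c * emeasure lborel B"
          unfolding L(1) .
      next
        show "indep_vars (\<lambda>_. borel) X (J \<union> ({1..n} - J))" unfolding JU by (rule assms(3))
      qed auto
      then show ?thesis unfolding JU .
    qed
    have c0: "0 \<le> c" unfolding c_def
    proof (cases "map w L" rule: box_peak.cases)
      case (3 v v' vs)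
      have vp: "0 < u" if "u \<in> set (map w L)" for u using that wpos by auto
      have "0 \<le> box_conc (v' # vs) v"
        by (rule odd_concave_nonneg[OF odd_concave_box_conc]) (use vp 3 in \<open>auto simp: less_imp_le\<close>)
      then show "0 \<le> box_peak (map w L)" using vp[of v] 3 by simp
    next
      case (2 v)
      then show "0 \<le> box_peak (map w L)" using wpos by (cases L) (auto simp: less_imp_le)
    qed simp
    note low = min_entropy_power_scaled_ge[of "\<lambda>\<omega>. \<Sum>i=1..n. X i \<omega>" "1 - \<epsilon>" c, OF _ _ c0 sumle]
    have cpos: "0 < c" by (rule low(1)) (use m assms in auto)
    have "((1 - \<epsilon>) / c)\<^sup>2 \<le> min_entropy_power P (\<lambda>\<omega>. (1 - \<epsilon>) * (\<Sum>i=1..n. X i \<omega>))"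
      by (rule low(2)) (use m assms in auto)
    also have "\<dots> \<le> S / 2" using assms(6) by (simp add: S_def N_def)
    finally have hyp: "((1 - \<epsilon>) / c)\<^sup>2 \<le> S / 2" .
    define r where "r = sqrt S"
    have r: "0 < r" "r\<^sup>2 = S" using S by (simp_all add: r_def)
    \<comment> \<open>By homogeneity this is the peak for weights of square sum 1, and the
      hypothesis becomes a lower bound for it.\<close>
    define F where "F = c * r"
    have F: "sqrt 2 * (1 - \<epsilon>) \<le> F"
    proof (rule power2_le_imp_le)
      have "(1 - \<epsilon>)\<^sup>2 \<le> S / 2 * c\<^sup>2" using hyp cpos by (simp add: power_divide field_simps)
      then show "(sqrt 2 * (1 - \<epsilon>))\<^sup>2 \<le> F\<^sup>2" using r by (simp add: F_def power_mult_distrib mult_ac)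
      show "0 \<le> F" using cpos r by (simp add: F_def)
    qed
    define a where "a i = w i / r" for i
    have a2: "(a i)\<^sup>2 = N i / S" for i using r by (simp add: a_def power_divide w2)
    have apos: "0 < a i" if "i \<in> set L" for i using wpos[OF that] r by (simp add: a_def)
    have Fa: "F = box_peak (map a L)"
    proof -
      have e1: "map a L = map ((*) (1 / r)) (map w L)" by (simp add: a_def)
      have e2: "box_peak (map ((*) (1 / r)) (map w L)) = c / (1 / r)"
        unfolding c_def by (rule box_peak_scale) (use r wpos in auto)
      show ?thesis unfolding e1 e2 F_def using r(1) by simp
    qed
    have sorted: "sorted_wrt (\<lambda>i j. a j \<le> a i) L"
    proof -
      have "sorted (map (\<lambda>i. - w i) L)" by (simp add: L_def)
      then show ?thesis using r(1) by (simp add: sorted_map a_def divide_le_cancel)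
    qed
    have Lsum: "(\<Sum>i\<leftarrow>L. (a i)\<^sup>2) = 1"
    proof -
      have "(\<Sum>i\<leftarrow>L. (a i)\<^sup>2) = (\<Sum>i\<in>J. N i / S)" using L by (simp add: sum_list_distinct_conv_sum_set a2)
      also have "\<dots> = 1" using S SJ by (simp add: sum_divide_distrib[symmetric])
      finally show ?thesis .
    qed
    have large: "sqrt 2 * (74 / 75) < F"
    proof -
      have "sqrt 2 * (74 / 75) < sqrt 2 * (1 - \<epsilon>)" using assms by simp
      then show ?thesis using F by linarith
    qed
    obtain i0 L' where L0: "L = i0 # L'" using Lne by (cases L) auto
    have "F \<le> 1 / a i0" unfolding Fa L0 list.map by (rule box_peak_le_inverse_hd) (use apos L0 in auto)
    then have "F * a i0 \<le> 1" using apos[of i0] L0 by (simp add: field_simps)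
    then have "sqrt 2 * (1 - \<epsilon>) * a i0 \<le> 1"
      using apos[of i0] L0 by (intro order_trans[OF mult_right_mono[OF F]]) simp_all
    then have "(sqrt 2 * (1 - \<epsilon>) * a i0)\<^sup>2 \<le> 1\<^sup>2" using assms apos[of i0] L0 by (intro power_mono) auto
    then have x1: "(1 - \<epsilon>)\<^sup>2 * (2 * (a i0)\<^sup>2) \<le> 1" by (simp add: power_mult_distrib mult_ac)
    \<comment> \<open>\<open>5137 / 10000\<close> is just above
      \<open>(75 / 74)\<^sup>2 / 2\<close>.\<close>
    have x2: "(a i0)\<^sup>2 \<le> 5137 / 10000"
    proof -
      have "(74 / 75)\<^sup>2 \<le> (1 - \<epsilon>)\<^sup>2" using assms by (intro power_mono) auto
      then have "(74 / 75)\<^sup>2 * (2 * (a i0)\<^sup>2) \<le> (1 - \<epsilon>)\<^sup>2 * (2 * (a i0)\<^sup>2)" by (intro mult_right_mono) auto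
      from order_trans[OF this x1] show ?thesis by (simp add: power_divide)
    qed
    \<comment> \<open>A single weight would have square 1, contradicting the bound on the first; so
      a second index exists.\<close>
    obtain i1 R where L1: "L' = i1 # R"
      using Lsum x2 L0 by (cases L') auto
    define d where "d = (\<Sum>i\<leftarrow>R. (a i)\<^sup>2)"
    have d0: "0 \<le> d" unfolding d_def by (rule sum_list_nonneg) auto
    have sum1: "(a i0)\<^sup>2 + (a i1)\<^sup>2 + d = 1" using Lsum L0 L1 by (simp add: d_def)
    have "box_peak (a i0 # a i1 # map a R) \<le> sqrt 2 * (74 / 75) \<or>
       ((\<Sum>v\<leftarrow>map a R. v\<^sup>2) \<le> 21 / 100 \<and> box_peak (a i0 # a i1 # map a R) \<le> sqrt 2 * (1 - (\<Sum>v\<leftarrow>map a R. v\<^sup>2) / 27))"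
    proof (rule box_peak_dichotomy)
      show "box_peak (map a R) * sqrt (\<Sum>v\<leftarrow>map a R. v\<^sup>2) \<le> sqrt 2" if "map a R \<noteq> []"
        by (rule ball_box_peak[OF that]) (use sorted apos L0 L1 in \<open>auto simp: sorted_wrt_map\<close>)
    qed (use sorted apos L0 L1 sum1 x2 in \<open>auto simp: d_def o_def\<close>)
    \<comment> \<open>The first alternative is excluded by \<open>large\<close>, which rests on
      \<open>\<epsilon> < 1 / 75\<close>.\<close>
    then have "F \<le> sqrt 2 * (1 - d / 27)" using large unfolding Fa L0 L1 d_def by (simp add: o_def del: box_peak.simps)
    then have "sqrt 2 * (1 - \<epsilon>) \<le> sqrt 2 * (1 - d / 27)" using F by linarith
    then have d27: "d \<le> 27 * \<epsilon>" by simp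
    have ge: "(a i1)\<^sup>2 \<le> (a i0)\<^sup>2"
      using sorted apos[of i1] L0 L1 by (intro power_mono) auto
    note fin = conclusion_numeric[OF sum1 ge assms(4,5) x1 d0 d27]
    have Na: "N i = S * (a i)\<^sup>2" for i using S by (simp add: a2)
    have Z: "(1 - 37.5 * \<epsilon>)\<^sup>2 * (1 / 2 * S) \<le> N i1" and U: "N i0 \<le> (1 + 2 * \<epsilon>)\<^sup>2 * (1 / 2 * S)"
      using mult_left_mono[OF fin(2), of S] mult_left_mono[OF fin(1), of S] S by (simp_all add: Na mult_ac)
    have "N i1 \<le> N i0" using ge S by (simp add: Na)
    moreover have "(\<Sum>i \<in> {1..n} - {i0, i1}. N i) \<le> 50 * \<epsilon> * S"
    proof -
      have "(\<Sum>i \<in> {1..n} - {i0, i1}. N i) = (\<Sum>i \<in> J - {i0, i1}. N i)"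
        by (rule sum.mono_neutral_right) (use N0 in \<open>auto simp: J_def less_le\<close>)
      also have "J - {i0, i1} = set R" using L L0 L1 by auto
      also have "(\<Sum>i\<in>set R. N i) = (\<Sum>i\<in>set R. S * (a i)\<^sup>2)" by (simp only: Na)
      also have "\<dots> = S * d" using L L0 L1 by (simp add: d_def sum_list_distinct_conv_sum_set sum_distrib_left)
      also have "\<dots> \<le> S * (50 * \<epsilon>)" using S d27 assms by (intro mult_left_mono) auto
      finally show ?thesis by (simp add: mult_ac)
    qed
    moreover have "i0 \<in> {1..n}" "i1 \<in> {1..n}" "i0 \<noteq> i1" using L L0 L1 J by auto
    ultimately show ?thesis using Z U
      by (intro bexI[of _ i0] bexI[of _ i1]) auto
  qed
  then show ?thesis unfolding N_def S_def .
qed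

end
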